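(* Let $(X,d,\mu)$ be a space of homogeneous type satisfying the standing assumptions in the context. Let $1<p<\infty$, $0<\lambda<1$, $0<\alpha<(1-\lambda)/p$, and let $q$ be defined by $\frac1p-\frac1q=\frac{\alpha}{1-\lambda}$. Suppose that $\theta_1>0$ and $\theta_2\ge\theta_1\left[1+\frac{\alpha q}{1-\lambda}\right]$. Let $A_1$ and $A_2$ be continuous non-negative non-decreasing functions on $(0,p-1]$ and $(0,q-1]$ respectively, satisfying: (i) $A_2\in C^1((0,\delta])$ for some $\delta>0$; (ii) $\lim_{x\to0+}A_2(x)=0$; (iii) the limit $B:=\lim_{x\to0+}\frac{d}{dx}A_2(x)$ exists and $0\le B<\frac{(1-\lambda)^2}{\alpha q^2}$; (iv) $A_1(\eta)=A_2(\bar\phi^{-1}(\eta))$, where $\bar\phi^{-1}$ is the inverse, on $(0,\delta]$ for some $\delta>0$, of the function $$\bar\phi(x)=p+\frac{(x-q)(1-\lambda+A_2(x))}{1-\lambda+A_2(x)-\alpha(x-q)}.$$ Let $I^\alpha$ be the potential operator on $X$ and let $b\in\mathrm{BMO}(X,\mu)$. Then the commutator $[b,I^\alpha]f=b\,I^\alpha(f)-I^\alpha(bf)$ is bounded from $L^{p),\lambda)}_{\theta_1,A_1}(X,\mu)$ to $L^{q),\lambda)}_{\theta_2,A_2}(X,\mu)$; that is, there is a constant $C>0$ such that $$\|[b,I^\alpha]f\|_{L^{q),\lambda)}_{\theta_2,A_2}(X,\mu)}\le C\,\|f\|_{L^{p),\lambda)}_{\theta_1,A_1}(X,\mu)}\qquad\text{for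 all } f\in L^{p),\lambda)}_{\theta_1,A_1}(X,\mu).$$
   Context: Standing assumptions on $(X,d,\mu)$. $X$ is a topological space with a complete positive measure $\mu$ such that compactly supported continuous functions are dense in $L^1(X,\mu)$. $d:X\times X\to[0,\infty)$ is a quasimetric: $d(x,y)=0$ iff $x=y$; $d(x,y)\le C_t[d(x,z)+d(z,y)]$; $d(x,y)\le C_s d(y,x)$, for constants $C_t,C_s>0$. Write $B(x,r)=\{y\in X:d(x,y)<r\}$; balls are measurable with $\mu B(x,r)<\infty$, and every neighborhood of $x$ contains some ball $B(x,r)$, $r>0$. Let $d_X$ be the diameter of $X$, assumed finite. $\mu$ is doubling: $\mu B(x,2r)\le C_d\,\mu B(x,r)$ for all $x\in X$, $0<r<d_X$, with $C_d>1$ independent of $x,r$. Moreover $\mu(B(x,R)\setminus B(x,r))>0$ for all $x\in X$, $0<r<R<d_X$. Finally $\mu$ is upper $\gamma$-Ahlfors regular for some $\gamma>0$: $\mu B(x,r)\le c\,r^\gamma$ with $c$ independent of $x,r$. Morrey space. For $1\le q<\infty$, $0\le\nu<1$: $\|f\|_{L^{q,\nu}(X,\mu)}=\sup_{x\in X,\,0<r<d_X}\big(\mu B(x,r)^{-\nu}\int_{B(x,r)}|f|^q\,d\mu\big)^{1/q}$. Generalized grand Morrey space. For $1<p<\infty$, $0\le\lambda<1$, $\theta>0$ and $A$ non-decreasing, non-negative, with $\lim_{x\to0+}A(x)=0$, the space $L^{p),\lambda)}_{\theta,A}(X,\mu)$ consists of the measurable $f$ with $$\|f\|_{L^{p),\lambda)}_{\theta,A}(X,\mu)}=\sup_{0<\varepsilon<s_{\max}}\varepsilon^{\frac{\theta}{p-\varepsilon}}\|f\|_{L^{p-\varepsilon,\lambda-A(\varepsilon)}(X,\mu)}<\infty,\quad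 s_{\max}=\min\{p-1,a\},\ a=\sup\{x>0:A(x)\le\lambda\}.$$ BMO. $\mathrm{BMO}(X,\mu)$ is the set of real-valued locally integrable $b$ with $\|b\|_{\mathrm{BMO}}=\sup_{x\in X,\,0<r<d_X}\frac1{\mu B(x,r)}\int_{B(x,r)}|b-b_{B(x,r)}|\,d\mu<\infty$, where $b_B$ is the integral average of $b$ over $B$. Potential operator. For $0<\alpha<1$, $I^\alpha f(x)=\int_X\frac{f(y)}{\mu B(x,d(x,y))^{1-\alpha}}\,d\mu(y)$.
   Formalization: The norm inequality holds as stated (lower integrals if the commutator is not measurable), but that the commutator lies in the target space is claimed only when d is jointly measurable on X×X; without this it can fail to be measurable. *)

theory Defs
  imports "HOL-Analysis.Analysis"
begin

section \<open>Spaces of homogeneous type\<close>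

text \<open>The underlying set is always \<^term>\<open>space M\<close>, and \<^term>\<open>d\<close> is only ever evaluated on it.\<close>

definition qball :: "'a measure \<Rightarrow> ('a \<Rightarrow> 'a \<Rightarrow> real) \<Rightarrow> 'a \<Rightarrow> real \<Rightarrow> 'a set" where
  "qball M d x r = {y \<in> space M. d x y < r}"

definition qdiam :: "'a measure \<Rightarrow> ('a \<Rightarrow> 'a \<Rightarrow> real) \<Rightarrow> real" where
  "qdiam M d = Sup {d x y | x y. x \<in> space M \<and> y \<in> space M}"

definition quasimetric_on :: "'a set \<Rightarrow> ('a \<Rightarrow> 'a \<Rightarrow> real) \<Rightarrow> bool" where
  "quasimetric_on X d \<longleftrightarrow>
     (\<forall>x\<in>X. \<forall>y\<in>X. 0 \<le> d x y) \<and>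
     (\<forall>x\<in>X. \<forall>y\<in>X. d x y = 0 \<longleftrightarrow> x = y) \<and>
     (\<exists>Ct>0. \<forall>x\<in>X. \<forall>y\<in>X. \<forall>z\<in>X. d x y \<le> Ct * (d x z + d z y)) \<and>
     (\<exists>Cs>0. \<forall>x\<in>X. \<forall>y\<in>X. d x y \<le> Cs * d y x)"

definition compactly_supported_continuous :: "'a topology \<Rightarrow> ('a \<Rightarrow> real) \<Rightarrow> bool" where
  "compactly_supported_continuous T \<phi> \<longleftrightarrow>
     continuous_map T euclideanreal \<phi> \<and>
     compactin T (T closure_of {x \<in> topspace T. \<phi> x \<noteq> 0})"

locale homogeneous_type_space = complete_measure M
  for T :: "'a topology" and M :: "'a measure" and d :: "'a \<Rightarrow> 'a \<Rightarrow> real" +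
  assumes space_eq: "topspace T = space M"
    and Cc_dense: "\<And>f e. integrable M f \<Longrightarrow> e > 0 \<Longrightarrow>
      \<exists>\<phi>. compactly_supported_continuous T \<phi> \<and> integrable M \<phi> \<and>
          (\<integral>x. \<bar>f x - \<phi> x\<bar> \<partial>M) < (e :: real)"
    and quasimetric: "quasimetric_on (space M) d"
    and qball_measurable: "\<And>x r. x \<in> space M \<Longrightarrow> r > 0 \<Longrightarrow> qball M d x r \<in> sets M"
    and qball_finite: "\<And>x r. x \<in> space M \<Longrightarrow> r > 0 \<Longrightarrow> emeasure M (qball M d x r) < \<infinity>"
    and qball_in_nbhd: "\<And>x U. openin T U \<Longrightarrow> x \<in> U \<Longrightarrow> \<exists>r>0. qball M d x r \<subseteq> U"
    and diam_finite: "bdd_above {d x y | x y. x \<in> space M \<and> y \<in> space M}"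
    and doubling: "\<exists>Cd>1. \<forall>x\<in>space M. \<forall>r. 0 < r \<and> r < qdiam M d \<longrightarrow>
      measure M (qball M d x (2 * r)) \<le> Cd * measure M (qball M d x r)"
    and annulus_pos: "\<And>x r R. x \<in> space M \<Longrightarrow> 0 < r \<Longrightarrow> r < R \<Longrightarrow> R < qdiam M d \<Longrightarrow>
      measure M (qball M d x R - qball M d x r) > 0"
    and upper_Ahlfors: "\<exists>\<gamma>>0. \<exists>c. \<forall>x\<in>space M. \<forall>r>0. measure M (qball M d x r) \<le> c * r powr \<gamma>"

section \<open>Morrey and grand Morrey spaces\<close>

text \<open>All norms take values in \<^typ>\<open>ennreal\<close>, so that a supremum is infinite rather than
  unspecified when it is not finite.\<close>

text \<open>The power $x^s$ for $s > 0$ and $x \in [0, \infty]$.\<close>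
definition ennreal_powr :: "ennreal \<Rightarrow> real \<Rightarrow> ennreal" where
  "ennreal_powr x s = (if x = \<infinity> then \<infinity> else ennreal (enn2real x powr s))"

definition morrey_norm ::
  "'a measure \<Rightarrow> ('a \<Rightarrow> 'a \<Rightarrow> real) \<Rightarrow> real \<Rightarrow> real \<Rightarrow> ('a \<Rightarrow> real) \<Rightarrow> ennreal" where
  "morrey_norm M d q \<nu> f =
     (SUP x\<in>space M. SUP r\<in>{0<..<qdiam M d}.
        ennreal_powr
          (ennreal (measure M (qball M d x r) powr (- \<nu>)) *
           (\<integral>\<^sup>+y\<in>qball M d x r. ennreal (\<bar>f y\<bar> powr q) \<partial>M))
          (1 / q))"

text \<open>The function \<^term>\<open>A\<close> is given on $(0, p - 1]$ only, so the supremum defining $a$ is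
  restricted to that interval; this does not change $\min\{p - 1, a\}$ for non-decreasing
  \<^term>\<open>A\<close>. (The set is nonempty when $\lambda > 0$ and $A(0+) = 0$.)\<close>
definition s_max :: "real \<Rightarrow> real \<Rightarrow> (real \<Rightarrow> real) \<Rightarrow> real" where
  "s_max p l A = min (p - 1) (Sup {x \<in> {0<..p - 1}. A x \<le> l})"

definition grand_morrey_norm ::
  "'a measure \<Rightarrow> ('a \<Rightarrow> 'a \<Rightarrow> real) \<Rightarrow> real \<Rightarrow> real \<Rightarrow> real \<Rightarrow> (real \<Rightarrow> real)
     \<Rightarrow> ('a \<Rightarrow> real) \<Rightarrow> ennreal" where
  "grand_morrey_norm M d p l \<theta> A f =
     (SUP \<epsilon>\<in>{0<..<s_max p l A}.
        ennreal (\<epsilon> powr (\<theta> / (p - \<epsilon>))) * morrey_norm M d (p - \<epsilon>) (l - A \<epsilon>) f)"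

definition grand_morrey_space ::
  "'a measure \<Rightarrow> ('a \<Rightarrow> 'a \<Rightarrow> real) \<Rightarrow> real \<Rightarrow> real \<Rightarrow> real \<Rightarrow> (real \<Rightarrow> real)
     \<Rightarrow> ('a \<Rightarrow> real) set" where
  "grand_morrey_space M d p l \<theta> A =
     {f \<in> borel_measurable M. grand_morrey_norm M d p l \<theta> A f < \<infinity>}"

section \<open>BMO\<close>

definition ball_average ::
  "'a measure \<Rightarrow> ('a \<Rightarrow> 'a \<Rightarrow> real) \<Rightarrow> ('a \<Rightarrow> real) \<Rightarrow> 'a \<Rightarrow> real \<Rightarrow> real" where
  "ball_average M d b x r =
     (LINT y:qball M d x r|M. b y) / measure M (qball M d x r)"

definition bmo_norm ::
  "'a measure \<Rightarrow> ('a \<Rightarrow> 'a \<Rightarrow> real) \<Rightarrow> ('a \<Rightarrow> real) \<Rightarrow> ennreal" where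
  "bmo_norm M d b =
     (SUP x\<in>space M. SUP r\<in>{0<..<qdiam M d}.
        (\<integral>\<^sup>+y\<in>qball M d x r. ennreal \<bar>b y - ball_average M d b x r\<bar> \<partial>M)
          / emeasure M (qball M d x r))"

text \<open>Local integrability means integrability on balls, which is what the averages require.\<close>
definition BMO :: "'a measure \<Rightarrow> ('a \<Rightarrow> 'a \<Rightarrow> real) \<Rightarrow> ('a \<Rightarrow> real) set" where
  "BMO M d =
     {b \<in> borel_measurable M.
        (\<forall>x\<in>space M. \<forall>r>0. set_integrable M (qball M d x r) b) \<and> bmo_norm M d b < \<infinity>}"

section \<open>Potential operator and commutator\<close>

text \<open>At $y = x$ the ball $B(x, d(x, y))$ is empty and the integrand below is $0$ by the conventions
  for \<^const>\<open>powr\<close> and division; upper Ahlfors regularity makes this point a null set.\<close>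
definition potential_integrand ::
  "'a measure \<Rightarrow> ('a \<Rightarrow> 'a \<Rightarrow> real) \<Rightarrow> real \<Rightarrow> ('a \<Rightarrow> real) \<Rightarrow> 'a \<Rightarrow> 'a \<Rightarrow> real" where
  "potential_integrand M d \<alpha> f x y =
     f y / measure M (qball M d x (d x y)) powr (1 - \<alpha>)"

definition potential ::
  "'a measure \<Rightarrow> ('a \<Rightarrow> 'a \<Rightarrow> real) \<Rightarrow> real \<Rightarrow> ('a \<Rightarrow> real) \<Rightarrow> 'a \<Rightarrow> real" where
  "potential M d \<alpha> f x = (\<integral>y. potential_integrand M d \<alpha> f x y \<partial>M)"

definition commutator ::
  "('a \<Rightarrow> real) \<Rightarrow> (('a \<Rightarrow> real) \<Rightarrow> 'a \<Rightarrow> real) \<Rightarrow> ('a \<Rightarrow> real) \<Rightarrow> 'a \<Rightarrow> real" where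
  "commutator b I f x = b x * I f x - I (\<lambda>y. b y * f y) x"

section \<open>The change of the grand parameter\<close>

definition phi_bar ::
  "real \<Rightarrow> real \<Rightarrow> real \<Rightarrow> real \<Rightarrow> (real \<Rightarrow> real) \<Rightarrow> real \<Rightarrow> real" where
  "phi_bar p q l \<alpha> A x = p + (x - q) * (1 - l + A x) / (1 - l + A x - \<alpha> * (x - q))"

end

theory Submission
  imports Defs
begin

text \<open>
  The balls of a space of homogeneous type are discretized by cells: the \<open>k\<close>-th cell of a point is
  a ball of radius comparable to \<open>\<rho>\<^sup>k\<close> around a nearby point of a finite net. Such a system satisfies a
  Vitali covering lemma, hence the maximal inequality for every measure that is doubling on cells,
  and by Lebesgue differentiation and a stopping time argument the John--Nirenberg inequality.

  The commutator is reduced to exponential conjugates of the potential by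
  \<open>\<kappa> |b(x) - b(y)| \<le> exp (\<kappa> (b(x) - b(y))) + exp (-\<kappa> (b(x) - b(y)))\<close>.
  For small \<open>\<kappa>\<close> the weights \<open>exp (\<plusminus>\<kappa> t b)\<close> define doubling measures, and the averages of \<open>b\<close> vary from
  one cell to the next by less than the powers of the measures of the cells. A Hedberg argument
  therefore applies to each conjugate: the contribution of the \<open>k\<close>-th cells is at most the minimum of a
  geometrically decreasing sequence governed by a weighted maximal function and a geometrically
  increasing one governed by the Morrey norm. This gives an Adams estimate between the Morrey spaces
  with \<open>1/s - 1/t = \<alpha>/(1 - \<nu>)\<close>, uniformly for \<open>(s, \<nu>)\<close> near \<open>(p, \<lambda>)\<close>, and the function that dominates
  the commutator does not depend on \<open>s\<close>, \<open>t\<close>, \<open>\<nu>\<close>.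

  The function \<open>\<eta> = \<phi>(\<epsilon>)\<close> is made so that \<open>(p - \<eta>, q - \<epsilon>, \<lambda> - A\<^sub>2(\<epsilon>))\<close> satisfies this relation, and the bound on
  \<open>B\<close> makes \<open>\<eta>\<close> at least a multiple of \<open>\<epsilon>\<close>, so that the grand weights on the two sides are comparable.
  The parameters \<open>\<epsilon>\<close> away from \<open>0\<close> are handled by Hoelder's inequality, since the measure is finite.
\<close>

section \<open>Elementary inequalities\<close>

text \<open>The grand norm is a supremum over exponents that accumulate at \<open>p\<close> and
  \<open>q\<close>, so all constants must be uniform in \<open>s\<close>, \<open>t\<close>,
  \<open>\<nu>\<close>, and one majorant must serve every exponent. This is why \<kappa> is fixed
  before them. The obstacle in a conjugate is the unbounded factor \<open>exp (b x - a k x)\<close>,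
  where \<open>a k x\<close> is the average of \<open>b\<close> on the cell. In the Hedberg
  interpolation the maximal function has weight \<open>s / t\<close> and the Morrey norm has weight
  \<open>1 - s / t\<close>; the factor cancels exactly if the maximal function carries
  \<open>exp (\<tau> * (b x - a k x))\<close> with \<open>\<tau> = t / s\<close>. Such a maximal
  function is no longer an average of \<open>f\<close>, but with respect to the measure of density
  \<open>exp (t b)\<close> it is dominated by the \<open>u\<close>-th root of an ordinary maximal
  function, for some \<open>u > 1\<close>. A second obstacle is that cells of different generations
  need not be nested. A cell is only known to lie in the parent of each cell of the same or a
  coarser generation that it meets, so every argument gives up one generation and pays a power of
  the doubling constant.\<close>

lemma nn_integral_Holder_bound:
  fixes u v :: "'a \<Rightarrow> real"
  assumes [measurable]: "u \<in> borel_measurable M" "v \<in> borel_measurable M" "A \<in> sets M"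
    and nonneg: "\<And>x. 0 \<le> u x" "\<And>x. 0 \<le> v x"
    and r: "1 < r" "1 < r'" "1 / r + 1 / r' = 1"
    and m: "0 \<le> m" "1 \<le> K" "0 \<le> Y"
    and u: "(\<integral>\<^sup>+x\<in>A. ennreal (u x powr r) \<partial>M) \<le> ennreal (Y powr r * m)"
    and v: "(\<integral>\<^sup>+x\<in>A. ennreal (v x powr r') \<partial>M) \<le> ennreal (K * m)"
  shows "(\<integral>\<^sup>+x\<in>A. ennreal (u x * v x) \<partial>M) \<le> ennreal (K * Y * m)"
proof (cases "Y = 0")
  case True
  then have "(\<integral>\<^sup>+x\<in>A. ennreal (u x powr r) \<partial>M) = 0"
    using u r by simp
  then have "AE x in M. ennreal (u x powr r) * indicator A x = 0"
    by (subst (asm) nn_integral_0_iff_AE) auto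
  then have "AE x in M. ennreal (u x * v x) * indicator A x = 0"
    by eventually_elim (auto simp: indicator_def split: if_splits)
  then have "(\<integral>\<^sup>+x\<in>A. ennreal (u x * v x) \<partial>M) = 0"
    by (subst nn_integral_0_iff_AE) auto
  then show ?thesis by simp
next
  case False
  then have Y: "0 < Y" using m by simp
  \<comment> \<open>Young's inequality for \<open>u / Y\<close> and \<open>v\<close>. Dividing by
    the size \<open>Y\<close> makes both integrals contribute multiples of the same
    \<open>m\<close>, and no root of an integral has to be taken.\<close>
  have pw: "u x * v x \<le> Y / r / Y powr r * u x powr r + Y / r' * v x powr r'" for x
  proof -
    have "(u x / Y) * v x \<le> (u x / Y) powr r / r + v x powr r' / r'"
      using r nonneg Y by (intro Youngs_inequality) auto
    then have "Y * ((u x / Y) * v x) \<le> Y * ((u x / Y) powr r / r + v x powr r' / r')"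
      using Y by (intro mult_left_mono) auto
    then show ?thesis
      using Y nonneg by (simp add: powr_divide field_simps)
  qed
  have "(\<integral>\<^sup>+x\<in>A. ennreal (u x * v x) \<partial>M)
      \<le> (\<integral>\<^sup>+x. ennreal (Y / r / Y powr r) * (ennreal (u x powr r) * indicator A x)
             + ennreal (Y / r') * (ennreal (v x powr r') * indicator A x) \<partial>M)"
  proof (rule nn_integral_mono)
    fix x
    have "ennreal (u x * v x) \<le> ennreal (Y / r / Y powr r * u x powr r + Y / r' * v x powr r')"
      by (rule ennreal_leI) (rule pw)
    also have "\<dots> = ennreal (Y / r / Y powr r) * ennreal (u x powr r)
                + ennreal (Y / r') * ennreal (v x powr r')"
      using Y r by (simp flip: ennreal_mult ennreal_plus)
    finally show "ennreal (u x * v x) * indicator A x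
      \<le> ennreal (Y / r / Y powr r) * (ennreal (u x powr r) * indicator A x)
             + ennreal (Y / r') * (ennreal (v x powr r') * indicator A x)"
      by (auto simp: indicator_def)
  qed
  also have "\<dots> = ennreal (Y / r / Y powr r) * (\<integral>\<^sup>+x\<in>A. ennreal (u x powr r) \<partial>M)
             + ennreal (Y / r') * (\<integral>\<^sup>+x\<in>A. ennreal (v x powr r') \<partial>M)"
    by (subst nn_integral_add) (auto simp: nn_integral_cmult)
  also have "\<dots> \<le> ennreal (Y / r / Y powr r) * ennreal (Y powr r * m) + ennreal (Y / r') * ennreal (K * m)"
    by (intro add_mono mult_left_mono u v) auto
  also have "\<dots> = ennreal (Y / r / Y powr r * (Y powr r * m) + Y / r' * (K * m))"
    using Y r m by (simp flip: ennreal_mult ennreal_plus)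
  also have "\<dots> \<le> ennreal (K * Y * m)"
  proof (rule ennreal_leI)
    have "Y / r / Y powr r * (Y powr r * m) = Y * m * (1 / r)" using Y by simp
    also have "\<dots> \<le> K * Y * m * (1 / r)"
      using Y r m mult_right_mono[of 1 K "Y * m * (1/r)"] by (simp add: mult_ac)
    finally have "Y / r / Y powr r * (Y powr r * m) + Y / r' * (K * m) \<le> K * Y * m * (1 / r + 1 / r')"
      by (simp add: algebra_simps)
    then show "Y / r / Y powr r * (Y powr r * m) + Y / r' * (K * m) \<le> K * Y * m"
      using r by simp
  qed
  finally show ?thesis .
qed

text \<open>The summation in Hedberg's argument. Before the first index where \<open>a\<close> is at
  most \<open>c\<close>, the increasing \<open>c\<close> is used, whose partial sums are governed by
  their last term; from there on the decreasing \<open>a\<close>, whose tails are governed by their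
  first term. Both of these terms are minima, hence at most \<open>L\<close>.\<close>

lemma sum_two_sided_geometric:
  fixes a c T :: "nat \<Rightarrow> real"
  assumes q: "0 \<le> \<theta>" "\<theta> < 1"
    and a: "\<And>k. a (Suc k) \<le> \<theta> * a k" and c: "\<And>k. c k \<le> \<theta> * c (Suc k)"
    and nonneg: "\<And>k. 0 \<le> a k" "\<And>k. 0 \<le> c k"
    and T: "\<And>k. T k \<le> a k" "\<And>k. T k \<le> c k" and L: "\<And>k. min (a k) (c k) \<le> L"
  shows "(\<Sum>k<n. T k) \<le> 2 * L / (1 - \<theta>)"
proof -
  have c_sum: "(\<Sum>k<Suc n. c k) \<le> c n / (1 - \<theta>)" for n
  proof (induction n)
    case 0
    have "c 0 * (1 - \<theta>) \<le> c 0 * 1" using nonneg(2)[of 0] q by (intro mult_left_mono) auto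
    then show ?case using q by (simp add: field_simps)
  next
    case (Suc n)
    have "c n / (1 - \<theta>) + c (Suc n) \<le> \<theta> * c (Suc n) / (1 - \<theta>) + c (Suc n)"
      using c[of n] q by (simp add: divide_right_mono)
    also have "\<dots> = c (Suc n) / (1 - \<theta>)" using q by (simp add: field_simps)
    finally show ?case using Suc by simp
  qed
  have a_sum: "(\<Sum>k<i. a (j + k)) \<le> (a j - a (j + i)) / (1 - \<theta>)" for i j
  proof (induction i)
    case (Suc i)
    have "a (j + i) * (1 - \<theta>) \<le> a (j + i) - a (j + Suc i)"
      using a[of "j + i"] by (simp add: algebra_simps)
    then have "a (j + i) \<le> (a (j + i) - a (j + Suc i)) / (1 - \<theta>)"
      using q by (simp add: field_simps)
    then show ?case using Suc by (simp add: diff_divide_distrib)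
  qed simp
  have L0: "0 \<le> L" using L[of 0] nonneg[of 0] by (simp add: min_def split: if_splits)
  have a_tail: "(\<Sum>k<i. a (j + k)) \<le> L / (1 - \<theta>)" if "a j \<le> c j" for i j
  proof -
    have "a j - a (j + i) \<le> L" using L[of j] that nonneg(1)[of "j + i"] by simp
    then have "(a j - a (j + i)) / (1 - \<theta>) \<le> L / (1 - \<theta>)" using q by (intro divide_right_mono) auto
    then show ?thesis using a_sum[where i=i and j=j] by simp
  qed
  have c_head: "(\<Sum>k<j. c k) \<le> L / (1 - \<theta>)" if "\<And>k. k < j \<Longrightarrow> c k < a k" for j
  proof (cases j)
    case 0 then show ?thesis using L0 q by simp
  next
    case (Suc i)
    have "c i \<le> L" using that[of i] L[of i] Suc by simp
    then have "c i / (1 - \<theta>) \<le> L / (1 - \<theta>)" using q by (intro divide_right_mono) auto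
    then show ?thesis using c_sum[of i] Suc by simp
  qed
  show ?thesis
  proof (cases "\<exists>k<n. a k \<le> c k")
    case True
    define j where "j = (LEAST k. a k \<le> c k)"
    obtain i where i: "i < n" "a i \<le> c i" using True by blast
    have j: "a j \<le> c j" unfolding j_def by (rule LeastI[of "\<lambda>k. a k \<le> c k", OF i(2)])
    have jn: "j < n" using Least_le[of "\<lambda>k. a k \<le> c k", OF i(2)] i(1) by (simp add: j_def)
    have below: "c k < a k" if "k < j" for k
      using not_less_Least[of k "\<lambda>k. a k \<le> c k"] that by (simp add: j_def not_le)
    have "(\<Sum>k<j + i. T k) = (\<Sum>k<j. T k) + (\<Sum>k<i. T (j + k))" for i
      by (induction i) (auto simp: add.assoc)
    from this[of "n - j"] jn
    have "(\<Sum>k<n. T k) = (\<Sum>k<j. T k) + (\<Sum>k<n - j. T (j + k))" by simp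
    also have "\<dots> \<le> (\<Sum>k<j. c k) + (\<Sum>k<n - j. a (j + k))"
      by (intro add_mono sum_mono T)
    also have "\<dots> \<le> L / (1 - \<theta>) + L / (1 - \<theta>)"
      by (intro add_mono c_head a_tail j below)
    finally show ?thesis by simp
  next
    case False
    then have "c k < a k" if "k < n" for k using that by (simp add: not_le)
    then have "(\<Sum>k<n. c k) \<le> L / (1 - \<theta>)" by (rule c_head)
    moreover have "(\<Sum>k<n. T k) \<le> (\<Sum>k<n. c k)" by (intro sum_mono T)
    ultimately have "(\<Sum>k<n. T k) \<le> L / (1 - \<theta>)" by simp
    also have "\<dots> \<le> 2 * L / (1 - \<theta>)" using L0 q by (intro divide_right_mono) auto
    finally show ?thesis .
  qed
qed

lemma nn_integral_powr_from_0:
  assumes "0 < c" "0 \<le> (y::real)"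
  shows "(\<integral>\<^sup>+x\<in>{0..y}. ennreal (x powr (c - 1)) \<partial>lborel) = ennreal (y powr c / c)"
  using nn_integral_has_integral_lebesgue'[OF _ has_integral_powr_from_0[of "c - 1" y]] assms by simp

text \<open>Write \<open>\<Phi> x powr c\<close> as the integral of its derivative over
  \<open>{0..\<Phi> x}\<close> and exchange the integrals.\<close>

lemma (in sigma_finite_measure) nn_integral_powr_layer_cake:
  fixes \<Phi> :: "'a \<Rightarrow> real"
  assumes [measurable]: "\<Phi> \<in> borel_measurable M" and \<Phi>: "\<And>x. 0 \<le> \<Phi> x" and c: "0 < c"
  shows "(\<integral>\<^sup>+x. ennreal (\<Phi> x powr c) \<partial>M) =
    (\<integral>\<^sup>+y\<in>{0..}. ennreal (c * y powr (c - 1)) * emeasure M {x\<in>space M. y \<le> \<Phi> x} \<partial>lborel)"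
proof -
  interpret P: pair_sigma_finite M lborel ..
  have "(\<integral>\<^sup>+x. ennreal (\<Phi> x powr c) \<partial>M)
      = (\<integral>\<^sup>+x. (\<integral>\<^sup>+y. ennreal (c * y powr (c - 1)) * indicator {0..} y * (if y \<le> \<Phi> x then 1 else 0) \<partial>lborel) \<partial>M)"
  proof (rule nn_integral_cong)
    fix x
    have "(\<integral>\<^sup>+y. ennreal (c * y powr (c - 1)) * indicator {0..} y * (if y \<le> \<Phi> x then 1 else 0) \<partial>lborel)
       = (\<integral>\<^sup>+y. ennreal c * (ennreal (y powr (c - 1)) * indicator {0..\<Phi> x} y) \<partial>lborel)"
      using c by (intro nn_integral_cong) (auto simp: ennreal_mult indicator_def)
    also have "\<dots> = ennreal c * ennreal (\<Phi> x powr c / c)"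
      by (subst nn_integral_cmult) (auto simp: nn_integral_powr_from_0 c \<Phi>)
    also have "\<dots> = ennreal (\<Phi> x powr c)"
      using c by (simp flip: ennreal_mult)
    finally show "ennreal (\<Phi> x powr c) = (\<integral>\<^sup>+y. ennreal (c * y powr (c - 1)) * indicator {0..} y * (if y \<le> \<Phi> x then 1 else 0) \<partial>lborel)"
      by simp
  qed
  also have "\<dots> = (\<integral>\<^sup>+y. (\<integral>\<^sup>+x. ennreal (c * y powr (c - 1)) * indicator {0..} y * (if y \<le> \<Phi> x then 1 else 0) \<partial>M) \<partial>lborel)"
    by (subst P.Fubini') (auto simp: case_prod_beta)
  also have "\<dots> = (\<integral>\<^sup>+y\<in>{0..}. ennreal (c * y powr (c - 1)) * emeasure M {x\<in>space M. y \<le> \<Phi> x} \<partial>lborel)"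
  proof (rule nn_integral_cong)
    fix y
    have "(\<integral>\<^sup>+x. ennreal (c * y powr (c - 1)) * indicator {0..} y * (if y \<le> \<Phi> x then 1 else 0) \<partial>M)
      = (\<integral>\<^sup>+x. ennreal (c * y powr (c - 1)) * indicator {0..} y * indicator {x\<in>space M. y \<le> \<Phi> x} x \<partial>M)"
      by (intro nn_integral_cong) (auto simp: indicator_def)
    also have "\<dots> = ennreal (c * y powr (c - 1)) * indicator {0..} y * emeasure M {x\<in>space M. y \<le> \<Phi> x}"
      by (subst nn_integral_cmult) auto
    finally show "(\<integral>\<^sup>+x. ennreal (c * y powr (c - 1)) * indicator {0..} y * (if y \<le> \<Phi> x then 1 else 0) \<partial>M)
      = ennreal (c * y powr (c - 1)) * emeasure M {x\<in>space M. y \<le> \<Phi> x} * indicator {0..} y"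
      by (simp add: mult_ac)
  qed
  finally show ?thesis .
qed

lemma set_integral_mono_set:
  fixes g :: "'a \<Rightarrow> real"
  assumes "A \<in> sets M" "B \<in> sets M" "A \<subseteq> B" "integrable M g" "\<And>y. 0 \<le> g y"
  shows "(LINT y:A|M. g y) \<le> (LINT y:B|M. g y)"
  unfolding set_lebesgue_integral_def
  using assms by (intro integral_mono integrable_mult_indicator) (auto simp: indicator_def)

section \<open>Cells and the maximal inequality\<close>

text \<open>\<open>C k x\<close> stands for a ball of generation \<open>k\<close> that contains \<open>x\<close>. The subtraction in \<open>k - 1\<close> is truncated, so
  that a cell of generation \<open>0\<close> is its own parent.\<close>

locale cells = finite_measure M for M :: "'a measure" +
  fixes C :: "nat \<Rightarrow> 'a \<Rightarrow> 'a set" and \<Gamma> :: real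
  assumes cell_sets [measurable]: "\<And>k x. x \<in> space M \<Longrightarrow> C k x \<in> sets M"
    and finite_cells: "\<And>k. finite (C k ` space M)"
    and cell_fiber: "\<And>k x. x \<in> space M \<Longrightarrow> {y \<in> space M. C k y = C k x} \<in> sets M"
    and cell_self: "\<And>k x. x \<in> space M \<Longrightarrow> x \<in> C k x"
    and engulf: "\<And>j k x y. x \<in> space M \<Longrightarrow> y \<in> space M \<Longrightarrow> k \<le> j \<Longrightarrow>
      C j y \<inter> C k x \<noteq> {} \<Longrightarrow> C j y \<subseteq> C (k - 1) x"
    and cell_pos: "\<And>k x. x \<in> space M \<Longrightarrow> 0 < measure M (C k x)"
    and cell_doubling: "\<And>k x. x \<in> space M \<Longrightarrow> measure M (C (k - 1) x) \<le> \<Gamma> * measure M (C k x)"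
begin

definition avg :: "nat \<Rightarrow> ('a \<Rightarrow> real) \<Rightarrow> 'a \<Rightarrow> real" where
  "avg k g x = (LINT y:C k x|M. g y) / measure M (C k x)"

lemma cell_subset: "x \<in> space M \<Longrightarrow> C k x \<subseteq> space M"
  using cell_sets sets.sets_into_space by blast

lemma cell_mono: "x \<in> space M \<Longrightarrow> C (Suc k) x \<subseteq> C k x"
  using engulf[of x x "Suc k" "Suc k"] cell_self by fastforce

text \<open>\<open>C k\<close> is a measurable map into a finite discrete space of sets, so
  composing it with any \<open>F\<close> at all gives a measurable function.\<close>

lemma measurable_cell_fun:
  fixes F :: "'a set \<Rightarrow> 'b::second_countable_topology"
  shows "(\<lambda>x. F (C k x)) \<in> borel_measurable M"
proof -
  have "C k \<in> measurable M (count_space (C k ` space M))"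
    using cell_fiber finite_cells[of k]
    by (subst measurable_count_space_eq2) (auto simp: vimage_def Int_def conj_commute)
  from measurable_compose[OF this, of F borel] show ?thesis by simp
qed

lemma measurable_avg [measurable]: "avg k g \<in> borel_measurable M"
  using measurable_cell_fun[of "\<lambda>S. (LINT y:S|M. g y) / measure M S" k]
  by (simp add: avg_def[abs_def])

lemma set_integrable_cell:
  fixes g :: "'a \<Rightarrow> real"
  shows "integrable M g \<Longrightarrow> x \<in> space M \<Longrightarrow> set_integrable M (C k x) g"
  unfolding set_integrable_def by (intro integrable_mult_indicator cell_sets)

text \<open>Generation 0 is its own parent, so its doubling inequality compares a positive number
  with \<open>\<Gamma>\<close> times itself.\<close>

lemma \<Gamma>_pos: "space M \<noteq> {} \<Longrightarrow> 1 \<le> \<Gamma>"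
proof -
  assume "space M \<noteq> {}"
  then obtain x where x: "x \<in> space M" by blast
  show ?thesis using cell_doubling[OF x, of 0] cell_pos[OF x, of 0] by simp
qed

text \<open>Greedy selection as in Vitali's lemma: take a cell of least generation, discard all
  cells that meet it and recurse on the rest. The condition \<open>j \<le> k\<close> records that
  the selected cell is the coarser one, as \<open>engulf\<close> requires.\<close>

lemma disjoint_subfamily:
  assumes "finite F" "\<And>k x. (k, x) \<in> F \<Longrightarrow> x \<in> space M"
  shows "\<exists>G\<subseteq>F. disjoint_family_on (\<lambda>(k, x). C k x) G \<and>
    (\<forall>(k, x)\<in>F. \<exists>(j, y)\<in>G. j \<le> k \<and> C k x \<inter> C j y \<noteq> {})"
  using assms
proof (induction "card F" arbitrary: F rule: less_induct)
  case less
  show ?case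
  proof (cases "F = {}")
    case False
    obtain p where p: "p \<in> F" "\<And>q. q \<in> F \<Longrightarrow> fst p \<le> fst q"
      using that[OF arg_min_if_finite(1)[OF less.prems(1) False, of fst]
          arg_min_least[OF less.prems(1) False, of _ fst]] by simp
    obtain k0 x0 where pe: "p = (k0, x0)" by (cases p)
    have x0: "x0 \<in> space M" using p less.prems pe by blast
    define F' where "F' = {(k, x) \<in> F. C k x \<inter> C k0 x0 = {}}"
    have "p \<notin> F'" using cell_self[OF x0, of k0] by (auto simp: F'_def pe)
    then have "F' \<subset> F" using p(1) F'_def by blast
    then have cF: "card F' < card F" by (rule psubset_card_mono[OF less.prems(1)])
    have "F' \<subseteq> F" using \<open>F' \<subset> F\<close> by (rule psubset_imp_subset)
    have "\<exists>G\<subseteq>F'. disjoint_family_on (\<lambda>(k, x). C k x) G \<and>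
      (\<forall>(k, x)\<in>F'. \<exists>(j, y)\<in>G. j \<le> k \<and> C k x \<inter> C j y \<noteq> {})"
    proof (rule less.hyps[OF cF])
      show "finite F'" using \<open>F' \<subseteq> F\<close> less.prems(1) by (rule finite_subset)
      show "x \<in> space M" if "(k, x) \<in> F'" for k x
        using subsetD[OF \<open>F' \<subseteq> F\<close> that] by (rule less.prems(2))
    qed
    then obtain G where G: "G \<subseteq> F'" "disjoint_family_on (\<lambda>(k, x). C k x) G"
      "\<forall>(k, x)\<in>F'. \<exists>(j, y)\<in>G. j \<le> k \<and> C k x \<inter> C j y \<noteq> {}"
      by blast
    show ?thesis
    proof (intro exI[of _ "insert p G"] conjI)
      show "insert p G \<subseteq> F" using G p \<open>F' \<subset> F\<close> by blast
      show "disjoint_family_on (\<lambda>(k, x). C k x) (insert p G)"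
      proof (subst disjoint_family_on_insert)
        show "p \<notin> G" using G(1) \<open>p \<notin> F'\<close> by blast
        have "C k0 x0 \<inter> (case q of (k, x) \<Rightarrow> C k x) = {}" if "q \<in> G" for q
          using subsetD[OF G(1) that] by (auto simp: F'_def)
        then show "(case p of (k, x) \<Rightarrow> C k x) \<inter> (\<Union>q\<in>G. case q of (k, x) \<Rightarrow> C k x) = {} \<and>
            disjoint_family_on (\<lambda>(k, x). C k x) G"
          using G(2) unfolding pe prod.case by blast
      qed
      show "\<forall>(k, x)\<in>F. \<exists>(j, y)\<in>insert p G. j \<le> k \<and> C k x \<inter> C j y \<noteq> {}"
      proof safe
        fix k x assume kx: "(k, x) \<in> F"
        show "\<exists>(j, y)\<in>insert p G. j \<le> k \<and> C k x \<inter> C j y \<noteq> {}"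
        proof (cases "(k, x) \<in> F'")
          case True then show ?thesis using G(3) by fast
        next
          case False
          then have "C k x \<inter> C k0 x0 \<noteq> {}" using kx by (auto simp: F'_def)
          then show ?thesis using p(2)[OF kx] by (auto simp: pe)
        qed
      qed
    qed
  qed (auto simp: disjoint_family_on_def)
qed

text \<open>\<open>P\<close> may depend on the point and not only on its cell of generation
  \<open>k\<close>, as a stopping rule does; hence each cell is represented by a point where
  \<open>P\<close> holds. The bound \<open>n\<close> on the generations makes the family
  finite.\<close>

lemma Vitali_cover:
  shows "\<exists>G. finite G \<and> (\<forall>(k, x)\<in>G. k < n \<and> x \<in> space M \<and> P k x) \<and>
    disjoint_family_on (\<lambda>(k, x). C k x) G \<and>
    {x\<in>space M. \<exists>k<n. P k x} \<subseteq> (\<Union>(k, x)\<in>G. C (k - 1) x)"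
proof -
  have "\<exists>R. R \<subseteq> {x\<in>space M. P k x} \<and> finite R \<and> C k ` {x\<in>space M. P k x} = C k ` R" for k
    by (rule finite_subset_image[OF finite_subset[OF _ finite_cells[of k]]]) auto
  then obtain R where R: "\<And>k. R k \<subseteq> {x\<in>space M. P k x}" "\<And>k. finite (R k)"
    "\<And>k. C k ` {x\<in>space M. P k x} = C k ` R k" by metis
  define F where "F = Sigma {..<n} R"
  have "finite F" using R by (auto simp: F_def)
  moreover have F_space: "x \<in> space M \<and> P k x \<and> k < n" if "(k, x) \<in> F" for k x
    using that R(1) by (auto simp: F_def)
  ultimately obtain G where G: "G \<subseteq> F" "disjoint_family_on (\<lambda>(k, x). C k x) G"
    "\<forall>(k, x)\<in>F. \<exists>(j, y)\<in>G. j \<le> k \<and> C k x \<inter> C j y \<noteq> {}"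
    using disjoint_subfamily[of F] by blast
  have "{x\<in>space M. \<exists>k<n. P k x} \<subseteq> (\<Union>(k, x)\<in>G. C (k - 1) x)"
  proof safe
    fix x k assume x: "x \<in> space M" "k < n" "P k x"
    then obtain x' where x': "x' \<in> R k" "C k x = C k x'" using R(3)[of k] by blast
    then have "(k, x') \<in> F" using x by (auto simp: F_def)
    then obtain j y where jy: "(j, y) \<in> G" "j \<le> k" "C k x' \<inter> C j y \<noteq> {}" using G(3) by fast
    have "C k x' \<subseteq> C (j - 1) y"
      using engulf[of y x' j k] jy F_space \<open>(k, x') \<in> F\<close> G(1) by blast
    then show "x \<in> (\<Union>(k, x)\<in>G. C (k - 1) x)"
      using jy x' cell_self[OF x(1), of k] by blast
  qed
  then show ?thesis using G F_space \<open>finite F\<close> finite_subset by (intro exI[of _ G]) blast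
qed

text \<open>The set \<open>A\<close> is the whole space in the weak type inequality and the parent
  of a cell in the stopping time argument.\<close>

lemma sum_disjoint_cells_le:
  assumes g: "integrable M g" "\<And>y. 0 \<le> g y" and \<open>0 < a\<close>
    and G: "finite G" "disjoint_family_on (\<lambda>(k, x). C k x) G"
      "\<And>k x. (k, x) \<in> G \<Longrightarrow> x \<in> space M \<and> a \<le> avg k g x"
    and A: "A \<in> sets M" "\<And>k x. (k, x) \<in> G \<Longrightarrow> C k x \<subseteq> A"
  shows "a * (\<Sum>(k, x)\<in>G. measure M (C k x)) \<le> (LINT y:A|M. g y)"
proof -
  have "a * (\<Sum>(k, x)\<in>G. measure M (C k x)) = (\<Sum>(k, x)\<in>G. a * measure M (C k x))"
    by (simp add: sum_distrib_left case_prod_beta)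
  also have "\<dots> \<le> (\<Sum>(k, x)\<in>G. (LINT y:C k x|M. g y))"
    using G(3) cell_pos by (intro sum_mono) (fastforce simp: avg_def field_simps)
  also have "\<dots> = (LINT y:(\<Union>p\<in>G. case p of (k, x) \<Rightarrow> C k x)|M. g y)"
  proof -
    have "set_integrable M (case p of (k, x) \<Rightarrow> C k x) g" if "p \<in> G" for p
      using that G(3) set_integrable_cell[OF g(1)] by (cases p) auto
    moreover have "(case p of (k, x) \<Rightarrow> C k x) \<in> sets M" if "p \<in> G" for p
      using that G(3) by (cases p) auto
    ultimately show ?thesis
      using G(1,2) set_integral_finite_Union[of G "\<lambda>(k, x). C k x" M g]
      by (simp add: disjoint_family_on_def case_prod_beta)
  qed
  also have "\<dots> \<le> (LINT y:A|M. g y)"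
  proof -
    have "(\<Union>p\<in>G. case p of (k, x) \<Rightarrow> C k x) \<in> sets M"
      using G by (intro sets.finite_UN) auto
    moreover have "(\<Union>p\<in>G. case p of (k, x) \<Rightarrow> C k x) \<subseteq> A" using A by auto
    ultimately show ?thesis
      using g A by (intro set_integral_mono_set) auto
  qed
  finally show ?thesis .
qed

section \<open>Maximal inequalities of weak and strong type\<close>

lemma weak_type_maximal:
  assumes g: "integrable M g" "\<And>y. 0 \<le> g y" and a: "0 < a"
  shows "a * measure M {x\<in>space M. \<exists>k. a \<le> avg k g x} \<le> \<Gamma> * (\<integral>y. g y \<partial>M)"
proof -
  \<comment> \<open>Only generations below \<open>n\<close> at first, since the covering lemma is
    finite; the limit is taken by continuity of the measure.\<close>
  let ?E = "\<lambda>n. {x\<in>space M. \<exists>k<n. a \<le> avg k g x}"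
  have bd: "a * measure M (?E n) \<le> \<Gamma> * (\<integral>y. g y \<partial>M)" for n
  proof -
    obtain G where G: "finite G" "\<forall>(k, x)\<in>G. k < n \<and> x \<in> space M \<and> a \<le> avg k g x"
      "disjoint_family_on (\<lambda>(k, x). C k x) G"
      "?E n \<subseteq> (\<Union>(k, x)\<in>G. C (k - 1) x)"
      using Vitali_cover[of n "\<lambda>k x. a \<le> avg k g x"] by blast
    have "measure M (?E n) \<le> measure M (\<Union>p\<in>G. case p of (k, x) \<Rightarrow> C (k - 1) x)"
      using G by (intro finite_measure_mono sets.finite_UN) auto
    also have "\<dots> \<le> (\<Sum>p\<in>G. measure M (case p of (k, x) \<Rightarrow> C (k - 1) x))"
      using G by (intro measure_UNION_le) auto
    also have "\<dots> \<le> (\<Sum>(k, x)\<in>G. \<Gamma> * measure M (C k x))"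
      using G cell_doubling by (intro sum_mono) auto
    also have "\<dots> = \<Gamma> * (\<Sum>(k, x)\<in>G. measure M (C k x))"
      by (simp add: sum_distrib_left case_prod_beta)
    finally have 1: "measure M (?E n) \<le> \<Gamma> * (\<Sum>(k, x)\<in>G. measure M (C k x))" .
    show ?thesis
    proof (cases "space M = {}")
      \<comment> \<open>On an empty space nothing bounds \<open>\<Gamma>\<close> from below, so this
        case stands apart.\<close>
      case True
      then have "?E n = {}" by blast
      moreover have "(\<integral>y. g y \<partial>M) = 0" using True by (rule Bochner_Integration.integral_empty)
      ultimately show ?thesis by (metis measure_empty mult_zero_right order_refl)
    next
      case False
      have "a * (\<Sum>(k, x)\<in>G. measure M (C k x)) \<le> (LINT y:space M|M. g y)"
        using G g a by (intro sum_disjoint_cells_le) (use cell_subset in blast)+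
      also have "\<dots> = (\<integral>y. g y \<partial>M)" by (rule set_integral_space[OF g(1)])
      finally have "\<Gamma> * (a * (\<Sum>(k, x)\<in>G. measure M (C k x))) \<le> \<Gamma> * (\<integral>y. g y \<partial>M)"
        using \<Gamma>_pos[OF False] by (intro mult_left_mono) auto
      moreover have "a * measure M (?E n) \<le> a * (\<Gamma> * (\<Sum>(k, x)\<in>G. measure M (C k x)))"
        using 1 a by (intro mult_left_mono) auto
      ultimately show ?thesis by (simp add: mult_ac)
    qed
  qed
  have "(\<lambda>n. measure M (?E n)) \<longlonglongrightarrow> measure M (\<Union>n. ?E n)"
    by (rule finite_Lim_measure_incseq) (auto simp: incseq_def intro: order.strict_trans2)
  also have "(\<Union>n. ?E n) = {x\<in>space M. \<exists>k. a \<le> avg k g x}" by auto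
  finally have "(\<lambda>n. a * measure M (?E n)) \<longlonglongrightarrow> a * measure M {x\<in>space M. \<exists>k. a \<le> avg k g x}"
    by (intro tendsto_mult_left)
  then show ?thesis by (rule LIMSEQ_le_const2) (use bd in auto)
qed

lemma avg_add_le:
  assumes [measurable]: "g \<in> borel_measurable M" and "integrable M g" "\<And>y. 0 \<le> g y" and x: "x \<in> space M" and "0 \<le> a"
  shows "avg k g x \<le> avg k (\<lambda>y. g y * indicator {y. a \<le> g y} y) x + a"
proof -
  let ?h = "\<lambda>y. g y * indicator {y. a \<le> g y} y"
  have h: "integrable M ?h"
    by (rule Bochner_Integration.integrable_bound[OF assms(2)]) (use assms(3) in \<open>auto simp: indicator_def\<close>)
  have a: "integrable M (\<lambda>y. a)" by simp
  have "(LINT y:C k x|M. g y) \<le> (LINT y:C k x|M. ?h y + a)"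
    using set_integrable_cell[OF assms(2) x, of k] set_integrable_cell[OF Bochner_Integration.integrable_add[OF h a] x, of k]
    by (intro set_integral_mono) (use \<open>0 \<le> a\<close> in \<open>auto simp: indicator_def\<close>)
  also have "\<dots> = (LINT y:C k x|M. ?h y) + (LINT y:C k x|M. a)"
    using set_integrable_cell[OF h x, of k] set_integrable_cell[OF a x, of k] by (rule set_integral_add)
  also have "(LINT y:C k x|M. a) = a * measure M (C k x)"
    using cell_sets[OF x, of k] by (simp add: set_lebesgue_integral_def)
  finally show ?thesis using cell_pos[OF x, of k] by (simp add: avg_def field_simps)
qed

text \<open>Marcinkiewicz interpolation. \<open>\<Phi>\<close> stands for the maximal function: it
  only has to be below some average wherever it is positive, so a truncated finite maximum qualifies
  and no supremum over infinitely many generations is formed.\<close>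

theorem maximal_inequality:
  assumes g [measurable]: "g \<in> borel_measurable M" "integrable M g" "\<And>y. 0 \<le> g y"
    and \<Phi> [measurable]: "\<Phi> \<in> borel_measurable M" "\<And>x. 0 \<le> \<Phi> x"
      "\<And>x. x \<in> space M \<Longrightarrow> 0 < \<Phi> x \<Longrightarrow> \<exists>k. \<Phi> x \<le> avg k g x"
    and r: "1 < r" and ne: "space M \<noteq> {}"
  shows "(\<integral>\<^sup>+x. ennreal (\<Phi> x powr r) \<partial>M)
    \<le> ennreal (2 powr r * \<Gamma> * r / (r - 1)) * (\<integral>\<^sup>+x. ennreal (g x powr r) \<partial>M)"
proof -
  interpret P: pair_sigma_finite M lborel ..
  have \<Gamma>: "1 \<le> \<Gamma>" using ne by (rule \<Gamma>_pos)
  let ?K = "\<lambda>x y. ennreal (r * 2 * \<Gamma> * y powr (r - 2) * g x) * indicator {0..2 * g x} y"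
  have level: "ennreal (r * y powr (r - 1)) * emeasure M {x\<in>space M. y \<le> \<Phi> x} \<le> (\<integral>\<^sup>+x. ?K x y \<partial>M)"
    if "0 \<le> y" for y
  proof (cases "y = 0")
    case False
    then have y: "0 < y" using that by simp
    \<comment> \<open>The part of \<open>g\<close> below \<open>y / 2\<close> contributes at most
      \<open>y / 2\<close> to an average, so where an average reaches \<open>y\<close> the rest must
      supply \<open>y / 2\<close>.\<close>
    let ?h = "\<lambda>z. g z * indicator {z. y / 2 \<le> g z} z"
    have h: "integrable M ?h"
      by (rule Bochner_Integration.integrable_bound[OF g(2)]) (use g(3) in \<open>auto simp: indicator_def\<close>)
    have "{x\<in>space M. y \<le> \<Phi> x} \<subseteq> {x\<in>space M. \<exists>k. y / 2 \<le> avg k ?h x}"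
    proof safe
      fix x assume x: "x \<in> space M" "y \<le> \<Phi> x"
      then obtain k where "\<Phi> x \<le> avg k g x" using \<Phi>(3) y by force
      then show "\<exists>k. y / 2 \<le> avg k ?h x"
        using avg_add_le[OF g x(1), of "y / 2" k] x(2) y by (intro exI[of _ k]) linarith
    qed
    then have "y / 2 * measure M {x\<in>space M. y \<le> \<Phi> x} \<le> y / 2 * measure M {x\<in>space M. \<exists>k. y / 2 \<le> avg k ?h x}"
      using y by (intro mult_left_mono finite_measure_mono) auto
    also have "\<dots> \<le> \<Gamma> * (\<integral>z. ?h z \<partial>M)"
      using y g(3) by (intro weak_type_maximal h) auto
    finally have "measure M {x\<in>space M. y \<le> \<Phi> x} \<le> 2 * \<Gamma> / y * (\<integral>z. ?h z \<partial>M)"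
      using y by (simp add: field_simps)
    then have "r * y powr (r - 1) * measure M {x\<in>space M. y \<le> \<Phi> x}
        \<le> r * y powr (r - 1) * (2 * \<Gamma> / y * (\<integral>z. ?h z \<partial>M))"
      using r by (intro mult_left_mono) auto
    also have "\<dots> = r * 2 * \<Gamma> * (y powr (r - 1) / y powr 1) * (\<integral>z. ?h z \<partial>M)"
      using y by simp
    also have "y powr (r - 1) / y powr 1 = y powr (r - 2)"
      by (subst powr_diff[symmetric]) simp
    finally have "ennreal (r * y powr (r - 1)) * emeasure M {x\<in>space M. y \<le> \<Phi> x}
       \<le> ennreal (r * 2 * \<Gamma> * y powr (r - 2) * (\<integral>z. ?h z \<partial>M))"
      using r by (simp add: emeasure_eq_measure ennreal_leI flip: ennreal_mult)
    also have "\<dots> = ennreal (r * 2 * \<Gamma> * y powr (r - 2)) * (\<integral>\<^sup>+z. ennreal (?h z) \<partial>M)"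
      using nn_integral_eq_integral[OF h] g(3) r \<Gamma> by (simp add: ennreal_mult)
    also have "\<dots> = (\<integral>\<^sup>+x. ?K x y \<partial>M)"
      using r \<Gamma> g(3) y by (subst nn_integral_cmult[symmetric])
        (auto intro!: nn_integral_cong simp: indicator_def ennreal_mult)
    finally show ?thesis .
  qed (use r in simp)
  have "(\<integral>\<^sup>+x. ennreal (\<Phi> x powr r) \<partial>M)
      = (\<integral>\<^sup>+y\<in>{0..}. ennreal (r * y powr (r - 1)) * emeasure M {x\<in>space M. y \<le> \<Phi> x} \<partial>lborel)"
    using r \<Phi> by (intro nn_integral_powr_layer_cake) auto
  also have "\<dots> \<le> (\<integral>\<^sup>+y. (\<integral>\<^sup>+x. ?K x y \<partial>M) \<partial>lborel)"
  proof (rule nn_integral_mono)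
    fix y :: real
    show "ennreal (r * y powr (r - 1)) * emeasure M {x\<in>space M. y \<le> \<Phi> x} * indicator {0..} y \<le> (\<integral>\<^sup>+x. ?K x y \<partial>M)"
      using level[of y] by (cases "0 \<le> y") auto
  qed
  also have "\<dots> = (\<integral>\<^sup>+x. (\<integral>\<^sup>+y. ?K x y \<partial>lborel) \<partial>M)"
  proof -
    have "(\<lambda>(x, y). ennreal (r * 2 * \<Gamma> * y powr (r - 2) * g x) * (if 0 \<le> y \<and> y \<le> 2 * g x then 1 else 0))
        \<in> borel_measurable (M \<Otimes>\<^sub>M lborel)"
      by measurable
    then have "(\<lambda>(x, y). ?K x y) \<in> borel_measurable (M \<Otimes>\<^sub>M lborel)"
      by (rule back_subst[where P = "\<lambda>F. F \<in> borel_measurable (M \<Otimes>\<^sub>M lborel)"])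
        (auto simp: fun_eq_iff indicator_def)
    then show ?thesis by (rule P.Fubini')
  qed
  also have "\<dots> = (\<integral>\<^sup>+x. ennreal (2 powr r * \<Gamma> * r / (r - 1)) * ennreal (g x powr r) \<partial>M)"
  proof (rule nn_integral_cong)
    fix x
    have "(\<integral>\<^sup>+y. ?K x y \<partial>lborel)
       = (\<integral>\<^sup>+y. ennreal (r * 2 * \<Gamma> * g x) * (ennreal (y powr (r - 1 - 1)) * indicator {0..2 * g x} y) \<partial>lborel)"
      using r \<Gamma> g(3) by (intro nn_integral_cong) (auto simp: indicator_def mult_ac simp flip: ennreal_mult)
    also have "\<dots> = ennreal (r * 2 * \<Gamma> * g x) * ennreal ((2 * g x) powr (r - 1) / (r - 1))"
      using r g(3) nn_integral_powr_from_0[of "r - 1" "2 * g x"] by (subst nn_integral_cmult) auto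
    also have "\<dots> = ennreal (\<Gamma> * r / (r - 1) * ((2 * g x) * (2 * g x) powr (r - 1)))"
      using r \<Gamma> g(3) by (simp add: mult_ac flip: ennreal_mult)
    also have "(2 * g x) * (2 * g x) powr (r - 1) = 2 powr r * g x powr r"
      using g(3)[of x] by (subst powr_mult_base) (auto simp: powr_mult)
    finally show "(\<integral>\<^sup>+y. ?K x y \<partial>lborel) = ennreal (2 powr r * \<Gamma> * r / (r - 1)) * ennreal (g x powr r)"
      using r \<Gamma> by (simp add: mult_ac flip: ennreal_mult)
  qed
  also have "\<dots> = ennreal (2 powr r * \<Gamma> * r / (r - 1)) * (\<integral>\<^sup>+x. ennreal (g x powr r) \<partial>M)"
    by (rule nn_integral_cmult) measurable
  finally show ?thesis .
qed

end

section \<open>Lebesgue differentiation and the John--Nirenberg inequality\<close>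

text \<open>\<open>approx\<close> is what the proof keeps of the topology: a dense class of
  functions oscillates little on small cells. \<open>decay\<close> turns powers of the measures of
  the cells into geometric sequences.\<close>

locale cell_space = cells M C \<Gamma>
  for M :: "'a measure" and C :: "nat \<Rightarrow> 'a \<Rightarrow> 'a set" and \<Gamma> :: real +
  fixes \<beta> :: real
  assumes nonempty: "space M \<noteq> {}"
    and cell_0: "\<And>x. x \<in> space M \<Longrightarrow> C 0 x = space M"
    and \<beta>: "0 < \<beta>" "\<beta> < 1"
    and decay: "\<And>k x. x \<in> space M \<Longrightarrow> measure M (C (Suc k) x) \<le> \<beta> * measure M (C k x)"
    and approx: "\<And>h e. integrable M h \<Longrightarrow> 0 < e \<Longrightarrow> \<exists>\<phi>. integrable M \<phi> \<and>
      (\<integral>x. \<bar>h x - \<phi> x\<bar> \<partial>M) < (e :: real) \<and>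
      (\<forall>x\<in>space M. \<forall>e'>0. \<exists>k0. \<forall>k\<ge>k0. \<forall>y\<in>C k x. \<bar>\<phi> y - \<phi> x\<bar> < e')"
begin

section \<open>Averages over cells and Lebesgue differentiation\<close>

lemma \<Gamma>_ge_1: "1 \<le> \<Gamma>" using nonempty by (rule \<Gamma>_pos)

lemma set_integral_const_cell: "x \<in> space M \<Longrightarrow> (LINT y:C k x|M. c) = c * measure M (C k x)"
  using cell_sets[of x k] by (simp add: set_lebesgue_integral_def)

lemma avg_mono:
  assumes "integrable M f" "integrable M g" "x \<in> space M" "\<And>y. y \<in> C k x \<Longrightarrow> f y \<le> g y"
  shows "avg k f x \<le> avg k g x"
  unfolding avg_def using assms
  by (intro divide_right_mono set_integral_mono set_integrable_cell) auto

lemma avg_affine: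
  assumes "integrable M f" "x \<in> space M"
  shows "avg k (\<lambda>y. c + s * f y) x = c + s * avg k f x"
proof -
  have c: "set_integrable M (C k x) (\<lambda>y. c)" using assms by (intro set_integrable_cell) auto
  have s: "set_integrable M (C k x) (\<lambda>y. s * f y)" using assms by (intro set_integrable_cell) auto
  have "(LINT y:C k x|M. c + s * f y) = (LINT y:C k x|M. c) + (LINT y:C k x|M. s * f y)"
    by (rule set_integral_add(2)[OF c s])
  then show ?thesis using assms cell_pos[OF assms(2), of k]
    by (simp add: avg_def set_integral_const_cell add_divide_distrib)
qed

lemma abs_avg_diff_le:
  assumes "integrable M f" "x \<in> space M"
  shows "\<bar>avg k f x - c\<bar> \<le> avg k (\<lambda>y. \<bar>f y - c\<bar>) x"
proof -
  have i: "integrable M (\<lambda>y. \<bar>f y - c\<bar>)" using assms by auto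
  have "avg k f x \<le> avg k (\<lambda>y. c + 1 * \<bar>f y - c\<bar>) x"
    using assms i by (intro avg_mono) auto
  moreover have "avg k (\<lambda>y. c + (- 1) * \<bar>f y - c\<bar>) x \<le> avg k f x"
    using assms i by (intro avg_mono) auto
  ultimately show ?thesis
    using avg_affine[OF i assms(2), of k c 1] avg_affine[OF i assms(2), of k c "- 1"] by (auto simp: abs_le_iff)
qed

text \<open>A one-sided form without a limit is what the stopping time argument uses: almost no
  point has all its fine averages below \<open>h x\<close> by a fixed amount. The approximation
  error is controlled by the Markov and weak type inequalities and then sent to 0.\<close>

lemma Lebesgue_differentiation_null:
  assumes h: "integrable M h" and \<delta>: "0 < \<delta>"
  shows "AE x in M. \<exists>k\<ge>m. h x < avg k h x + 3 * \<delta>"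
proof -
  have [measurable]: "h \<in> borel_measurable M" using h by auto
  define Z where "Z = {x\<in>space M. \<forall>k\<in>{m..}. avg k h x + 3 * \<delta> \<le> h x}"
  have [measurable]: "Z \<in> sets M" unfolding Z_def by measurable
  have bd: "\<delta> * measure M Z \<le> (1 + \<Gamma>) * e" if e: "0 < e" for e
  proof -
    obtain \<phi> where \<phi>: "integrable M \<phi>" "(\<integral>x. \<bar>h x - \<phi> x\<bar> \<partial>M) < e"
      "\<And>x e'. x \<in> space M \<Longrightarrow> 0 < e' \<Longrightarrow> \<exists>k0. \<forall>k\<ge>k0. \<forall>y\<in>C k x. \<bar>\<phi> y - \<phi> x\<bar> < e'"
      using approx[OF h e] by blast
    have [measurable]: "\<phi> \<in> borel_measurable M" using \<phi> by auto
    let ?g = "\<lambda>y. \<bar>h y - \<phi> y\<bar>"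
    have g: "integrable M ?g" using h \<phi> by auto
    \<comment> \<open>The slack \<open>3 * \<delta>\<close> is shared by the error at
      \<open>x\<close>, the oscillation of \<open>\<phi>\<close> on the cell and the average
      error.\<close>
    let ?E1 = "{x\<in>space M. \<delta> \<le> ?g x}" and ?E2 = "{x\<in>space M. \<exists>k. \<delta> \<le> avg k ?g x}"
    have "Z \<subseteq> ?E1 \<union> ?E2"
    proof
      fix x assume x: "x \<in> Z"
      then have xs: "x \<in> space M" by (simp add: Z_def)
      show "x \<in> ?E1 \<union> ?E2"
      proof (rule ccontr)
        assume "x \<notin> ?E1 \<union> ?E2"
        then have small: "?g x < \<delta>" "\<And>k. avg k ?g x < \<delta>" using xs by (auto simp: not_le)
        obtain k0 where k0: "\<forall>k\<ge>k0. \<forall>y\<in>C k x. \<bar>\<phi> y - \<phi> x\<bar> < \<delta>" using \<phi>(3)[OF xs \<delta>] by blast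
        define k where "k = max m k0"
        have "avg k (\<lambda>y. (\<phi> x - \<delta>) + (- 1) * ?g y) x \<le> avg k h x"
        proof (intro avg_mono h xs)
          fix y assume "y \<in> C k x"
          then have "\<bar>\<phi> y - \<phi> x\<bar> < \<delta>" using k0[rule_format, of k y] by (simp add: k_def)
          then show "\<phi> x - \<delta> + - 1 * \<bar>h y - \<phi> y\<bar> \<le> h y" by (simp add: abs_if split: if_splits)
        qed (use g in auto)
        then have "\<phi> x - \<delta> - avg k ?g x \<le> avg k h x" using avg_affine[OF g xs, of k "\<phi> x - \<delta>" "- 1"] by simp
        moreover have "avg k h x + 3 * \<delta> \<le> h x" using x by (simp add: Z_def k_def)
        ultimately show False using small(1) small(2)[of k] by linarith
      qed
    qed
    then have "measure M Z \<le> measure M (?E1 \<union> ?E2)" by (intro finite_measure_mono) auto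
    also have "\<dots> \<le> measure M ?E1 + measure M ?E2" by (intro measure_Un_le) auto
    finally have "\<delta> * measure M Z \<le> \<delta> * measure M ?E1 + \<delta> * measure M ?E2"
      using \<delta> by (simp flip: distrib_left)
    also have "\<dots> \<le> (\<integral>x. ?g x \<partial>M) + \<Gamma> * (\<integral>x. ?g x \<partial>M)"
    proof (rule add_mono)
      have "measure M ?E1 \<le> (\<integral>x. ?g x \<partial>M) / \<delta>"
        using integral_Markov_inequality_measure[OF g, of "{}" \<delta>] \<delta> by simp
      then show "\<delta> * measure M ?E1 \<le> (\<integral>x. ?g x \<partial>M)" using \<delta> by (simp add: field_simps)
      show "\<delta> * measure M ?E2 \<le> \<Gamma> * (\<integral>x. ?g x \<partial>M)"
        using g \<delta> by (intro weak_type_maximal) auto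
    qed
    also have "\<dots> = (1 + \<Gamma>) * (\<integral>x. ?g x \<partial>M)" by (simp add: algebra_simps)
    also have "\<dots> \<le> (1 + \<Gamma>) * e" using \<Gamma>_ge_1 \<phi>(2) by (intro mult_left_mono) auto
    finally show ?thesis .
  qed
  have "measure M Z = 0"
  proof (rule ccontr)
    assume "measure M Z \<noteq> 0"
    then have pos: "0 < \<delta> * measure M Z" using \<delta> by (simp add: zero_less_measure_iff)
    have "\<delta> * measure M Z \<le> \<delta> * measure M Z / 2"
    proof -
      have "0 < 1 + \<Gamma>" using \<Gamma>_ge_1 by simp
      moreover from this have "(1 + \<Gamma>) * (\<delta> * measure M Z / 2 / (1 + \<Gamma>)) = \<delta> * measure M Z / 2"
        by (subst nonzero_mult_div_cancel_left[symmetric, of "1 + \<Gamma>"]) auto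
      ultimately show ?thesis using bd[of "\<delta> * measure M Z / 2 / (1 + \<Gamma>)"] pos by simp
    qed
    then show False using pos by simp
  qed
  then have "AE x in M. x \<notin> Z" by (intro AE_not_in) (simp add: null_setsI emeasure_eq_measure)
  with AE_space show ?thesis
    by eventually_elim (auto simp: Z_def not_le)
qed

end

locale bmo_function = cell_space +
  fixes b :: "'a \<Rightarrow> real" and K :: real
  assumes b_integrable: "integrable M b" and K: "0 < K"
    and oscillation: "\<And>k x. x \<in> space M \<Longrightarrow> avg k (\<lambda>y. \<bar>b y - avg k b x\<bar>) x \<le> K"
begin

lemma b_measurable [measurable]: "b \<in> borel_measurable M"
  using b_integrable by auto

text \<open>The integral over the smaller cell is at most that over the larger one, and
  \<open>G\<close> absorbs the ratio of the measures. With \<open>c\<close> free, the same estimate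
  compares two averages and starts the stopping time argument.\<close>

lemma avg_dev_le:
  assumes x: "x \<in> space M" and y: "y \<in> space M" and sub: "C j y \<subseteq> C k x"
    and G: "measure M (C k x) \<le> G * measure M (C j y)"
  shows "avg j (\<lambda>z. \<bar>b z - c\<bar>) y \<le> G * (K + \<bar>avg k b x - c\<bar>)"
proof -
  let ?a = "avg k b x"
  have i: "integrable M (\<lambda>z. \<bar>b z - u\<bar>)" for u using b_integrable by auto
  have pos: "0 < measure M (C j y)" "0 < measure M (C k x)" using x y by (auto intro: cell_pos)
  have "(LINT z:C j y|M. \<bar>b z - c\<bar>) \<le> (LINT z:C k x|M. \<bar>b z - c\<bar>)"
    using i x y sub by (intro set_integral_mono_set) auto
  also have "\<dots> = avg k (\<lambda>z. \<bar>b z - c\<bar>) x * measure M (C k x)" using pos by (simp add: avg_def)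
  also have "\<dots> \<le> (K + \<bar>?a - c\<bar>) * measure M (C k x)"
  proof (rule mult_right_mono)
    have "avg k (\<lambda>z. \<bar>b z - c\<bar>) x \<le> avg k (\<lambda>z. \<bar>?a - c\<bar> + 1 * \<bar>b z - ?a\<bar>) x"
      using i x by (intro avg_mono) auto
    also have "\<dots> \<le> \<bar>?a - c\<bar> + K" using oscillation[OF x, of k] by (subst avg_affine[OF i x]) simp
    finally show "avg k (\<lambda>z. \<bar>b z - c\<bar>) x \<le> K + \<bar>?a - c\<bar>" by simp
  qed simp
  also have "\<dots> \<le> (K + \<bar>?a - c\<bar>) * (G * measure M (C j y))"
    using G K by (intro mult_left_mono) auto
  finally show ?thesis using pos by (simp add: avg_def[of j] divide_le_eq mult_ac)
qed

lemma avg_diff_le: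
  assumes "x \<in> space M" "y \<in> space M" "C j y \<subseteq> C k x" "measure M (C k x) \<le> G * measure M (C j y)"
  shows "\<bar>avg j b y - avg k b x\<bar> \<le> G * K"
  using abs_avg_diff_le[OF b_integrable assms(2), of j "avg k b x"] avg_dev_le[OF assms, of "avg k b x"] by simp

text \<open>Two cells of the same generation that meet are not nested, but each lies in the parent
  of the other; this chain costs two doublings.\<close>

lemma neighbour_cell:
  assumes z: "z \<in> space M" and x: "x \<in> C m z"
  shows "x \<in> space M" "C m x \<subseteq> C (m - 1) z" "measure M (C (m - 1) z) \<le> \<Gamma>\<^sup>2 * measure M (C m x)"
proof -
  show xs: "x \<in> space M" using cell_subset[OF z] x by blast
  show "C m x \<subseteq> C (m - 1) z" using engulf[OF z xs, of m m] cell_self[OF xs] x by blast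
  have "measure M (C (m - 1) z) \<le> \<Gamma> * measure M (C m z)" using z by (rule cell_doubling)
  also have "\<dots> \<le> \<Gamma> * measure M (C (m - 1) x)"
    using engulf[OF xs z, of m m] cell_self[OF xs, of m] x \<Gamma>_ge_1
    by (intro mult_left_mono finite_measure_mono cell_sets xs) auto
  also have "\<dots> \<le> \<Gamma> * (\<Gamma> * measure M (C m x))"
    using cell_doubling[OF xs] \<Gamma>_ge_1 by (intro mult_left_mono) auto
  finally show "measure M (C (m - 1) z) \<le> \<Gamma>\<^sup>2 * measure M (C m x)" by (simp add: power2_eq_square mult_ac)
qed

text \<open>Two requirements fix this constant. The cells of generation \<open>m\<close> at points
  of \<open>C m z\<close> have average of \<open>|b - c|\<close> at most
  \<open>\<Lambda> / 2\<close>, so nothing stops at once. The stopped cells have total measure at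
  most \<open>K * (1 + \<Gamma>) * \<Gamma> / \<Lambda>\<close> times that of \<open>C m z\<close>,
  and passing to their parents costs one more \<open>\<Gamma>\<close>, which leaves exactly one
  half.\<close>

definition \<Lambda> :: real where "\<Lambda> = 2 * K * (1 + \<Gamma>) * \<Gamma>\<^sup>2"

lemma \<Lambda>_pos: "0 < \<Lambda>" using K \<Gamma>_ge_1 by (auto simp: \<Lambda>_def intro!: mult_pos_pos)

text \<open>Stop at the first generation where the average of \<open>|b - c|\<close> reaches \<open>\<Lambda>\<close>. The stopped cells have
  small total measure, and on their parents, which are not stopped, the average of \<open>b\<close> is within \<open>\<Lambda>\<close> of
  \<open>c\<close>. Almost every point where \<open>|b - c|\<close> exceeds \<open>\<Lambda>\<close> lies in a stopped cell.\<close>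

lemma level_set_halving:
  assumes \<psi>: "\<And>k x. x \<in> space M \<Longrightarrow> measure M {y\<in>C k x. u \<le> \<bar>b y - avg k b x\<bar>} \<le> \<psi> * measure M (C k x)"
    and u: "0 \<le> u" and z: "z \<in> space M"
  shows "measure M {y\<in>C m z. u + 2 * \<Lambda> \<le> \<bar>b y - avg m b z\<bar>} \<le> \<psi> / 2 * measure M (C m z)"
proof -
  define c where "c = avg m b z"
  define h where "h = (\<lambda>y. \<bar>b y - c\<bar>)"
  have h: "integrable M h" "\<And>y. 0 \<le> h y" using b_integrable by (auto simp: h_def)
  have [measurable]: "h \<in> borel_measurable M" using h by auto
  have cs: "C k x \<in> sets M" if "x \<in> space M" for k x using that by (rule cell_sets)
  note [measurable] = cs[OF z]
  have \<psi>0: "0 \<le> \<psi>"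
    using order_trans[OF measure_nonneg \<psi>[OF z]] cell_pos[OF z] by (metis zero_le_mult_iff not_le)
  \<comment> \<open>\<open>k\<close> is the stopping generation of \<open>x\<close>. As
    \<open>m < k\<close>, the parent generation \<open>k - 1\<close> is among those where the
    average is still small.\<close>
  define P where "P = (\<lambda>k x. x \<in> C m z \<and> m < k \<and> \<Lambda> \<le> avg k h x \<and> (\<forall>j. m \<le> j \<and> j < k \<longrightarrow> avg j h x < \<Lambda>))"
  let ?S = "{y\<in>C m z. u + 2 * \<Lambda> \<le> h y}"
  let ?E = "\<lambda>n. {y\<in>space M. \<exists>k<n. P k y}"
  have c1: "\<bar>avg (m - 1) b z - c\<bar> \<le> \<Gamma> * K"
    unfolding c_def using z cell_doubling[OF z, of m] engulf[OF z z, of m m] cell_self[OF z, of m]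
    by (subst abs_minus_commute, intro avg_diff_le) auto
  \<comment> \<open>The stopped cells meet \<open>C m z\<close> but may stick out of it. They stay
    inside its parent by \<open>engulf\<close>, so \<open>h\<close> is integrated there.\<close>
  have parent: "(LINT y:C (m - 1) z|M. h y) \<le> K * (1 + \<Gamma>) * \<Gamma> * measure M (C m z)"
  proof -
    have "avg (m - 1) h z \<le> 1 * (K + \<bar>avg (m - 1) b z - c\<bar>)"
      unfolding h_def using z by (intro avg_dev_le) auto
    also have "\<dots> \<le> K * (1 + \<Gamma>)" using c1 by (simp add: algebra_simps)
    finally have "(LINT y:C (m - 1) z|M. h y) \<le> K * (1 + \<Gamma>) * measure M (C (m - 1) z)"
      using cell_pos[OF z, of "m - 1"] by (simp add: avg_def divide_le_eq)
    also have "\<dots> \<le> K * (1 + \<Gamma>) * (\<Gamma> * measure M (C m z))"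
      using cell_doubling[OF z, of m] K \<Gamma>_ge_1 by (intro mult_left_mono) auto
    finally show ?thesis by (simp add: mult_ac)
  qed
  have start: "avg m h x < \<Lambda>" if x: "x \<in> C m z" for x
  proof -
    note n = neighbour_cell[OF z x]
    have "avg m h x \<le> \<Gamma>\<^sup>2 * (K + \<bar>avg (m - 1) b z - c\<bar>)"
      unfolding h_def by (rule avg_dev_le[OF z n])
    also have "\<dots> \<le> \<Gamma>\<^sup>2 * (K + \<Gamma> * K)" using c1 by (intro mult_left_mono) auto
    also have "\<dots> = \<Lambda> / 2" by (simp add: \<Lambda>_def algebra_simps)
    also have "\<dots> < \<Lambda>" using \<Lambda>_pos by simp
    finally show ?thesis .
  qed
  have step: "measure M (?S \<inter> (\<Union>(k, x)\<in>G. C (k - 1) x)) \<le> \<psi> / 2 * measure M (C m z)"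
    if G: "finite G" "\<And>k x. (k, x) \<in> G \<Longrightarrow> x \<in> space M \<and> P k x" "disjoint_family_on (\<lambda>(k, x). C k x) G" for G
  proof -
    \<comment> \<open>A point with large \<open>|b - c|\<close> in the parent of a stopped cell
      still deviates by \<open>u\<close> from the average of \<open>b\<close> on that parent, to
      which the hypothesis on \<open>\<psi>\<close> applies.\<close>
    let ?D = "\<lambda>(k, x). {y\<in>C (k - 1) x. u \<le> \<bar>b y - avg (k - 1) b x\<bar>}"
    have D: "?D p \<in> sets M" if "p \<in> G" for p
      using G(2) that by (cases p) auto
    have "?S \<inter> (\<Union>(k, x)\<in>G. C (k - 1) x) \<subseteq> (\<Union>p\<in>G. ?D p)"
    proof
      fix y assume "y \<in> ?S \<inter> (\<Union>(k, x)\<in>G. C (k - 1) x)"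
      then obtain k x where kx: "(k, x) \<in> G" "y \<in> C (k - 1) x" "u + 2 * \<Lambda> \<le> h y" by auto
      then have "avg (k - 1) h x < \<Lambda>" "x \<in> space M" using G(2)[OF kx(1)] by (auto simp: P_def)
      then have "\<bar>avg (k - 1) b x - c\<bar> < \<Lambda>"
        using abs_avg_diff_le[OF b_integrable, of x "k - 1" c] by (simp add: h_def)
      then have "u \<le> \<bar>b y - avg (k - 1) b x\<bar>" using kx(3) \<Lambda>_pos unfolding h_def by linarith
      then show "y \<in> (\<Union>p\<in>G. ?D p)" using kx by force
    qed
    then have "measure M (?S \<inter> (\<Union>(k, x)\<in>G. C (k - 1) x)) \<le> measure M (\<Union>p\<in>G. ?D p)"
      using G(1) D by (intro finite_measure_mono sets.finite_UN) auto
    also have "\<dots> \<le> (\<Sum>p\<in>G. measure M (?D p))"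
      using G(1) D by (intro measure_UNION_le) auto
    also have "\<dots> \<le> (\<Sum>(k, x)\<in>G. \<psi> * \<Gamma> * measure M (C k x))"
    proof (rule sum_mono)
      fix p assume p: "p \<in> G"
      obtain k x where kx: "p = (k, x)" by (cases p)
      have x: "x \<in> space M" using G(2) p kx by blast
      have "measure M (?D p) \<le> \<psi> * measure M (C (k - 1) x)" using \<psi>[OF x, of "k - 1"] by (simp add: kx)
      also have "\<dots> \<le> \<psi> * (\<Gamma> * measure M (C k x))" using \<psi>0 cell_doubling[OF x] by (intro mult_left_mono)
      finally show "measure M (?D p) \<le> (case p of (k, x) \<Rightarrow> \<psi> * \<Gamma> * measure M (C k x))" by (simp add: kx mult_ac)
    qed
    also have "\<dots> = \<psi> * \<Gamma> / \<Lambda> * (\<Lambda> * (\<Sum>(k, x)\<in>G. measure M (C k x)))"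
      using \<Lambda>_pos by (simp add: sum_distrib_left case_prod_beta mult.assoc)
    also have "\<dots> \<le> \<psi> * \<Gamma> / \<Lambda> * (LINT y:C (m - 1) z|M. h y)"
    proof (intro mult_left_mono sum_disjoint_cells_le h G(1,3) \<Lambda>_pos)
      show "x \<in> space M \<and> \<Lambda> \<le> avg k h x" if "(k, x) \<in> G" for k x
        using G(2)[OF that] by (auto simp: P_def)
      show "C k x \<subseteq> C (m - 1) z" if "(k, x) \<in> G" for k x
        using G(2)[OF that] engulf[OF z, of x m k] cell_self[of x k] by (auto simp: P_def)
    qed (use z \<psi>0 \<Gamma>_ge_1 \<Lambda>_pos in auto)
    also have "\<dots> \<le> \<psi> * \<Gamma> / \<Lambda> * (K * (1 + \<Gamma>) * \<Gamma> * measure M (C m z))"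
      using \<psi>0 \<Gamma>_ge_1 \<Lambda>_pos parent by (intro mult_left_mono) auto
    also have "\<dots> = \<psi> / 2 * measure M (C m z)"
    proof -
      have "\<Lambda> = 2 * (K * (1 + \<Gamma>) * \<Gamma>) * \<Gamma>" by (simp add: \<Lambda>_def power2_eq_square)
      moreover have "0 < K * (1 + \<Gamma>) * \<Gamma>" using K \<Gamma>_ge_1 by (intro mult_pos_pos) auto
      ultimately show ?thesis using \<Gamma>_ge_1 K by simp
    qed
    finally show ?thesis .
  qed
  have E_meas [measurable]: "?S \<inter> ?E n \<in> sets M" for n
  proof -
    have "?S \<inter> ?E n = ?S \<inter> {y\<in>space M. \<exists>k<n. m < k \<and> \<Lambda> \<le> avg k h y \<and> (\<forall>j\<in>{m..<k}. avg j h y < \<Lambda>)}"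
      by (auto simp: P_def)
    also have "\<dots> \<in> sets M" by measurable
    finally show ?thesis .
  qed
  have bd: "measure M (?S \<inter> ?E n) \<le> \<psi> / 2 * measure M (C m z)" for n
  proof -
    obtain G where G: "finite G" "\<forall>(k, x)\<in>G. k < n \<and> x \<in> space M \<and> P k x"
      "disjoint_family_on (\<lambda>(k, x). C k x) G" "?E n \<subseteq> (\<Union>(k, x)\<in>G. C (k - 1) x)"
      using Vitali_cover[of n P] by blast
    have "measure M (?S \<inter> ?E n) \<le> measure M (?S \<inter> (\<Union>p\<in>G. case p of (k, x) \<Rightarrow> C (k - 1) x))"
      using G by (intro finite_measure_mono sets.Int sets.finite_UN) auto
    also have "\<dots> \<le> \<psi> / 2 * measure M (C m z)"
    proof (rule step[OF G(1) _ G(3)])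
      show "x \<in> space M \<and> P k x" if "(k, x) \<in> G" for k x using bspec[OF G(2) that] by simp
    qed
    finally show ?thesis .
  qed
  have "(\<lambda>n. measure M (?S \<inter> ?E n)) \<longlonglongrightarrow> measure M (\<Union>n. ?S \<inter> ?E n)"
  proof (rule finite_Lim_measure_incseq)
    show "range (\<lambda>n. ?S \<inter> ?E n) \<subseteq> sets M" using E_meas by blast
    show "incseq (\<lambda>n. ?S \<inter> ?E n)"
      unfolding incseq_def using order.strict_trans2 by blast
  qed
  then have lim: "measure M (\<Union>n. ?S \<inter> ?E n) \<le> \<psi> / 2 * measure M (C m z)"
    by (rule LIMSEQ_le_const2) (use bd in auto)
  \<comment> \<open>Countably many margins, so that one below \<Lambda> is available outside a
    single null set. Since \<open>h y\<close> is at least \<open>u + 2 * \<Lambda>\<close>, some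
    average then reaches \<Lambda>.\<close>
  have "AE y in M. \<forall>i::nat. \<exists>k\<ge>m. h y < avg k h y + 3 * (1 / Suc i)"
    by (subst AE_all_countable, intro allI Lebesgue_differentiation_null[OF h(1)]) simp
  then have "AE y in M. y \<in> ?S \<longrightarrow> y \<in> (\<Union>n. ?S \<inter> ?E n)"
  proof eventually_elim
    case (elim y)
    show ?case
    proof
      assume y: "y \<in> ?S"
      then have ys: "y \<in> C m z" "y \<in> space M" using cell_subset[OF z] by auto
      obtain i where "3 * (1 / real (Suc i)) < \<Lambda>"
        using reals_Archimedean[of "\<Lambda> / 3"] \<Lambda>_pos by (auto simp: inverse_eq_divide)
      moreover from elim obtain k where "m \<le> k" "h y < avg k h y + 3 * (1 / real (Suc i))" by blast
      moreover have "u + 2 * \<Lambda> \<le> h y" using y by simp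
      ultimately have k: "m \<le> k" "\<Lambda> \<le> avg k h y" using u by linarith+
      define k1 where "k1 = (LEAST k. m \<le> k \<and> \<Lambda> \<le> avg k h y)"
      have k1: "m \<le> k1 \<and> \<Lambda> \<le> avg k1 h y"
        unfolding k1_def by (rule LeastI[of _ k]) (use k in auto)
      have "k1 \<noteq> m" using start[OF ys(1)] k1 by auto
      moreover have "avg j h y < \<Lambda>" if "m \<le> j" "j < k1" for j
        using not_less_Least[OF that(2)[unfolded k1_def]] that(1) by (simp add: not_le)
      ultimately have "P k1 y" using k1 ys by (auto simp: P_def le_less)
      then have "y \<in> ?E (Suc k1)" using ys by blast
      then show "y \<in> (\<Union>n. ?S \<inter> ?E n)" using y by blast
    qed
  qed
  then have "measure M ?S \<le> measure M (\<Union>n. ?S \<inter> ?E n)"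
    by (rule finite_measure_mono_AE) (intro sets.countable_UN image_subsetI E_meas)
  then have "measure M ?S \<le> \<psi> / 2 * measure M (C m z)" using lim by (rule order_trans)
  then show ?thesis by (simp only: h_def c_def)
qed

text \<open>Iterated halving, from the trivial factor 1 at height 0. The induction covers all cells
  at once, as the halving step uses the bound on the parents of the stopped cells.\<close>

lemma level_set_decay:
  "x \<in> space M \<Longrightarrow> measure M {y\<in>C k x. real j * (2 * \<Lambda>) \<le> \<bar>b y - avg k b x\<bar>} \<le> (1 / 2) ^ j * measure M (C k x)"
proof (induction j arbitrary: k x)
  case 0
  then show ?case by (auto intro!: finite_measure_mono)
next
  case (Suc j)
  have "measure M {y\<in>C k x. real j * (2 * \<Lambda>) + 2 * \<Lambda> \<le> \<bar>b y - avg k b x\<bar>} \<le> (1 / 2) ^ j / 2 * measure M (C k x)"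
    using Suc.IH \<Lambda>_pos Suc.prems by (intro level_set_halving) auto
  then show ?case by (simp add: algebra_simps)
qed

theorem John_Nirenberg:
  assumes x: "x \<in> space M" and \<kappa>: "\<bar>\<kappa>\<bar> * (2 * \<Lambda>) \<le> ln (4 / 3)"
  shows "(\<integral>\<^sup>+y\<in>C k x. ennreal (exp (\<bar>\<kappa>\<bar> * \<bar>b y - avg k b x\<bar>)) \<partial>M) \<le> ennreal (4 * measure M (C k x))"
proof -
  define L where "L = 2 * \<Lambda>"
  have L: "0 < L" using \<Lambda>_pos by (simp add: L_def)
  define h where "h = (\<lambda>y. \<bar>b y - avg k b x\<bar>)"
  have [measurable]: "h \<in> borel_measurable M" "C k x \<in> sets M" using x by (auto simp: h_def)
  let ?D = "\<lambda>j. {y\<in>C k x. real j * L \<le> h y}"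
  have D [measurable]: "?D j \<in> sets M" for j by measurable
  \<comment> \<open>From one height \<open>j * L\<close> to the next the exponential grows by at
    most 4/3 while the bound on the level set halves. The series has ratio 2/3 and first term 4/3
    times the measure, whence the constant 4.\<close>
  have "exp (\<bar>\<kappa>\<bar> * L) \<le> 4 / 3" using \<kappa> by (metis L_def exp_le_cancel_iff exp_ln zero_less_divide_iff zero_less_numeral)
  then have E: "exp (\<bar>\<kappa>\<bar> * (real j * L)) \<le> (4 / 3) ^ j" for j
    using power_mono[of "exp (\<bar>\<kappa>\<bar> * L)" "4/3" j] by (simp add: exp_of_nat_mult[symmetric] mult_ac)
  have term_le: "f j \<le> (\<Sum>j. f j)" for f :: "nat \<Rightarrow> ennreal" and j
    using sum_le_suminf[of f "{j}"] by simp
  have pw: "ennreal (exp (\<bar>\<kappa>\<bar> * h y)) * indicator (C k x) y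
      \<le> (\<Sum>j. ennreal ((4 / 3) ^ Suc j) * indicator (?D j) y)" for y
  proof (cases "y \<in> C k x")
    case True
    define j where "j = nat \<lfloor>h y / L\<rfloor>"
    have h0: "0 \<le> h y / L" using L by (simp add: h_def)
    have j: "real j \<le> h y / L" "h y / L \<le> real (Suc j)" using h0 by (auto simp: j_def) linarith
    then have j': "real j * L \<le> h y" "h y \<le> real (Suc j) * L" using L by (auto simp: field_simps)
    have "exp (\<bar>\<kappa>\<bar> * h y) \<le> exp (\<bar>\<kappa>\<bar> * (real (Suc j) * L))"
      using j'(2) by (simp add: mult_left_mono)
    also have "\<dots> \<le> (4 / 3) ^ Suc j" by (rule E)
    finally have "ennreal (exp (\<bar>\<kappa>\<bar> * h y)) * indicator (C k x) y \<le> ennreal ((4 / 3) ^ Suc j) * indicator (?D j) y"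
      using j'(1) True by (auto intro: ennreal_leI)
    also have "\<dots> \<le> (\<Sum>j. ennreal ((4 / 3) ^ Suc j) * indicator (?D j) y)"
      by (rule term_le)
    finally show ?thesis .
  qed simp
  have "(\<integral>\<^sup>+y\<in>C k x. ennreal (exp (\<bar>\<kappa>\<bar> * h y)) \<partial>M)
     \<le> (\<integral>\<^sup>+y. (\<Sum>j. ennreal ((4 / 3) ^ Suc j) * indicator (?D j) y) \<partial>M)"
    by (rule nn_integral_mono) (rule pw)
  also have "\<dots> = (\<Sum>j. \<integral>\<^sup>+y. ennreal ((4 / 3) ^ Suc j) * indicator (?D j) y \<partial>M)"
    by (rule nn_integral_suminf) measurable
  also have "\<dots> \<le> (\<Sum>j. ennreal ((4 / 3 * measure M (C k x)) * (2 / 3) ^ j))"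
  proof (intro suminf_le)
    fix j
    have "(\<integral>\<^sup>+y. ennreal ((4 / 3) ^ Suc j) * indicator (?D j) y \<partial>M) = ennreal ((4 / 3) ^ Suc j * measure M (?D j))"
      by (subst nn_integral_cmult_indicator) (auto simp: emeasure_eq_measure simp flip: ennreal_mult)
    also have "\<dots> \<le> ennreal ((4 / 3) ^ Suc j * ((1 / 2) ^ j * measure M (C k x)))"
      using level_set_decay[OF x, of k j] by (intro ennreal_leI mult_left_mono) (auto simp: h_def L_def)
    also have "(4 / 3) ^ Suc j * ((1 / 2) ^ j * measure M (C k x)) = (4 / 3 * measure M (C k x)) * (2 / 3) ^ j"
      by (simp add: power_divide field_simps flip: power_mult_distrib)
    finally show "(\<integral>\<^sup>+y. ennreal ((4 / 3) ^ Suc j) * indicator (?D j) y \<partial>M) \<le> ennreal ((4 / 3 * measure M (C k x)) * (2 / 3) ^ j)" .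
  qed auto
  also have "\<dots> = ennreal (\<Sum>j. (4 / 3 * measure M (C k x)) * (2 / 3) ^ j)"
    by (intro suminf_ennreal2 summable_mult summable_geometric) auto
  also have "(\<Sum>j. (4 / 3 * measure M (C k x)) * (2 / 3) ^ j) = 4 * measure M (C k x)"
    by (subst suminf_mult) (auto simp: suminf_geometric)
  finally show ?thesis by (simp add: h_def)
qed

end

section \<open>The weighted maximal inequality\<close>

text \<open>Here \<open>b\<close> is a small multiple of the given function. The exponents in \<open>small_exp\<close> cover all those that
  occur in applications of Hoelder's inequality; \<open>small_step\<close> says that exponentials of \<open>b\<close> vary more slowly
  between generations than the relevant powers of the measures of the cells.\<close>

locale small_bmo = bmo_function +
  fixes s0 q l \<alpha> :: real
  assumes s0: "1 < s0" and q: "s0 \<le> q" and l: "0 \<le> l" "l < 1" and \<alpha>: "0 < \<alpha>"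
    and small_exp: "(1 + q) * (1 + s0) / (s0 - 1) * (2 * \<Lambda>) \<le> ln (4 / 3)"
    and small_step: "q * (\<Gamma>\<^sup>2 * K) \<le> - ln \<beta> * (min \<alpha> ((1 - l) / q) / 2)"
begin

definition \<omega> :: real where "\<omega> = \<Gamma>\<^sup>2 * K"
definition \<theta> :: real where "\<theta> = \<beta> powr (min \<alpha> ((1 - l) / q) / 2)"
text \<open>Strictly between 1 and \<open>s0\<close>: the power \<open>u\<close> is spent on
  Hoelder's inequality, and \<open>s / u\<close> stays above 1 for the maximal inequality, uniformly
  in \<open>s \<ge> s0\<close>.\<close>

definition u :: real where "u = (1 + s0) / 2"

abbreviation \<mu> :: "nat \<Rightarrow> 'a \<Rightarrow> real" where "\<mu> k x \<equiv> measure M (C k x)"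
abbreviation a :: "nat \<Rightarrow> 'a \<Rightarrow> real" where "a k x \<equiv> avg k b x"

lemma q_pos: "1 < q" using s0 q by simp

lemma \<omega>_nonneg: "0 \<le> \<omega>" using K by (simp add: \<omega>_def)

lemma \<theta>: "0 < \<theta>" "\<theta> < 1"
proof -
  have "0 < min \<alpha> ((1 - l) / q) / 2" using \<alpha> l q_pos by simp
  then show "0 < \<theta>" "\<theta> < 1"
    using \<beta> powr_less_mono2[of "min \<alpha> ((1 - l) / q) / 2" \<beta> 1] unfolding \<theta>_def by auto
qed

text \<open>By \<open>small_step\<close> the growth \<open>exp (q * \<omega>)\<close> uses up at
  most half of the decay exponent; the other half is \<theta>.\<close>

lemma decay_dominates:
  assumes "min \<alpha> ((1 - l) / q) \<le> x" "y \<le> q * \<omega>"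
  shows "\<beta> powr x * exp y \<le> \<theta>"
proof -
  define g where "g = min \<alpha> ((1 - l) / q)"
  have "\<beta> powr x * exp y = exp (x * ln \<beta> + y)" using \<beta> by (simp add: powr_def exp_add)
  also have "\<dots> \<le> exp (g / 2 * ln \<beta>)"
  proof -
    have "x * ln \<beta> \<le> g * ln \<beta>" using \<beta> assms(1) unfolding g_def by (intro mult_right_mono_neg) auto
    moreover have "y \<le> - ln \<beta> * (g / 2)" using assms(2) small_step by (simp add: \<omega>_def g_def)
    moreover have "g * ln \<beta> + - ln \<beta> * (g / 2) = g / 2 * ln \<beta>" by (simp add: field_simps)
    ultimately have "x * ln \<beta> + y \<le> g / 2 * ln \<beta>" by linarith
    then show ?thesis by simp
  qed
  also have "\<dots> = \<theta>" using \<beta> by (simp add: \<theta>_def powr_def g_def)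
  finally show ?thesis .
qed

lemma avg_step: "x \<in> space M \<Longrightarrow> \<bar>a (Suc k) x - a k x\<bar> \<le> \<omega>"
proof -
  assume x: "x \<in> space M"
  have "\<bar>a (Suc k) x - a k x\<bar> \<le> \<Gamma> * K"
    using x cell_mono cell_doubling[OF x, of "Suc k"] by (intro avg_diff_le) auto
  also have "\<dots> \<le> \<omega>" using \<Gamma>_ge_1 K by (simp add: \<omega>_def power2_eq_square)
  finally show ?thesis .
qed

lemma avg_parent_step: "x \<in> space M \<Longrightarrow> \<bar>a k x - a (k - 1) x\<bar> \<le> \<omega>"
  using avg_step[of x "k - 1"] \<omega>_nonneg by (cases k) auto

lemma exp_deviation_le:
  assumes x: "x \<in> space M" and c: "\<bar>c\<bar> \<le> (1 + q) * (1 + s0) / (s0 - 1)"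
  shows "(\<integral>\<^sup>+y\<in>C k x. ennreal (exp (c * (b y - a k x))) \<partial>M) \<le> ennreal (4 * \<mu> k x)"
proof -
  have "\<bar>c\<bar> * (2 * \<Lambda>) \<le> (1 + q) * (1 + s0) / (s0 - 1) * (2 * \<Lambda>)"
    using c \<Lambda>_pos by (intro mult_right_mono) auto
  then have "(\<integral>\<^sup>+y\<in>C k x. ennreal (exp (\<bar>c\<bar> * \<bar>b y - a k x\<bar>)) \<partial>M) \<le> ennreal (4 * \<mu> k x)"
    using small_exp by (intro John_Nirenberg x) simp
  moreover have "(\<integral>\<^sup>+y\<in>C k x. ennreal (exp (c * (b y - a k x))) \<partial>M)
      \<le> (\<integral>\<^sup>+y\<in>C k x. ennreal (exp (\<bar>c\<bar> * \<bar>b y - a k x\<bar>)) \<partial>M)"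
  proof (intro nn_integral_mono mult_right_mono ennreal_leI)
    fix y
    have "c * (b y - a k x) \<le> \<bar>c * (b y - a k x)\<bar>" by simp
    then show "exp (c * (b y - a k x)) \<le> exp (\<bar>c\<bar> * \<bar>b y - a k x\<bar>)" by (simp add: abs_mult)
  qed simp
  ultimately show ?thesis by simp
qed

lemma exponent_le_max: "q \<le> (1 + q) * (1 + s0) / (s0 - 1)" "s0 / (s0 - 1) \<le> (1 + q) * (1 + s0) / (s0 - 1)"
proof -
  have "q * (s0 - 1) \<le> q * (1 + s0)" using q_pos by (intro mult_left_mono) auto
  also have "\<dots> \<le> (1 + q) * (1 + s0)" using s0 by (intro mult_right_mono) auto
  finally show "q \<le> (1 + q) * (1 + s0) / (s0 - 1)" using s0 by (simp add: le_divide_eq)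
  have "s0 \<le> (1 + q) * (1 + s0)" using s0 q_pos mult_mono[of 1 "1 + q" s0 "1 + s0"] by simp
  then show "s0 / (s0 - 1) \<le> (1 + q) * (1 + s0) / (s0 - 1)" using s0 by (intro divide_right_mono) auto
qed

section \<open>Exponential weights as doubling measures\<close>

definition weight_measure :: "real \<Rightarrow> 'a measure" where
  "weight_measure t = density M (\<lambda>y. ennreal (exp (t * b y)))"

text \<open>John--Nirenberg gives the upper bound and Jensen the lower one, so up to a factor 4 the
  weighted measure of a cell is read off from the average of \<open>b\<close>. Doubling for the
  weight then follows from the slow variation of the averages.\<close>

lemma weight_cell:
  assumes x: "x \<in> space M" and t: "0 \<le> t" "t \<le> q"
  shows "emeasure (weight_measure t) (C k x) = ennreal (LINT y:C k x|M. exp (t * b y))"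
    and "set_integrable M (C k x) (\<lambda>y. exp (t * b y))"
    and "exp (t * a k x) * \<mu> k x \<le> (LINT y:C k x|M. exp (t * b y))"
    and "(LINT y:C k x|M. exp (t * b y)) \<le> 4 * exp (t * a k x) * \<mu> k x"
proof -
  have [measurable]: "C k x \<in> sets M" using x by (rule cell_sets)
  have "(\<integral>\<^sup>+y\<in>C k x. ennreal (exp (t * b y)) \<partial>M)
      = (\<integral>\<^sup>+y. ennreal (exp (t * a k x)) * (ennreal (exp (t * (b y - a k x))) * indicator (C k x) y) \<partial>M)"
    by (intro nn_integral_cong) (auto simp: indicator_def right_diff_distrib exp_diff simp flip: ennreal_mult)
  also have "\<dots> = ennreal (exp (t * a k x)) * (\<integral>\<^sup>+y\<in>C k x. ennreal (exp (t * (b y - a k x))) \<partial>M)"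
    by (rule nn_integral_cmult) measurable
  also have "\<dots> \<le> ennreal (exp (t * a k x)) * ennreal (4 * \<mu> k x)"
    using t exponent_le_max by (intro mult_left_mono exp_deviation_le x) auto
  also have "\<dots> = ennreal (4 * exp (t * a k x) * \<mu> k x)" by (simp add: mult_ac flip: ennreal_mult)
  finally have bd: "(\<integral>\<^sup>+y\<in>C k x. ennreal (exp (t * b y)) \<partial>M) \<le> ennreal (4 * exp (t * a k x) * \<mu> k x)" .
  have eq: "(\<integral>\<^sup>+y\<in>C k x. ennreal (exp (t * b y)) \<partial>M) = (\<integral>\<^sup>+y. ennreal (indicator (C k x) y *\<^sub>R exp (t * b y)) \<partial>M)"
    by (intro nn_integral_cong) (auto simp: indicator_def)
  show int: "set_integrable M (C k x) (\<lambda>y. exp (t * b y))"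
    unfolding set_integrable_def
    using bd unfolding eq by (intro integrableI_nonneg) (auto intro: le_less_trans)
  have val: "(\<integral>\<^sup>+y\<in>C k x. ennreal (exp (t * b y)) \<partial>M) = ennreal (LINT y:C k x|M. exp (t * b y))"
    unfolding eq set_lebesgue_integral_def
    by (rule nn_integral_eq_integral) (use int in \<open>auto simp: set_integrable_def\<close>)
  then show "emeasure (weight_measure t) (C k x) = ennreal (LINT y:C k x|M. exp (t * b y))"
    by (simp add: weight_measure_def emeasure_density)
  show "(LINT y:C k x|M. exp (t * b y)) \<le> 4 * exp (t * a k x) * \<mu> k x"
    using bd by (simp add: val)
  \<comment> \<open>Jensen's inequality, from the tangent line of the exponential at the average.\<close>
  have ib: "set_integrable M (C k x) (\<lambda>y. t * (b y - a k x))" and ic: "set_integrable M (C k x) (\<lambda>y. 1 :: real)"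
    using b_integrable x by (auto intro!: set_integrable_cell)
  have "avg k (\<lambda>y. - (t * a k x) + t * b y) x = 0" by (subst avg_affine[OF b_integrable x]) simp
  then have zero: "(LINT y:C k x|M. t * (b y - a k x)) = 0"
    using cell_pos[OF x, of k] by (simp add: avg_def algebra_simps)
  have "exp (t * a k x) * \<mu> k x = exp (t * a k x) * (LINT y:C k x|M. 1 + t * (b y - a k x))"
    using set_integral_add(2)[OF ic ib] zero set_integral_const_cell[OF x, of k 1] by simp
  also have "\<dots> = (LINT y:C k x|M. exp (t * a k x) * (1 + t * (b y - a k x)))" by simp
  also have "\<dots> \<le> (LINT y:C k x|M. exp (t * b y))"
  proof (rule set_integral_mono)
    show "set_integrable M (C k x) (\<lambda>y. exp (t * a k x) * (1 + t * (b y - a k x)))"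
      using set_integral_add(1)[OF ic ib] by simp
    fix y
    have "exp (t * a k x) * (1 + t * (b y - a k x)) \<le> exp (t * a k x) * exp (t * (b y - a k x))"
      by (intro mult_left_mono exp_ge_add_one_self) simp
    then show "exp (t * a k x) * (1 + t * (b y - a k x)) \<le> exp (t * b y)"
      by (simp add: right_diff_distrib exp_diff)
  qed (rule int)
  finally show "exp (t * a k x) * \<mu> k x \<le> (LINT y:C k x|M. exp (t * b y))" .
qed

lemma weight_measure_bounds:
  assumes "x \<in> space M" "0 \<le> t" "t \<le> q"
  shows "exp (t * a k x) * \<mu> k x \<le> measure (weight_measure t) (C k x)"
    and "measure (weight_measure t) (C k x) \<le> 4 * exp (t * a k x) * \<mu> k x"
proof -
  have "0 \<le> (LINT y:C k x|M. exp (t * b y))"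
    unfolding set_lebesgue_integral_def by (intro integral_nonneg_AE) auto
  then have "measure (weight_measure t) (C k x) = (LINT y:C k x|M. exp (t * b y))"
    using weight_cell(1)[OF assms, of k] by (simp add: measure_def)
  then show "exp (t * a k x) * \<mu> k x \<le> measure (weight_measure t) (C k x)"
    "measure (weight_measure t) (C k x) \<le> 4 * exp (t * a k x) * \<mu> k x"
    using weight_cell(3,4)[OF assms, of k] by auto
qed

lemma cells_weight:
  assumes t: "0 \<le> t" "t \<le> q"
  shows "cells (weight_measure t) C (4 * \<Gamma> * exp (q * \<omega>))"
proof -
  have sets [simp]: "sets (weight_measure t) = sets M" and space [simp]: "space (weight_measure t) = space M"
    by (simp_all add: weight_measure_def)
  obtain x0 where x0: "x0 \<in> space M" using nonempty by blast
  have fm: "finite_measure (weight_measure t)"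
    using weight_cell(1)[OF x0 t, of 0] cell_0[OF x0] by (intro finite_measureI) simp
  show ?thesis
  proof (intro cells.intro fm cells_axioms.intro)
    show "x \<in> space (weight_measure t) \<Longrightarrow> C k x \<in> sets (weight_measure t)" for k x using cell_sets by simp
    show "finite (C k ` space (weight_measure t))" for k using finite_cells by simp
    show "x \<in> space (weight_measure t) \<Longrightarrow> {y \<in> space (weight_measure t). C k y = C k x} \<in> sets (weight_measure t)" for k x
      using cell_fiber by simp
    show "x \<in> space (weight_measure t) \<Longrightarrow> x \<in> C k x" for k x using cell_self by simp
    show "x \<in> space (weight_measure t) \<Longrightarrow> y \<in> space (weight_measure t) \<Longrightarrow> k \<le> j \<Longrightarrow>
        C j y \<inter> C k x \<noteq> {} \<Longrightarrow> C j y \<subseteq> C (k - 1) x" for j k x y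
      using engulf by simp
    show "0 < measure (weight_measure t) (C k x)" if "x \<in> space (weight_measure t)" for k x
      using weight_measure_bounds(1)[OF _ t, of x k] that cell_pos[of x k]
      by (auto intro: less_le_trans[rotated])
    show "measure (weight_measure t) (C (k - 1) x) \<le> 4 * \<Gamma> * exp (q * \<omega>) * measure (weight_measure t) (C k x)"
      if "x \<in> space (weight_measure t)" for k x
    proof -
      have x: "x \<in> space M" using that by simp
      have "t * a (k - 1) x \<le> q * \<omega> + t * a k x"
      proof -
        have "t * (a (k - 1) x - a k x) \<le> t * \<omega>" using avg_parent_step[OF x, of k] t by (intro mult_left_mono) auto
        also have "\<dots> \<le> q * \<omega>" using t \<omega>_nonneg by (intro mult_right_mono) auto
        finally show ?thesis by (simp add: algebra_simps)
      qed
      then have e: "exp (t * a (k - 1) x) \<le> exp (q * \<omega>) * exp (t * a k x)" by (simp flip: exp_add)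
      have "measure (weight_measure t) (C (k - 1) x) \<le> 4 * exp (t * a (k - 1) x) * \<mu> (k - 1) x"
        by (rule weight_measure_bounds(2)[OF x t])
      also have "\<dots> \<le> 4 * (exp (q * \<omega>) * exp (t * a k x)) * (\<Gamma> * \<mu> k x)"
        using e cell_doubling[OF x, of k] by (intro mult_mono) auto
      also have "\<dots> = 4 * \<Gamma> * exp (q * \<omega>) * (exp (t * a k x) * \<mu> k x)" by (simp add: mult_ac)
      also have "\<dots> \<le> 4 * \<Gamma> * exp (q * \<omega>) * measure (weight_measure t) (C k x)"
        using \<Gamma>_ge_1 by (intro mult_left_mono weight_measure_bounds(1)[OF x t]) auto
      finally show ?thesis .
    qed
  qed
qed

lemma u: "1 < u" "u < s0" "1 < s0 / u"
  using s0 by (auto simp: u_def field_simps)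

text \<open>The constant of the maximal inequality and the normalization by 16, at the largest
  exponent \<open>q\<close> and the least ratio \<open>s0 / u\<close>, where
  \<open>x / (x - 1)\<close> is largest.\<close>

definition A1 :: real where
  "A1 = 16 powr q * (2 powr q * (4 * \<Gamma> * exp (q * \<omega>)) * ((s0 / u) / (s0 / u - 1)))"

lemma A1_nonneg: "0 \<le> A1" using u \<Gamma>_ge_1 by (simp add: A1_def)

text \<open>Division by \<open>exp (\<tau> * b)\<close>, with \<open>\<tau> = t / s\<close>, turns
  the \<open>s\<close>-norm of \<open>f\<close> into an \<open>s\<close>-norm for the measure of
  density \<open>exp (t * b)\<close>. There Hoelder's inequality dominates \<open>\<Phi>\<close> by
  \<open>u\<close>-th roots of averages of \<open>g\<close>, and the maximal inequality applies with
  exponent \<open>s / u\<close>.\<close>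

lemma weighted_maximal_inequality:
  fixes f \<Phi> :: "'a \<Rightarrow> real"
  assumes f [measurable]: "f \<in> borel_measurable M" and t: "1 \<le> t" "t \<le> q" and s: "s0 \<le> s" "s \<le> t"
    and fin: "(\<integral>\<^sup>+y. ennreal (\<bar>f y\<bar> powr s) \<partial>M) < \<infinity>"
    and H: "integrable M (\<lambda>y. exp (- b y) * \<bar>f y\<bar>)"
    and \<Phi> [measurable]: "\<Phi> \<in> borel_measurable M" "\<And>x. 0 \<le> \<Phi> x"
      "\<And>x. x \<in> space M \<Longrightarrow> 0 < \<Phi> x \<Longrightarrow> \<exists>k. \<Phi> x \<le>
        exp (t / s * (b x - a k x)) * (exp (a k x) * avg k (\<lambda>y. exp (- b y) * \<bar>f y\<bar>) x)"
  shows "(\<integral>\<^sup>+x. ennreal (\<Phi> x powr s) \<partial>M) \<le> ennreal A1 * (\<integral>\<^sup>+x. ennreal (\<bar>f x\<bar> powr s) \<partial>M)"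
proof -
  define \<tau> where "\<tau> = t / s"
  have s_pos: "1 < s" using s s0 by simp
  have us: "1 < s / u" "u < s" using u s by (auto simp: field_simps)
  have u0: "0 < u" using u by simp
  define N where "N = weight_measure t"
  have sets [measurable_cong, simp]: "sets N = sets M" and space [simp]: "space N = space M"
    by (simp_all add: N_def weight_measure_def)
  have nnN: "(\<integral>\<^sup>+x. F x \<partial>N) = (\<integral>\<^sup>+x. ennreal (exp (t * b x)) * F x \<partial>M)" if "F \<in> borel_measurable M" for F
    unfolding N_def weight_measure_def using that by (subst nn_integral_density) auto
  have t0: "0 \<le> t" using t by simp
  interpret N: cells N C "4 * \<Gamma> * exp (q * \<omega>)"
    unfolding N_def by (rule cells_weight[OF t0 t(2)])
  define g where "g = (\<lambda>y. (\<bar>f y\<bar> * exp (- (\<tau> * b y))) powr u)"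
  have g0: "0 \<le> g y" for y by (simp add: g_def)
  have g_meas: "g \<in> borel_measurable M" unfolding g_def by measurable
  have g_measN: "g \<in> borel_measurable N" unfolding g_def by measurable
  note [measurable] = g_meas
  have gs: "g y powr (s / u) = \<bar>f y\<bar> powr s * exp (- (t * b y))" for y
  proof -
    have "g y powr (s / u) = (\<bar>f y\<bar> * exp (- (\<tau> * b y))) powr s"
      using u0 by (simp add: g_def powr_powr)
    also have "\<dots> = \<bar>f y\<bar> powr s * exp (- (\<tau> * b y)) powr s" by (simp add: powr_mult)
    also have "exp (- (\<tau> * b y)) powr s = exp (- (t * b y))"
      using s_pos by (simp add: powr_def \<tau>_def)
    finally show ?thesis .
  qed
  have int_gs: "(\<integral>\<^sup>+y. ennreal (g y powr (s / u)) \<partial>N) = (\<integral>\<^sup>+y. ennreal (\<bar>f y\<bar> powr s) \<partial>M)"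
    by (subst nnN) (auto simp: gs exp_minus field_simps intro!: nn_integral_cong simp flip: ennreal_mult)
  have g_int: "integrable N g"
  proof (rule integrableI_nonneg[OF g_measN])
    have "(\<integral>\<^sup>+y. ennreal (g y) \<partial>N) \<le> (\<integral>\<^sup>+y. 1 + ennreal (g y powr (s / u)) \<partial>N)"
    proof (rule nn_integral_mono)
      fix y
      have "g y \<le> 1 + g y powr (s / u)"
      proof (cases "g y \<le> 1")
        case False
        then have "g y powr 1 \<le> g y powr (s / u)" using us by (intro powr_mono) auto
        then show ?thesis using False by simp
      qed (simp add: add_increasing2)
      then have "ennreal (g y) \<le> ennreal (1 + g y powr (s / u))" by (rule ennreal_leI)
      then show "ennreal (g y) \<le> 1 + ennreal (g y powr (s / u))" by (simp add: ennreal_plus)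
    qed
    also have "\<dots> = emeasure N (space N) + (\<integral>\<^sup>+y. ennreal (\<bar>f y\<bar> powr s) \<partial>M)"
      using int_gs by (subst nn_integral_add) auto
    also have "\<dots> < \<infinity>" using fin N.emeasure_finite[of "space M", unfolded infinity_ennreal_def less_top] by simp
    finally show "(\<integral>\<^sup>+y. ennreal (g y) \<partial>N) < \<infinity>" .
  qed (simp add: g0)
  define \<Psi> where "\<Psi> = (\<lambda>x. (\<Phi> x * exp (- (\<tau> * b x)) / 16) powr u)"
  have \<Psi>_bd: "\<exists>k. \<Psi> x \<le> N.avg k g x" if x: "x \<in> space M" and pos: "0 < \<Psi> x" for x
  proof -
    have "0 < \<Phi> x" using pos \<Phi>(2)[of x] by (cases "\<Phi> x = 0") (auto simp: \<Psi>_def)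
    then obtain k where k: "\<Phi> x \<le> exp (\<tau> * (b x - a k x)) * (exp (a k x) * avg k (\<lambda>y. exp (- b y) * \<bar>f y\<bar>) x)"
      using \<Phi>(3)[OF x] unfolding \<tau>_def by blast
    have [measurable]: "C k x \<in> sets M" using x by (rule cell_sets)
    have pos_\<mu>: "0 < \<mu> k x" using x by (rule cell_pos)
    define D where "D = N.avg k g x"
    have D0: "0 \<le> D" unfolding D_def N.avg_def set_lebesgue_integral_def
      by (intro divide_nonneg_nonneg integral_nonneg_AE) (auto simp: g0)
    \<comment> \<open>\<open>U powr u\<close> is \<open>g\<close> times the density of
      \<open>N\<close>, up to a constant. \<open>V\<close> collects the remaining exponentials of
      \<open>b - a k x\<close>, and John--Nirenberg bounds the average of its conjugate
      power.\<close>
    define U where "U = (\<lambda>y. \<bar>f y\<bar> * exp (- (\<tau> * b y)) * exp (t / u * (b y - a k x)))"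
    define V where "V = (\<lambda>y. exp ((1 - \<tau> + t / u) * (a k x - b y)))"
    have "(\<integral>\<^sup>+y\<in>C k x. ennreal (U y * V y) \<partial>M) \<le> ennreal (4 * (4 * D) powr (1 / u) * \<mu> k x)"
    proof (rule nn_integral_Holder_bound[where r = u and r' = "u / (u - 1)"])
      show "1 < u / (u - 1)" "1 / u + 1 / (u / (u - 1)) = 1" using u by (auto simp: field_simps)
      have Uu: "U y powr u = exp (t * b y) * g y * exp (- (t * a k x))" for y
      proof -
        have "U y powr u = g y * exp (t / u * (b y - a k x)) powr u" by (simp add: U_def g_def powr_mult)
        also have "exp (t / u * (b y - a k x)) powr u = exp (t * (b y - a k x))" using u0 by (simp add: powr_def)
        finally show ?thesis by (simp add: right_diff_distrib exp_diff exp_minus field_simps)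
      qed
      have "(\<integral>\<^sup>+y\<in>C k x. ennreal (U y powr u) \<partial>M)
          = (\<integral>\<^sup>+y. ennreal (exp (- (t * a k x))) * (ennreal (exp (t * b y)) * (ennreal (g y) * indicator (C k x) y)) \<partial>M)"
        by (intro nn_integral_cong) (auto simp: Uu indicator_def g0 mult_ac simp flip: ennreal_mult)
      also have "\<dots> = ennreal (exp (- (t * a k x))) * (\<integral>\<^sup>+y. ennreal (g y) * indicator (C k x) y \<partial>N)"
        by (subst nn_integral_cmult) (auto simp: nnN)
      also have "(\<integral>\<^sup>+y. ennreal (g y) * indicator (C k x) y \<partial>N) = (\<integral>\<^sup>+y. ennreal (indicator (C k x) y *\<^sub>R g y) \<partial>N)"
        by (intro nn_integral_cong) (auto simp: indicator_def)
      also have "\<dots> = ennreal (LINT y:C k x|N. g y)"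
        unfolding set_lebesgue_integral_def
        using N.set_integrable_cell[OF g_int, of x k] x
        by (intro nn_integral_eq_integral) (auto simp: g0 set_integrable_def)
      also have "(LINT y:C k x|N. g y) = D * measure N (C k x)"
        using N.cell_pos[of x k] x by (simp add: D_def N.avg_def)
      also have "ennreal (exp (- (t * a k x))) * ennreal (D * measure N (C k x)) = ennreal (exp (- (t * a k x)) * (D * measure N (C k x)))"
        using D0 by (simp flip: ennreal_mult)
      also have "\<dots> \<le> ennreal (exp (- (t * a k x)) * (D * (4 * exp (t * a k x) * \<mu> k x)))"
        using D0 weight_measure_bounds(2)[OF x t0 t(2), of k] unfolding N_def
        by (intro ennreal_leI mult_left_mono) auto
      also have "exp (- (t * a k x)) * (D * (4 * exp (t * a k x) * \<mu> k x)) = ((4 * D) powr (1 / u)) powr u * \<mu> k x"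
        using D0 u0 by (simp add: exp_minus powr_powr field_simps)
      finally show "(\<integral>\<^sup>+y\<in>C k x. ennreal (U y powr u) \<partial>M) \<le> ennreal (((4 * D) powr (1 / u)) powr u * \<mu> k x)" .
      \<comment> \<open>This is the origin of the bound in \<open>small_exp\<close>:
        \<open>u / (u - 1)\<close> equals \<open>(1 + s0) / (s0 - 1)\<close>, and the other factor
        is at most \<open>1 + q\<close>.\<close>
      define c where "c = u / (u - 1) * (1 - \<tau> + t / u)"
      have neg: "r * (e * (p - w)) = - (r * e) * (w - p)" for r e p w :: real by (simp add: algebra_simps)
      have "V y powr (u / (u - 1)) = exp (- c * (b y - a k x))" for y
        unfolding V_def c_def neg[symmetric] by (simp only: powr_def ln_exp exp_not_eq_zero if_False)
      moreover have "\<bar>- c\<bar> \<le> (1 + q) * (1 + s0) / (s0 - 1)"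
      proof -
        have "t / s \<le> t / u" using us t0 u0 by (intro divide_left_mono) auto
        moreover have "t / u \<le> t" using u t0 by (simp add: divide_le_eq mult_le_cancel_left1)
        moreover have "1 \<le> t / s" using s s_pos by simp
        ultimately have "0 \<le> 1 - \<tau> + t / u" "1 - \<tau> + t / u \<le> 1 + q" using t by (auto simp: \<tau>_def)
        moreover have "0 \<le> u / (u - 1)" using u by simp
        ultimately have "0 \<le> c" "c \<le> u / (u - 1) * (1 + q)"
          unfolding c_def by (blast intro: mult_nonneg_nonneg mult_left_mono)+
        moreover have "u / (u - 1) = (1 + s0) / (s0 - 1)" using s0 by (simp add: u_def field_simps)
        ultimately show ?thesis by (simp add: mult.commute)
      qed
      ultimately show "(\<integral>\<^sup>+y\<in>C k x. ennreal (V y powr (u / (u - 1))) \<partial>M) \<le> ennreal (4 * \<mu> k x)"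
        using exp_deviation_le[OF x, of "- c" k] by simp
    qed (use u pos_\<mu> in \<open>auto simp: U_def V_def\<close>)
    also have "(\<integral>\<^sup>+y\<in>C k x. ennreal (U y * V y) \<partial>M)
        = (\<integral>\<^sup>+y. ennreal (exp ((1 - \<tau>) * a k x)) * ennreal (indicator (C k x) y *\<^sub>R (exp (- b y) * \<bar>f y\<bar>)) \<partial>M)"
    proof (intro nn_integral_cong)
      fix y
      have "U y * V y = \<bar>f y\<bar> * (exp (- (\<tau> * b y)) * exp (t / u * (b y - a k x)) * exp ((1 - \<tau> + t / u) * (a k x - b y)))"
        by (simp add: U_def V_def)
      also have "exp (- (\<tau> * b y)) * exp (t / u * (b y - a k x)) * exp ((1 - \<tau> + t / u) * (a k x - b y)) = exp ((1 - \<tau>) * a k x) * exp (- b y)"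
        unfolding exp_add[symmetric] by (simp add: algebra_simps)
      finally have "U y * V y = exp ((1 - \<tau>) * a k x) * (exp (- b y) * \<bar>f y\<bar>)" by simp
      then show "ennreal (U y * V y) * indicator (C k x) y
          = ennreal (exp ((1 - \<tau>) * a k x)) * ennreal (indicator (C k x) y *\<^sub>R (exp (- b y) * \<bar>f y\<bar>))"
        by (auto simp: indicator_def simp flip: ennreal_mult)
    qed
    also have "\<dots> = ennreal (exp ((1 - \<tau>) * a k x)) * (\<integral>\<^sup>+y. ennreal (indicator (C k x) y *\<^sub>R (exp (- b y) * \<bar>f y\<bar>)) \<partial>M)"
      by (rule nn_integral_cmult) measurable
    also have "(\<integral>\<^sup>+y. ennreal (indicator (C k x) y *\<^sub>R (exp (- b y) * \<bar>f y\<bar>)) \<partial>M) = ennreal (LINT y:C k x|M. exp (- b y) * \<bar>f y\<bar>)"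
      unfolding set_lebesgue_integral_def
      using set_integrable_cell[OF H x, of k] by (intro nn_integral_eq_integral) (auto simp: set_integrable_def)
    also have "(LINT y:C k x|M. exp (- b y) * \<bar>f y\<bar>) = avg k (\<lambda>y. exp (- b y) * \<bar>f y\<bar>) x * \<mu> k x"
      using pos_\<mu> by (simp add: avg_def)
    finally have "exp ((1 - \<tau>) * a k x) * (avg k (\<lambda>y. exp (- b y) * \<bar>f y\<bar>) x * \<mu> k x) \<le> 4 * (4 * D) powr (1 / u) * \<mu> k x"
      using D0 by (simp flip: ennreal_mult')
    then have *: "exp ((1 - \<tau>) * a k x) * avg k (\<lambda>y. exp (- b y) * \<bar>f y\<bar>) x \<le> 4 * (4 * D) powr (1 / u)"
      using pos_\<mu> by (simp flip: mult.assoc)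
    have "\<Phi> x * exp (- (\<tau> * b x)) \<le> exp (\<tau> * (b x - a k x)) * (exp (a k x) * avg k (\<lambda>y. exp (- b y) * \<bar>f y\<bar>) x) * exp (- (\<tau> * b x))"
      by (rule mult_right_mono[OF k]) simp
    also have "\<dots> = (exp (\<tau> * (b x - a k x)) * exp (a k x) * exp (- (\<tau> * b x))) * avg k (\<lambda>y. exp (- b y) * \<bar>f y\<bar>) x"
      by (simp add: mult_ac)
    also have "exp (\<tau> * (b x - a k x)) * exp (a k x) * exp (- (\<tau> * b x)) = exp ((1 - \<tau>) * a k x)"
      unfolding exp_add[symmetric] by (simp add: algebra_simps)
    also note *
    \<comment> \<open>One 4 is the Hoelder constant, the other compares the weighted measure of a
      cell with \<open>exp (t * a k x)\<close> times its measure. Together they are the 16 in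
      \<open>\<Psi>\<close>.\<close>
    also have "4 * (4 * D) powr (1 / u) \<le> 16 * D powr (1 / u)"
    proof -
      have "4 powr (1 / u) \<le> 4 powr 1" using u by (intro powr_mono) auto
      then have "(4 * D) powr (1 / u) \<le> 4 * D powr (1 / u)" using D0 by (simp add: powr_mult mult_right_mono)
      then show ?thesis by simp
    qed
    finally have "\<Phi> x * exp (- (\<tau> * b x)) / 16 \<le> D powr (1 / u)" by simp
    then have "\<Psi> x \<le> (D powr (1 / u)) powr u"
      unfolding \<Psi>_def using \<Phi>(2)[of x] u0 by (intro powr_mono2) auto
    also have "\<dots> = D" using D0 u0 by (simp add: powr_powr)
    finally show ?thesis unfolding D_def by blast
  qed
  have "(\<integral>\<^sup>+x. ennreal (\<Psi> x powr (s / u)) \<partial>N)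
      \<le> ennreal (2 powr (s / u) * (4 * \<Gamma> * exp (q * \<omega>)) * (s / u) / (s / u - 1)) * (\<integral>\<^sup>+x. ennreal (g x powr (s / u)) \<partial>N)"
  proof (rule N.maximal_inequality)
    show "\<Psi> \<in> borel_measurable N" unfolding \<Psi>_def by measurable
    show "\<exists>k. \<Psi> x \<le> N.avg k g x" if "x \<in> space N" "0 < \<Psi> x" for x using \<Psi>_bd that by simp
  qed (use g_measN g_int g0 us nonempty in \<open>auto simp: \<Psi>_def\<close>)
  also have "\<dots> = ennreal (2 powr (s / u) * (4 * \<Gamma> * exp (q * \<omega>)) * (s / u) / (s / u - 1)) * (\<integral>\<^sup>+y. ennreal (\<bar>f y\<bar> powr s) \<partial>M)"
    by (simp only: int_gs)
  finally have main: "(\<integral>\<^sup>+x. ennreal (\<Psi> x powr (s / u)) \<partial>N)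
    \<le> ennreal (2 powr (s / u) * (4 * \<Gamma> * exp (q * \<omega>)) * (s / u) / (s / u - 1)) * (\<integral>\<^sup>+y. ennreal (\<bar>f y\<bar> powr s) \<partial>M)" .
  have \<Psi>s: "ennreal (\<Phi> x powr s) = ennreal (16 powr s) * (ennreal (exp (t * b x)) * ennreal (\<Psi> x powr (s / u)))" for x
  proof -
    have "\<Psi> x powr (s / u) = (\<Phi> x * exp (- (\<tau> * b x)) / 16) powr s"
      using u0 by (simp add: \<Psi>_def powr_powr)
    also have "\<dots> = \<Phi> x powr s * exp (- (\<tau> * b x)) powr s / 16 powr s"
      using \<Phi>(2)[of x] by (simp add: powr_mult powr_divide)
    also have "exp (- (\<tau> * b x)) powr s = exp (- (t * b x))"
      using s_pos by (simp add: powr_def \<tau>_def)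
    finally have "\<Phi> x powr s = 16 powr s * (exp (t * b x) * \<Psi> x powr (s / u))"
      by (simp add: exp_minus field_simps)
    then show ?thesis by (simp flip: ennreal_mult)
  qed
  have "(\<integral>\<^sup>+x. ennreal (\<Phi> x powr s) \<partial>M) = ennreal (16 powr s) * (\<integral>\<^sup>+x. ennreal (\<Psi> x powr (s / u)) \<partial>N)"
    unfolding \<Psi>s by (subst nn_integral_cmult) (auto simp: nnN \<Psi>_def)
  also have "\<dots> \<le> ennreal (16 powr s) * (ennreal (2 powr (s / u) * (4 * \<Gamma> * exp (q * \<omega>)) * (s / u) / (s / u - 1)) * (\<integral>\<^sup>+y. ennreal (\<bar>f y\<bar> powr s) \<partial>M))"
    by (intro mult_left_mono main) simp
  also have "\<dots> = ennreal (16 powr s * (2 powr (s / u) * (4 * \<Gamma> * exp (q * \<omega>)) * (s / u) / (s / u - 1))) * (\<integral>\<^sup>+y. ennreal (\<bar>f y\<bar> powr s) \<partial>M)"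
    by (subst ennreal_mult') (auto simp: mult.assoc)
  also have "\<dots> \<le> ennreal A1 * (\<integral>\<^sup>+y. ennreal (\<bar>f y\<bar> powr s) \<partial>M)"
  proof (intro mult_right_mono ennreal_leI)
    have "(s / u) / (s / u - 1) \<le> (s0 / u) / (s0 / u - 1)"
    proof -
      have "1 + 1 / (s / u - 1) \<le> 1 + 1 / (s0 / u - 1)"
        using u(3) s u0 by (intro add_left_mono divide_left_mono mult_pos_pos) (auto simp: divide_right_mono us)
      moreover have e: "x / (x - 1) = 1 + 1 / (x - 1)" if "1 < x" for x :: real using that by (simp add: field_simps)
      ultimately show ?thesis by (simp only: e[OF us(1)] e[OF u(3)])
    qed
    moreover have "s / u \<le> q" using u s t s_pos by (simp add: divide_le_eq mult_le_cancel_left1 order_trans[of s t q] order_trans[of s q "q * u"])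
    moreover have "s \<le> q" using s t by simp
    moreover have "0 \<le> s / u / (s / u - 1)" using us by (intro divide_nonneg_nonneg[of "s / u"]) linarith+
    moreover have "16 powr s * (2 powr (s / u) * (4 * \<Gamma> * exp (q * \<omega>)) * X)
        \<le> 16 powr q * (2 powr q * (4 * \<Gamma> * exp (q * \<omega>)) * Y)"
      if "X \<le> Y" "s / u \<le> q" "s \<le> q" "0 \<le> X" for X Y
      using that \<Gamma>_ge_1 by (intro mult_mono powr_mono) auto
    ultimately have "16 powr s * (2 powr (s / u) * (4 * \<Gamma> * exp (q * \<omega>)) * ((s / u) / (s / u - 1)))
        \<le> 16 powr q * (2 powr q * (4 * \<Gamma> * exp (q * \<omega>)) * ((s0 / u) / (s0 / u - 1)))"
      by blast
    then show "16 powr s * (2 powr (s / u) * (4 * \<Gamma> * exp (q * \<omega>)) * (s / u) / (s / u - 1)) \<le> A1"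
      by (simp add: A1_def)
  qed simp
  finally show ?thesis .
qed

end

section \<open>The Morrey estimate\<close>

context cell_space begin

text \<open>The sum over \<open>k\<close> of these terms dominates \<open>e\<^sup>c I\<^sup>\<alpha>(e\<^sup>-\<^sup>c |f|)\<close>.\<close>

definition level :: "real \<Rightarrow> ('a \<Rightarrow> real) \<Rightarrow> ('a \<Rightarrow> real) \<Rightarrow> nat \<Rightarrow> 'a \<Rightarrow> real" where
  "level \<alpha> c f k x =
     measure M (C k x) powr (\<alpha> - 1) * (exp (c x) * (LINT y:C k x|M. exp (- c y) * \<bar>f y\<bar>))"

lemma measurable_level [measurable]:
  assumes [measurable]: "c \<in> borel_measurable M"
  shows "level \<alpha> c f k \<in> borel_measurable M"
proof -
  have [measurable]: "(\<lambda>x. measure M (C k x) powr (\<alpha> - 1)) \<in> borel_measurable M"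
    by (rule measurable_cell_fun[of "\<lambda>S. measure M S powr (\<alpha> - 1)"])
  have [measurable]: "(\<lambda>x. LINT y:C k x|M. exp (- c y) * \<bar>f y\<bar>) \<in> borel_measurable M"
    by (rule measurable_cell_fun[of "\<lambda>S. LINT y:S|M. exp (- c y) * \<bar>f y\<bar>"])
  show ?thesis unfolding level_def[abs_def] by measurable
qed

lemma level_nonneg: "0 \<le> level \<alpha> c f k x"
  unfolding level_def set_lebesgue_integral_def by (intro mult_nonneg_nonneg integral_nonneg_AE) auto

end

context small_bmo begin

text \<open>The two summands come from the near and the far part of the maximal function.\<close>

definition A2 :: real where "A2 = A1 * \<Gamma> + (4 * \<Gamma>\<^sup>2 * exp (q * \<omega>)) powr q * 4 * \<Gamma>"
definition A3 :: real where "A3 = (8 / (1 - \<theta>)) powr q * A2"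

lemma A2_nonneg: "0 \<le> A2" using A1_nonneg \<Gamma>_ge_1 by (simp add: A2_def)
lemma A3_nonneg: "0 \<le> A3" using A2_nonneg by (simp add: A3_def)

lemma \<mu>_pos: "x \<in> space M \<Longrightarrow> 0 < \<mu> k x" by (rule cell_pos)

lemma powr_neg_step:
  assumes x: "x \<in> space M" and e: "e \<le> 0"
  shows "\<mu> k x powr e \<le> \<beta> powr (- e) * \<mu> (Suc k) x powr e"
proof -
  have "\<mu> k x powr e \<le> (\<mu> (Suc k) x / \<beta>) powr e"
    using decay[OF x, of k] \<beta> \<mu>_pos[OF x] e by (intro powr_mono2') (auto simp: divide_le_eq mult.commute)
  also have "\<dots> = \<beta> powr (- e) * \<mu> (Suc k) x powr e"
    using \<beta> by (simp add: powr_divide powr_minus_divide)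
  finally show ?thesis .
qed

end

text \<open>The exponents and \<open>f\<close> enter only here, above the locale in which
  \<open>A1\<close> and \<theta> are defined, so the constants are visibly independent of them.
  \<open>rel\<close> is the Adams relation.\<close>

locale morrey_data = small_bmo +
  fixes s t \<nu> N :: real and f :: "'a \<Rightarrow> real"
  assumes s: "s0 \<le> s" and t: "0 < t" "t \<le> q" and \<nu>: "0 \<le> \<nu>" "\<nu> \<le> l"
    and rel: "1 / s - 1 / t = \<alpha> / (1 - \<nu>)" and N: "0 \<le> N"
    and f [measurable]: "f \<in> borel_measurable M"
    and morrey: "\<And>k x. x \<in> space M \<Longrightarrow>
      (\<integral>\<^sup>+y\<in>C k x. ennreal (\<bar>f y\<bar> powr s) \<partial>M) \<le> ennreal (measure M (C k x) powr \<nu> * N powr s)"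
begin

definition \<tau> :: real where "\<tau> = t / s"
definition H :: "'a \<Rightarrow> real" where "H y = exp (- b y) * \<bar>f y\<bar>"
text \<open>The average \<open>a k x\<close> takes the place of \<open>b x\<close> in the
  exponential, so that \<open>F\<close> obeys a Morrey bound. The deviation
  \<open>b x - a k x\<close>, which is unbounded, is split off and enters \<open>G\<close> with the
  exponent \<open>\<tau>\<close> that the interpolation will need.\<close>

definition F :: "nat \<Rightarrow> 'a \<Rightarrow> real" where "F k x = exp (a k x) * avg k H x"
definition G :: "nat \<Rightarrow> 'a \<Rightarrow> real" where "G k x = exp (\<tau> * (b x - a k x)) * F k x"

lemma \<nu>_less: "\<nu> < 1" using \<nu> l by simp

lemma s_less_t: "1 < s" "s < t"
proof -
  show s1: "1 < s" using s s0 by simp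
  have "0 < \<alpha> / (1 - \<nu>)" using \<alpha> \<nu>_less by simp
  then have "1 / t < 1 / s" using rel by simp
  then show "s < t" using t s1 by (simp add: field_simps)
qed

lemma \<tau>: "1 < \<tau>" "\<tau> \<le> q"
proof -
  show "1 < \<tau>" using s_less_t by (simp add: \<tau>_def)
  have "\<tau> \<le> t" using s_less_t t by (simp add: \<tau>_def divide_le_eq mult_le_cancel_left1)
  then show "\<tau> \<le> q" using t by simp
qed

text \<open>Two forms of \<open>rel\<close>. The first gives the exponent of the measure in the
  terms bounded by the Morrey norm, the second makes the powers of the measure cancel at the weight
  \<open>s / t\<close>.\<close>

lemma exponent_rel: "\<alpha> - (1 - \<nu>) / s = - ((1 - \<nu>) / t)" "\<alpha> * s = (1 - \<nu>) * (1 - s / t)"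
proof -
  have "\<alpha> = (1 / s - 1 / t) * (1 - \<nu>)" using rel \<nu>_less by simp
  then have *: "\<alpha> = (1 - \<nu>) / s - (1 - \<nu>) / t" by (simp add: algebra_simps diff_divide_distrib)
  show "\<alpha> - (1 - \<nu>) / s = - ((1 - \<nu>) / t)" using * by simp
  show "\<alpha> * s = (1 - \<nu>) * (1 - s / t)" using * s_less_t t by (simp add: field_simps)
qed

lemma min_exponent_le:
  "min \<alpha> ((1 - l) / q) \<le> (1 - \<nu>) / s" "min \<alpha> ((1 - l) / q) \<le> (1 - \<nu>) / t"
proof -
  have "(1 - l) / q \<le> (1 - \<nu>) / t" "(1 - l) / q \<le> (1 - \<nu>) / s"
    using \<nu> l t s_less_t by (auto intro!: frac_le)
  then show "min \<alpha> ((1 - l) / q) \<le> (1 - \<nu>) / s" "min \<alpha> ((1 - l) / q) \<le> (1 - \<nu>) / t" by auto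
qed

text \<open>Hoelder's inequality with exponent \<open>s\<close>. The conjugate exponent is at most
  \<open>s0 / (s0 - 1)\<close>, so the exponential of the deviation is covered by
  \<open>small_exp\<close>.\<close>

lemma nn_integral_H_le:
  assumes x: "x \<in> space M"
  shows "(\<integral>\<^sup>+y\<in>C k x. ennreal (\<bar>f y\<bar> * exp (a k x - b y)) \<partial>M) \<le> ennreal (4 * (N * \<mu> k x powr ((\<nu> - 1) / s)) * \<mu> k x)"
proof (rule nn_integral_Holder_bound[where r = s and r' = "s / (s - 1)"])
  show "1 < s" "1 < s / (s - 1)" "1 / s + 1 / (s / (s - 1)) = 1"
    using s_less_t by (auto simp: field_simps)
  have "(N * \<mu> k x powr ((\<nu> - 1) / s)) powr s * \<mu> k x = N powr s * (\<mu> k x powr (\<nu> - 1) * \<mu> k x powr 1)"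
    using \<mu>_pos[OF x, of k] s_less_t N by (simp add: powr_mult powr_powr)
  also have "\<mu> k x powr (\<nu> - 1) * \<mu> k x powr 1 = \<mu> k x powr \<nu>" by (simp only: powr_add[symmetric]) simp
  finally show "(\<integral>\<^sup>+y\<in>C k x. ennreal (\<bar>f y\<bar> powr s) \<partial>M) \<le> ennreal ((N * \<mu> k x powr ((\<nu> - 1) / s)) powr s * \<mu> k x)"
    using morrey[OF x, of k] by (simp add: mult.commute)
  have neg: "r * (p - w) = - r * (w - p)" for r p w :: real by (simp add: algebra_simps)
  have "exp (a k x - b y) powr (s / (s - 1)) = exp (- (s / (s - 1)) * (b y - a k x))" for y
    unfolding neg[symmetric] by (simp only: powr_def ln_exp exp_not_eq_zero if_False)
  moreover have "\<bar>- (s / (s - 1))\<bar> \<le> (1 + q) * (1 + s0) / (s0 - 1)"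
  proof -
    have "s / (s - 1) \<le> s0 / (s0 - 1)" using s s0 by (simp add: field_simps)
    then show ?thesis using exponent_le_max(2) s_less_t by simp
  qed
  ultimately show "(\<integral>\<^sup>+y\<in>C k x. ennreal (exp (a k x - b y) powr (s / (s - 1))) \<partial>M) \<le> ennreal (4 * \<mu> k x)"
    using exp_deviation_le[OF x, of "- (s / (s - 1))" k] by simp
qed (use x N in auto)

lemma H_measurable [measurable]: "H \<in> borel_measurable M" unfolding H_def[abs_def] by measurable

lemma nn_integral_H_eq:
  assumes x: "x \<in> space M"
  shows "(\<integral>\<^sup>+y\<in>C k x. ennreal (\<bar>f y\<bar> * exp (a k x - b y)) \<partial>M)
    = ennreal (exp (a k x)) * (\<integral>\<^sup>+y. ennreal (indicator (C k x) y *\<^sub>R H y) \<partial>M)"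
proof -
  have [measurable]: "C k x \<in> sets M" using x by (rule cell_sets)
  have "(\<integral>\<^sup>+y\<in>C k x. ennreal (\<bar>f y\<bar> * exp (a k x - b y)) \<partial>M)
    = (\<integral>\<^sup>+y. ennreal (exp (a k x)) * ennreal (indicator (C k x) y *\<^sub>R H y) \<partial>M)"
    by (intro nn_integral_cong)
      (auto simp: indicator_def H_def exp_diff exp_minus field_simps simp flip: ennreal_mult)
  then show ?thesis by (simp add: nn_integral_cmult)
qed

lemma H_integrable: "integrable M H"
proof -
  obtain x where x: "x \<in> space M" using nonempty by blast
  have "ennreal (exp (a 0 x)) * (\<integral>\<^sup>+y. ennreal (indicator (C 0 x) y *\<^sub>R H y) \<partial>M) < \<infinity>"
    using nn_integral_H_le[OF x, of 0] unfolding nn_integral_H_eq[OF x] by (auto intro: le_less_trans)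
  then have "(\<integral>\<^sup>+y. ennreal (indicator (C 0 x) y *\<^sub>R H y) \<partial>M) < \<infinity>"
    by (auto simp: ennreal_mult_less_top)
  also have "(\<integral>\<^sup>+y. ennreal (indicator (C 0 x) y *\<^sub>R H y) \<partial>M) = (\<integral>\<^sup>+y. ennreal (H y) \<partial>M)"
    using cell_0[OF x] by (intro nn_integral_cong) auto
  finally show ?thesis by (intro integrableI_nonneg) (auto simp: H_def)
qed

lemma F_nonneg: "0 \<le> F k x"
  unfolding F_def avg_def set_lebesgue_integral_def
  by (intro mult_nonneg_nonneg divide_nonneg_nonneg integral_nonneg_AE) (auto simp: H_def)

lemma F_le:
  assumes x: "x \<in> space M"
  shows "F k x \<le> 4 * N * \<mu> k x powr ((\<nu> - 1) / s)"
proof -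
  have "(\<integral>\<^sup>+y. ennreal (indicator (C k x) y *\<^sub>R H y) \<partial>M) = ennreal (LINT y:C k x|M. H y)"
    unfolding set_lebesgue_integral_def
    using set_integrable_cell[OF H_integrable x, of k]
    by (intro nn_integral_eq_integral) (auto simp: set_integrable_def H_def)
  then have "ennreal (exp (a k x) * (LINT y:C k x|M. H y)) \<le> ennreal (4 * (N * \<mu> k x powr ((\<nu> - 1) / s)) * \<mu> k x)"
    using nn_integral_H_le[OF x, of k] unfolding nn_integral_H_eq[OF x] by (simp add: ennreal_mult')
  then have "exp (a k x) * (LINT y:C k x|M. H y) \<le> 4 * (N * \<mu> k x powr ((\<nu> - 1) / s)) * \<mu> k x"
    using N by simp
  then show ?thesis using \<mu>_pos[OF x, of k] by (simp add: F_def avg_def divide_le_eq mult_ac)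
qed

lemma G_measurable [measurable]: "G k \<in> borel_measurable M"
  unfolding G_def[abs_def] F_def by measurable

lemma G_nonneg: "0 \<le> G k x" by (simp add: G_def F_nonneg)

text \<open>A finite maximum is measurable by construction and attained, so each positive value
  comes from a definite generation that can be compared with \<open>m\<close>.\<close>

primrec Q :: "nat \<Rightarrow> 'a \<Rightarrow> real" where
  "Q 0 = (\<lambda>x. 0)"
| "Q (Suc n) = (\<lambda>x. max (Q n x) (G n x))"

lemma Q_measurable [measurable]: "Q n \<in> borel_measurable M"
  by (induction n) auto

lemma Q_nonneg: "0 \<le> Q n x"
  by (induction n) (auto simp: le_max_iff_disj)

lemma G_le_Q: "k < n \<Longrightarrow> G k x \<le> Q n x"
  by (induction n) (auto simp: less_Suc_eq le_max_iff_disj)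

lemma Q_attained: "0 < Q n x \<Longrightarrow> \<exists>k<n. Q n x = G k x"
proof (induction n)
  case (Suc n)
  show ?case
  proof (cases "G n x < Q n x")
    case True
    then have "0 < Q n x" using G_nonneg[of n x] by simp
    then show ?thesis using Suc.IH True by (auto simp: max_def less_Suc_eq)
  qed (auto simp: max_def intro!: exI[of _ n])
qed simp

text \<open>In the Morrey estimate of \<open>Q\<close> on \<open>C m z\<close>, the cells of generations below \<open>m\<close> are handled by the Morrey
  norm and the others by the maximal inequality for the restriction of \<open>f\<close> to \<open>C (m - 1) z\<close>.\<close>

definition far :: "nat \<Rightarrow> 'a \<Rightarrow> 'a \<Rightarrow> real" where
  "far m z x = 4 * N * \<Gamma>\<^sup>2 * exp (q * \<omega>) * \<mu> (m - 1) z powr ((\<nu> - 1) / s) * exp (\<tau> * (b x - a (m - 1) z))"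

lemma far_measurable [measurable]: "far m z \<in> borel_measurable M"
  unfolding far_def[abs_def] by measurable

text \<open>The quantity \<open>D k\<close>, made of the Morrey bound on \<open>F\<close> and the
  exponential of the average, does not decrease with \<open>k\<close>, because the decay of the
  measures beats the variation of the averages. So generation \<open>m\<close> is the worst, and its
  cell is compared with the parent of \<open>C m z\<close>.\<close>

lemma G_le_far:
  assumes z: "z \<in> space M" and x: "x \<in> C m z" and km: "k \<le> m"
  shows "G k x \<le> far m z x"
proof -
  note n = neighbour_cell[OF z x]
  define e where "e = (\<nu> - 1) / s"
  have e0: "e \<le> 0" "- e \<le> 1" and e_min: "min \<alpha> ((1 - l) / q) \<le> - e"
  proof -
    show "e \<le> 0" using \<nu>_less s_less_t by (simp add: e_def divide_nonpos_pos)
    have "- e = (1 - \<nu>) / s" by (simp add: e_def minus_divide_left)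
    moreover have "(1 - \<nu>) / s \<le> 1" using \<nu> s_less_t by (simp add: divide_le_eq)
    ultimately show "- e \<le> 1" "min \<alpha> ((1 - l) / q) \<le> - e" using min_exponent_le(1) by simp_all
  qed
  define D where "D = (\<lambda>k. \<mu> k x powr e * exp (- (\<tau> * a k x)))"
  have \<tau>\<omega>: "\<tau> * \<omega> \<le> q * \<omega>" using \<tau> \<omega>_nonneg by (intro mult_right_mono) auto
  have step: "D k \<le> D (Suc k)" for k
  proof -
    have "\<tau> * (a (Suc k) x - a k x) \<le> \<tau> * \<omega>"
      using avg_step[OF n(1), of k] \<tau> by (intro mult_left_mono) auto
    then have "exp (- (\<tau> * a k x)) \<le> exp (\<tau> * \<omega>) * exp (- (\<tau> * a (Suc k) x))"
      by (simp add: algebra_simps flip: exp_add)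
    then have "D k \<le> (\<beta> powr (- e) * \<mu> (Suc k) x powr e) * (exp (\<tau> * \<omega>) * exp (- (\<tau> * a (Suc k) x)))"
      unfolding D_def using powr_neg_step[OF n(1) e0(1), of k] by (intro mult_mono) auto
    also have "\<dots> = (\<beta> powr (- e) * exp (\<tau> * \<omega>)) * D (Suc k)" by (simp add: D_def mult_ac)
    also have "\<dots> \<le> 1 * D (Suc k)"
      using decay_dominates[OF e_min \<tau>\<omega>] \<theta> by (intro mult_right_mono) (auto simp: D_def)
    finally show ?thesis by simp
  qed
  have "D k \<le> D m" by (rule lift_Suc_mono_le[of D, OF step km])
  also have "D m \<le> (\<Gamma>\<^sup>2 * \<mu> (m - 1) z powr e) * (exp (q * \<omega>) * exp (- (\<tau> * a (m - 1) z)))"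
    unfolding D_def
  proof (rule mult_mono)
    have G2: "1 \<le> \<Gamma>\<^sup>2" "0 < \<Gamma>\<^sup>2" using \<Gamma>_ge_1 by simp_all
    have "\<mu> m x powr e \<le> (\<mu> (m - 1) z / \<Gamma>\<^sup>2) powr e"
      using n(3) G2 \<mu>_pos[OF z, of "m - 1"] e0 by (intro powr_mono2') (auto simp: divide_le_eq mult.commute intro: divide_pos_pos)
    also have "\<dots> = (\<Gamma>\<^sup>2) powr (- e) * \<mu> (m - 1) z powr e"
      by (simp add: powr_divide powr_minus_divide)
    also have "\<dots> \<le> \<Gamma>\<^sup>2 powr 1 * \<mu> (m - 1) z powr e"
      using e0 G2 by (intro mult_right_mono powr_mono) auto
    finally show "\<mu> m x powr e \<le> \<Gamma>\<^sup>2 * \<mu> (m - 1) z powr e" using G2 by simp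
    have "\<bar>a m x - a (m - 1) z\<bar> \<le> \<omega>" unfolding \<omega>_def using z n by (intro avg_diff_le) auto
    then have "\<tau> * (a (m - 1) z - a m x) \<le> \<tau> * \<omega>" using \<tau> by (intro mult_left_mono) auto
    then show "exp (- (\<tau> * a m x)) \<le> exp (q * \<omega>) * exp (- (\<tau> * a (m - 1) z))"
      using \<tau>\<omega> by (simp add: algebra_simps flip: exp_add)
  qed auto
  finally have D: "D k \<le> (\<Gamma>\<^sup>2 * \<mu> (m - 1) z powr e) * (exp (q * \<omega>) * exp (- (\<tau> * a (m - 1) z)))" .
  have "G k x \<le> exp (\<tau> * (b x - a k x)) * (4 * N * \<mu> k x powr e)"
    unfolding G_def e_def using F_le[OF n(1), of k] by (intro mult_left_mono) auto
  also have "\<dots> = 4 * N * exp (\<tau> * b x) * D k"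
    by (simp add: D_def right_diff_distrib exp_diff exp_minus field_simps)
  also have "\<dots> \<le> 4 * N * exp (\<tau> * b x) * ((\<Gamma>\<^sup>2 * \<mu> (m - 1) z powr e) * (exp (q * \<omega>) * exp (- (\<tau> * a (m - 1) z))))"
    using N D by (intro mult_left_mono) auto
  also have "\<dots> = far m z x"
    by (simp add: far_def e_def right_diff_distrib exp_diff exp_minus field_simps)
  finally show ?thesis .
qed

lemma parent_powr_le:
  assumes z: "z \<in> space M"
  shows "\<mu> (m - 1) z powr \<nu> \<le> \<Gamma> * \<mu> m z powr \<nu>"
proof -
  have "\<mu> (m - 1) z powr \<nu> \<le> (\<Gamma> * \<mu> m z) powr \<nu>"
    using cell_doubling[OF z, of m] \<nu> by (intro powr_mono2) auto
  also have "\<dots> = \<Gamma> powr \<nu> * \<mu> m z powr \<nu>" using \<Gamma>_ge_1 by (simp add: powr_mult)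
  also have "\<dots> \<le> \<Gamma> powr 1 * \<mu> m z powr \<nu>" using \<Gamma>_ge_1 \<nu>_less by (intro mult_right_mono powr_mono) auto
  finally show ?thesis using \<Gamma>_ge_1 by simp
qed

text \<open>Since \<open>\<tau> * s = t\<close>, the \<open>s\<close>-th power of \<open>far\<close>
  is an exponential with exponent \<open>t \<le> q\<close>, to which John--Nirenberg on the parent
  applies.\<close>

lemma nn_integral_far_le:
  assumes z: "z \<in> space M"
  shows "(\<integral>\<^sup>+x\<in>C m z. ennreal (far m z x powr s) \<partial>M)
    \<le> ennreal ((4 * \<Gamma>\<^sup>2 * exp (q * \<omega>)) powr q * 4 * \<Gamma> * (\<mu> m z powr \<nu> * N powr s))"
proof -
  have [measurable]: "C m z \<in> sets M" "C (m - 1) z \<in> sets M" using z by (auto intro: cell_sets)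
  define c where "c = 4 * \<Gamma>\<^sup>2 * exp (q * \<omega>)"
  have c1: "1 \<le> c"
  proof -
    have "1 \<le> \<Gamma>\<^sup>2" using \<Gamma>_ge_1 by simp
    then have "1 \<le> 4 * \<Gamma>\<^sup>2" by linarith
    then show ?thesis
      using q_pos \<omega>_nonneg mult_mono[of 1 "4 * \<Gamma>\<^sup>2" 1 "exp (q * \<omega>)"] by (simp add: c_def)
  qed
  let ?a = "a (m - 1) z" and ?\<mu> = "\<mu> (m - 1) z"
  have sub: "C m z \<subseteq> C (m - 1) z" using neighbour_cell(2)[OF z cell_self[OF z]] .
  have pw: "far m z x powr s = c powr s * N powr s * ?\<mu> powr (\<nu> - 1) * exp (t * (b x - ?a))" for x
  proof -
    have "far m z x = c * N * ?\<mu> powr ((\<nu> - 1) / s) * exp (\<tau> * (b x - ?a))" by (simp add: far_def c_def)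
    also have "\<dots> powr s = c powr s * N powr s * (?\<mu> powr ((\<nu> - 1) / s)) powr s * exp (\<tau> * (b x - ?a)) powr s"
      using c1 N by (simp add: powr_mult)
    also have "(?\<mu> powr ((\<nu> - 1) / s)) powr s = ?\<mu> powr (\<nu> - 1)" using s_less_t by (simp add: powr_powr)
    also have "exp (\<tau> * (b x - ?a)) powr s = exp (t * (b x - ?a))" using s_less_t by (simp add: powr_def \<tau>_def)
    finally show ?thesis .
  qed
  have "(\<integral>\<^sup>+x\<in>C m z. ennreal (far m z x powr s) \<partial>M)
    \<le> (\<integral>\<^sup>+x. ennreal (c powr s * N powr s * ?\<mu> powr (\<nu> - 1)) * (ennreal (exp (t * (b x - ?a))) * indicator (C (m - 1) z) x) \<partial>M)"
    using sub unfolding pw by (intro nn_integral_mono) (auto simp: indicator_def simp flip: ennreal_mult)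
  also have "\<dots> = ennreal (c powr s * N powr s * ?\<mu> powr (\<nu> - 1)) * (\<integral>\<^sup>+x\<in>C (m - 1) z. ennreal (exp (t * (b x - ?a))) \<partial>M)"
    by (rule nn_integral_cmult) measurable
  also have "\<dots> \<le> ennreal (c powr s * N powr s * ?\<mu> powr (\<nu> - 1)) * ennreal (4 * ?\<mu>)"
    using t exponent_le_max(1) by (intro mult_left_mono exp_deviation_le z) auto
  also have "\<dots> = ennreal (c powr s * N powr s * 4 * (?\<mu> powr (\<nu> - 1) * ?\<mu> powr 1))"
    by (simp add: mult_ac flip: ennreal_mult)
  also have "?\<mu> powr (\<nu> - 1) * ?\<mu> powr 1 = ?\<mu> powr \<nu>" by (simp only: powr_add[symmetric]) simp
  also have "ennreal (c powr s * N powr s * 4 * ?\<mu> powr \<nu>) \<le> ennreal (c powr q * N powr s * 4 * (\<Gamma> * \<mu> m z powr \<nu>))"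
    using c1 s_less_t t parent_powr_le[OF z, of m]
    by (intro ennreal_leI mult_mono powr_mono order_refl[of "N powr s"]) auto
  finally show ?thesis by (simp add: c_def mult_ac)
qed

lemma nn_integral_Q_le:
  assumes z: "z \<in> space M"
  shows "(\<integral>\<^sup>+x\<in>C m z. ennreal (Q n x powr s) \<partial>M) \<le> ennreal (A2 * (\<mu> m z powr \<nu> * N powr s))"
proof -
  have [measurable]: "C m z \<in> sets M" "C (m - 1) z \<in> sets M" using z by (auto intro: cell_sets)
  define f1 where "f1 = (\<lambda>y. f y * indicator (C (m - 1) z) y)"
  have [measurable]: "f1 \<in> borel_measurable M" unfolding f1_def by measurable
  \<comment> \<open>Where \<open>Q n\<close> exceeds \<open>far\<close>, the maximum is attained at
    a generation beyond \<open>m\<close>. That cell lies in the parent of \<open>C m z\<close>, so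
    \<open>f\<close> may be replaced by its restriction \<open>f1\<close>.\<close>
  define \<Phi> where "\<Phi> = (\<lambda>x. Q n x * indicator {x\<in>C m z. far m z x < Q n x} x)"
  have [measurable]: "{x\<in>C m z. far m z x < Q n x} \<in> sets M" by measurable
  have f1s: "(\<integral>\<^sup>+y. ennreal (\<bar>f1 y\<bar> powr s) \<partial>M) = (\<integral>\<^sup>+y\<in>C (m - 1) z. ennreal (\<bar>f y\<bar> powr s) \<partial>M)"
    by (intro nn_integral_cong) (auto simp: f1_def indicator_def)
  have "(\<integral>\<^sup>+x. ennreal (\<Phi> x powr s) \<partial>M) \<le> ennreal A1 * (\<integral>\<^sup>+y. ennreal (\<bar>f1 y\<bar> powr s) \<partial>M)"
  proof (rule weighted_maximal_inequality[where t = t])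
    show "(\<integral>\<^sup>+y. ennreal (\<bar>f1 y\<bar> powr s) \<partial>M) < \<infinity>"
      unfolding f1s using morrey[OF z, of "m - 1"] by (auto intro: le_less_trans)
    have H1: "exp (- b y) * \<bar>f1 y\<bar> = indicator (C (m - 1) z) y *\<^sub>R H y" for y
      by (auto simp: f1_def H_def indicator_def)
    show "integrable M (\<lambda>y. exp (- b y) * \<bar>f1 y\<bar>)"
      unfolding H1 by (intro integrable_mult_indicator H_integrable) measurable
    show "\<Phi> \<in> borel_measurable M" unfolding \<Phi>_def by measurable
    show "0 \<le> \<Phi> x" for x by (simp add: \<Phi>_def Q_nonneg)
    show "\<exists>k. \<Phi> x \<le> exp (t / s * (b x - a k x)) * (exp (a k x) * avg k (\<lambda>y. exp (- b y) * \<bar>f1 y\<bar>) x)"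
      if "x \<in> space M" "0 < \<Phi> x" for x
    proof -
      have x: "x \<in> C m z" "far m z x < Q n x" "\<Phi> x = Q n x" "0 < Q n x"
      proof -
        show S: "x \<in> C m z" "far m z x < Q n x"
          using that(2) by (cases "x \<in> C m z \<and> far m z x < Q n x"; simp add: \<Phi>_def)+
        then show "\<Phi> x = Q n x" by (simp add: \<Phi>_def)
        then show "0 < Q n x" using that(2) by simp
      qed
      obtain k where k: "Q n x = G k x" using Q_attained[OF x(4)] by blast
      then have "m \<le> k" using G_le_far[OF z x(1), of k] x(2) by (cases "k \<le> m") auto
      then have sub: "C k x \<subseteq> C (m - 1) z"
        using engulf[OF z that(1), of m k] cell_self[OF that(1), of k] x(1) by blast
      have "(LINT y:C k x|M. exp (- b y) * \<bar>f1 y\<bar>) = (LINT y:C k x|M. H y)"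
        unfolding H1 set_lebesgue_integral_def
        by (intro Bochner_Integration.integral_cong) (use sub in \<open>auto simp: indicator_def\<close>)
      then have "\<Phi> x = exp (t / s * (b x - a k x)) * (exp (a k x) * avg k (\<lambda>y. exp (- b y) * \<bar>f1 y\<bar>) x)"
        unfolding x(3) k G_def F_def avg_def \<tau>_def by simp
      then show ?thesis by (metis order_refl)
    qed
  qed (use s s_less_t t in auto)
  also have "\<dots> \<le> ennreal A1 * ennreal (\<mu> (m - 1) z powr \<nu> * N powr s)"
    unfolding f1s using morrey[OF z, of "m - 1"] by (intro mult_left_mono) auto
  also have "\<dots> = ennreal (A1 * (\<mu> (m - 1) z powr \<nu> * N powr s))"
    using A1_nonneg by (simp flip: ennreal_mult)
  also have "\<dots> \<le> ennreal (A1 * (\<Gamma> * \<mu> m z powr \<nu> * N powr s))"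
    using A1_nonneg parent_powr_le[OF z, of m] by (intro ennreal_leI mult_left_mono mult_right_mono) auto
  finally have near: "(\<integral>\<^sup>+x. ennreal (\<Phi> x powr s) \<partial>M) \<le> ennreal (A1 * (\<Gamma> * \<mu> m z powr \<nu> * N powr s))" .
  have "(\<integral>\<^sup>+x\<in>C m z. ennreal (Q n x powr s) \<partial>M)
      \<le> (\<integral>\<^sup>+x. ennreal (\<Phi> x powr s) + ennreal (far m z x powr s) * indicator (C m z) x \<partial>M)"
  proof (rule nn_integral_mono)
    fix x
    show "ennreal (Q n x powr s) * indicator (C m z) x
        \<le> ennreal (\<Phi> x powr s) + ennreal (far m z x powr s) * indicator (C m z) x"
    proof (cases "x \<in> C m z \<and> \<not> far m z x < Q n x")
      case True
      then have "Q n x powr s \<le> far m z x powr s"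
        using Q_nonneg[of n x] s_less_t by (intro powr_mono2) auto
      then show ?thesis using True by (auto simp: add_increasing ennreal_leI)
    next
      case False
      then show ?thesis by (auto simp: \<Phi>_def indicator_def)
    qed
  qed
  also have "\<dots> = (\<integral>\<^sup>+x. ennreal (\<Phi> x powr s) \<partial>M) + (\<integral>\<^sup>+x\<in>C m z. ennreal (far m z x powr s) \<partial>M)"
    by (rule nn_integral_add) (auto simp: \<Phi>_def)
  also have "\<dots> \<le> ennreal (A1 * (\<Gamma> * \<mu> m z powr \<nu> * N powr s))
      + ennreal ((4 * \<Gamma>\<^sup>2 * exp (q * \<omega>)) powr q * 4 * \<Gamma> * (\<mu> m z powr \<nu> * N powr s))"
    by (intro add_mono near nn_integral_far_le z)
  also have "\<dots> = ennreal (A2 * (\<mu> m z powr \<nu> * N powr s))"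
    using A1_nonneg \<Gamma>_ge_1 by (subst ennreal_plus[symmetric]) (auto simp: A2_def algebra_simps)
  finally show ?thesis .
qed

abbreviation T :: "nat \<Rightarrow> 'a \<Rightarrow> real" where "T k x \<equiv> level \<alpha> b f k x"

section \<open>Hedberg summation over the generations\<close>

lemma level_eq:
  assumes x: "x \<in> space M"
  shows "T k x = \<mu> k x powr \<alpha> * exp (b x - a k x) * F k x"
proof -
  have "\<mu> k x powr (\<alpha> - 1) = \<mu> k x powr \<alpha> / \<mu> k x"
    using \<mu>_pos[OF x, of k] by (simp add: powr_diff)
  then show ?thesis
    by (simp add: level_def F_def avg_def H_def[abs_def] exp_diff field_simps)
qed

lemma sum_level_le:
  assumes x: "x \<in> space M"
  shows "(\<Sum>k<n. T k x) \<le> 2 * (Q n x powr (s / t) * (4 * N) powr (1 - s / t)) / (1 - \<theta>)"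
proof -
  define w where "w = s / t"
  have w: "0 < w" "w < 1" using s_less_t by (auto simp: w_def)
  define A where "A = (\<lambda>k. \<mu> k x powr \<alpha> * exp ((1 - \<tau>) * (b x - a k x)) * Q n x)"
  define B where "B = (\<lambda>k. 4 * N * \<mu> k x powr (- ((1 - \<nu>) / t)) * exp (b x - a k x))"
  have A0: "0 \<le> A k" for k using Q_nonneg by (simp add: A_def)
  have B0: "0 \<le> B k" for k using N by (simp add: B_def)
  \<comment> \<open>\<open>Q n\<close> dominates \<open>G k\<close> only for \<open>k < n\<close>,
    so the later terms are replaced by 0 to fit the summation lemma.\<close>
  have "(\<Sum>k<n. T k x) = (\<Sum>k<n. if k < n then T k x else 0)" by (rule sum.cong) auto
  also have "\<dots> \<le> 2 * (Q n x powr w * (4 * N) powr (1 - w)) / (1 - \<theta>)"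
  proof (rule sum_two_sided_geometric[where a = A and c = B])
    show "0 \<le> \<theta>" "\<theta> < 1" using \<theta> by auto
    show "A (Suc k) \<le> \<theta> * A k" for k
    proof -
      have "(\<tau> - 1) * (a (Suc k) x - a k x) \<le> (\<tau> - 1) * \<omega>"
        using avg_step[OF x, of k] \<tau> by (intro mult_left_mono) auto
      then have "(1 - \<tau>) * (b x - a (Suc k) x) \<le> (\<tau> - 1) * \<omega> + (1 - \<tau>) * (b x - a k x)"
        by (simp add: algebra_simps)
      then have "exp ((1 - \<tau>) * (b x - a (Suc k) x)) \<le> exp ((\<tau> - 1) * \<omega>) * exp ((1 - \<tau>) * (b x - a k x))"
        by (simp flip: exp_add)
      moreover have "\<mu> (Suc k) x powr \<alpha> \<le> \<beta> powr \<alpha> * \<mu> k x powr \<alpha>"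
        using powr_mono2[OF _ _ decay[OF x, of k], of \<alpha>] \<alpha> \<beta> by (simp add: powr_mult)
      ultimately have "A (Suc k) \<le> (\<beta> powr \<alpha> * \<mu> k x powr \<alpha>) * (exp ((\<tau> - 1) * \<omega>) * exp ((1 - \<tau>) * (b x - a k x))) * Q n x"
        unfolding A_def by (intro mult_right_mono mult_mono Q_nonneg) auto
      also have "\<dots> = (\<beta> powr \<alpha> * exp ((\<tau> - 1) * \<omega>)) * A k" by (simp add: A_def mult_ac)
      also have "\<dots> \<le> \<theta> * A k"
        using \<tau> \<omega>_nonneg by (intro mult_right_mono decay_dominates A0) (auto intro!: mult_right_mono)
      finally show ?thesis .
    qed
    show "B k \<le> \<theta> * B (Suc k)" for k
    proof -
      have e: "exp (b x - a k x) \<le> exp \<omega> * exp (b x - a (Suc k) x)"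
        using avg_step[OF x, of k] by (simp add: abs_le_iff flip: exp_add)
      have "- ((1 - \<nu>) / t) \<le> 0" using \<nu>_less t by simp
      from powr_neg_step[OF x this, of k] e
      have "B k \<le> 4 * N * (\<beta> powr ((1 - \<nu>) / t) * \<mu> (Suc k) x powr (- ((1 - \<nu>) / t))) * (exp \<omega> * exp (b x - a (Suc k) x))"
        unfolding B_def using N by (intro mult_mono mult_left_mono) auto
      also have "\<dots> = (\<beta> powr ((1 - \<nu>) / t) * exp \<omega>) * B (Suc k)" by (simp add: B_def mult_ac)
      also have "\<dots> \<le> \<theta> * B (Suc k)"
        using q_pos \<omega>_nonneg mult_right_mono[of 1 q \<omega>]
        by (intro mult_right_mono decay_dominates B0 min_exponent_le) auto
      finally show ?thesis .
    qed
    show "(if k < n then T k x else 0) \<le> A k" for k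
    proof (cases "k < n")
      case True
      have "T k x = \<mu> k x powr \<alpha> * exp ((1 - \<tau>) * (b x - a k x)) * G k x"
        unfolding level_eq[OF x] G_def by (simp add: algebra_simps flip: exp_add)
      also have "\<dots> \<le> A k" unfolding A_def using G_le_Q[OF True] by (intro mult_left_mono) auto
      finally show ?thesis using True by simp
    qed (simp add: A0)
    show "(if k < n then T k x else 0) \<le> B k" for k
    proof -
      have "\<alpha> + (\<nu> - 1) / s = - ((1 - \<nu>) / t)" using exponent_rel(1) by (simp add: diff_divide_distrib)
      then have "\<mu> k x powr \<alpha> * \<mu> k x powr ((\<nu> - 1) / s) = \<mu> k x powr (- ((1 - \<nu>) / t))"
        by (simp only: powr_add[symmetric])
      moreover have "T k x \<le> \<mu> k x powr \<alpha> * exp (b x - a k x) * (4 * N * \<mu> k x powr ((\<nu> - 1) / s))"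
        unfolding level_eq[OF x] using F_le[OF x, of k] by (intro mult_left_mono) auto
      moreover have "\<mu> k x powr \<alpha> * exp (b x - a k x) * (4 * N * \<mu> k x powr ((\<nu> - 1) / s))
          = 4 * N * (\<mu> k x powr \<alpha> * \<mu> k x powr ((\<nu> - 1) / s)) * exp (b x - a k x)" by (simp only: mult_ac)
      ultimately have "T k x \<le> B k" by (simp add: B_def)
      then show ?thesis using B0 by simp
    qed
    \<comment> \<open>The minimum is at most the geometric mean with weights \<open>w\<close> and
      \<open>1 - w\<close>. There the measure disappears by \<open>exponent_rel\<close>, and the
      deviation of \<open>b\<close> because \<open>w * \<tau> = 1\<close>.\<close>
    show "min (A k) (B k) \<le> Q n x powr w * (4 * N) powr (1 - w)" for k
    proof -
      have "min (A k) (B k) = min (A k) (B k) powr w * min (A k) (B k) powr (1 - w)"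
        using A0[of k] B0[of k] by (simp flip: powr_add add: min_def)
      also have "\<dots> \<le> A k powr w * B k powr (1 - w)"
        using w A0[of k] B0[of k] by (intro mult_mono powr_mono2) auto
      also have "A k powr w = \<mu> k x powr (\<alpha> * w) * exp (w * ((1 - \<tau>) * (b x - a k x))) * Q n x powr w"
        using Q_nonneg[of n x] by (simp add: A_def powr_mult powr_powr exp_powr_real mult_ac)
      also have "B k powr (1 - w) = (4 * N) powr (1 - w) * \<mu> k x powr (- ((1 - \<nu>) / t) * (1 - w)) * exp ((1 - w) * (b x - a k x))"
        using N by (simp add: B_def powr_mult powr_powr exp_powr_real mult_ac)
      also have "\<mu> k x powr (\<alpha> * w) * exp (w * ((1 - \<tau>) * (b x - a k x))) * Q n x powr w
          * ((4 * N) powr (1 - w) * \<mu> k x powr (- ((1 - \<nu>) / t) * (1 - w)) * exp ((1 - w) * (b x - a k x)))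
        = (\<mu> k x powr (\<alpha> * w) * \<mu> k x powr (- ((1 - \<nu>) / t) * (1 - w)))
          * (exp (w * ((1 - \<tau>) * (b x - a k x))) * exp ((1 - w) * (b x - a k x)))
          * (Q n x powr w * (4 * N) powr (1 - w))"
        by (simp only: mult_ac)
      also have "\<mu> k x powr (\<alpha> * w) * \<mu> k x powr (- ((1 - \<nu>) / t) * (1 - w)) = 1"
      proof -
        have "\<alpha> * w = (1 - \<nu>) * (1 - w) / t"
          using exponent_rel(2) by (simp add: w_def)
        then have "\<alpha> * w + - ((1 - \<nu>) / t) * (1 - w) = 0" by simp
        then show ?thesis using \<mu>_pos[OF x, of k] by (simp only: powr_add[symmetric]) simp
      qed
      also have "exp (w * ((1 - \<tau>) * (b x - a k x))) * exp ((1 - w) * (b x - a k x)) = 1"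
      proof -
        have "w * \<tau> = 1" using s_less_t by (simp add: w_def \<tau>_def)
        moreover have "w * ((1 - \<tau>) * d) + (1 - w) * d = (1 - w * \<tau>) * d" for d by (simp add: algebra_simps)
        ultimately show ?thesis by (simp flip: exp_add)
      qed
      finally show ?thesis by simp
    qed
  qed (use A0 B0 in auto)
  finally show ?thesis by (simp add: w_def)
qed

lemma nn_integral_sum_level_le:
  assumes z: "z \<in> space M"
  shows "(\<integral>\<^sup>+x\<in>C m z. ennreal ((\<Sum>k<n. T k x) powr t) \<partial>M) \<le> ennreal (A3 * (\<mu> m z powr \<nu> * N powr t))"
proof -
  have [measurable]: "C m z \<in> sets M" using z by (rule cell_sets)
  \<comment> \<open>The 8 is the 2 of the geometric summation times the 4 of the Morrey bound on
    \<open>F\<close>.\<close>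
  define c where "c = (8 / (1 - \<theta>)) powr q * N powr (t - s)"
  have pw: "(\<Sum>k<n. T k x) powr t \<le> c * Q n x powr s" if x: "x \<in> space M" for x
  proof -
    have "(\<Sum>k<n. T k x) powr t \<le> (2 * (Q n x powr (s / t) * (4 * N) powr (1 - s / t)) / (1 - \<theta>)) powr t"
      using sum_level_le[OF x] t by (intro powr_mono2 sum_nonneg level_nonneg) auto
    also have "\<dots> = (2 / (1 - \<theta>)) powr t * ((Q n x powr (s / t)) powr t * ((4 * N) powr (1 - s / t)) powr t)"
      using \<theta> by (simp add: powr_mult powr_divide)
    also have "(Q n x powr (s / t)) powr t = Q n x powr s" using t by (simp add: powr_powr)
    also have "((4 * N) powr (1 - s / t)) powr t = 4 powr (t - s) * N powr (t - s)"
      using t N by (simp add: powr_powr powr_mult left_diff_distrib)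
    also have "(2 / (1 - \<theta>)) powr t * (Q n x powr s * (4 powr (t - s) * N powr (t - s)))
        = ((2 / (1 - \<theta>)) powr t * 4 powr (t - s)) * (N powr (t - s) * Q n x powr s)" by (simp only: mult_ac)
    also have "\<dots> \<le> ((2 / (1 - \<theta>)) powr q * 4 powr q) * (N powr (t - s) * Q n x powr s)"
      using \<theta> t s_less_t by (intro mult_right_mono mult_mono powr_mono) (auto simp: field_simps)
    also have "(2 / (1 - \<theta>)) powr q * 4 powr q = (8 / (1 - \<theta>)) powr q"
      using \<theta> by (simp flip: powr_mult)
    finally show ?thesis by (simp add: c_def mult_ac)
  qed
  have c0: "0 \<le> c" by (simp add: c_def)
  have "(\<integral>\<^sup>+x\<in>C m z. ennreal ((\<Sum>k<n. T k x) powr t) \<partial>M)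
      \<le> (\<integral>\<^sup>+x. ennreal c * (ennreal (Q n x powr s) * indicator (C m z) x) \<partial>M)"
    using pw c0 by (intro nn_integral_mono) (auto simp: indicator_def ennreal_leI simp flip: ennreal_mult)
  also have "\<dots> = ennreal c * (\<integral>\<^sup>+x\<in>C m z. ennreal (Q n x powr s) \<partial>M)"
    by (rule nn_integral_cmult) measurable
  also have "\<dots> \<le> ennreal c * ennreal (A2 * (\<mu> m z powr \<nu> * N powr s))"
    by (intro mult_left_mono nn_integral_Q_le z) simp
  also have "\<dots> = ennreal ((8 / (1 - \<theta>)) powr q * A2 * (\<mu> m z powr \<nu> * (N powr (t - s) * N powr s)))"
    using c0 A2_nonneg by (simp add: c_def mult_ac flip: ennreal_mult)
  also have "N powr (t - s) * N powr s = N powr t" by (simp flip: powr_add)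
  finally show ?thesis by (simp add: A3_def)
qed

theorem level_sum_bound:
  shows "AE x in M. summable (\<lambda>k. T k x)"
    and "z \<in> space M \<Longrightarrow> (\<integral>\<^sup>+x\<in>C m z. ennreal ((\<Sum>k. T k x) powr t) \<partial>M) \<le> ennreal (A3 * (\<mu> m z powr \<nu> * N powr t))"
proof -
  let ?S = "\<lambda>n x. \<Sum>k<n. T k x"
  have S_mono: "?S n x \<le> ?S n' x" if "n \<le> n'" for n n' x
    using that by (intro sum_mono2) (auto simp: level_nonneg)
  have S0: "0 \<le> ?S n x" for n x by (intro sum_nonneg level_nonneg)
  have inc: "incseq (\<lambda>n x. ennreal (?S n x powr t))"
    using S_mono S0 t by (auto simp: incseq_def le_fun_def intro!: ennreal_leI powr_mono2)
  \<comment> \<open>Until summability is known, the supremum of the partial sums in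
    \<open>ennreal\<close> stands in for the series.\<close>
  have sup_bd: "(\<integral>\<^sup>+x\<in>C m z. (SUP n. ennreal (?S n x powr t)) \<partial>M) \<le> ennreal (A3 * (\<mu> m z powr \<nu> * N powr t))"
    if z: "z \<in> space M" for z m
  proof -
    have [measurable]: "C m z \<in> sets M" using z by (rule cell_sets)
    have "(\<integral>\<^sup>+x\<in>C m z. (SUP n. ennreal (?S n x powr t)) \<partial>M)
        = (\<integral>\<^sup>+x. (SUP n. ennreal (?S n x powr t) * indicator (C m z) x) \<partial>M)"
      by (intro nn_integral_cong) (auto simp: indicator_def)
    also have "\<dots> = (SUP n. \<integral>\<^sup>+x\<in>C m z. ennreal (?S n x powr t) \<partial>M)"
    proof (rule nn_integral_monotone_convergence_SUP)
      show "incseq (\<lambda>n x. ennreal (?S n x powr t) * indicator (C m z) x)"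
        using inc by (auto simp: incseq_def le_fun_def indicator_def)
    qed measurable
    also have "\<dots> \<le> ennreal (A3 * (\<mu> m z powr \<nu> * N powr t))"
      by (intro SUP_least nn_integral_sum_level_le z)
    finally show ?thesis .
  qed
  \<comment> \<open>Generation 0 is the whole space, so the bound on its cell makes the supremum
    finite almost everywhere.\<close>
  obtain z0 where z0: "z0 \<in> space M" using nonempty by blast
  have "(\<integral>\<^sup>+x. (SUP n. ennreal (?S n x powr t)) \<partial>M) = (\<integral>\<^sup>+x\<in>C 0 z0. (SUP n. ennreal (?S n x powr t)) \<partial>M)"
    using cell_0[OF z0] by (intro nn_integral_cong) auto
  also have "\<dots> \<noteq> \<infinity>" using sup_bd[OF z0, of 0] by (auto simp: top_unique)
  finally have "AE x in M. (SUP n. ennreal (?S n x powr t)) \<noteq> \<infinity>"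
    by (intro nn_integral_PInf_AE) auto
  then show summ: "AE x in M. summable (\<lambda>k. T k x)"
  proof eventually_elim
    case (elim x)
    define B where "B = enn2real (SUP n. ennreal (?S n x powr t))"
    have "?S n x \<le> B powr (1 / t)" for n
    proof -
      have "ennreal (?S n x powr t) \<le> (SUP n. ennreal (?S n x powr t))" by (rule SUP_upper) simp
      also have "\<dots> = ennreal B"
        unfolding B_def using elim unfolding less_top infinity_ennreal_def by (rule ennreal_enn2real[symmetric])
      finally have "ennreal (?S n x powr t) \<le> ennreal B" .
      then have "?S n x powr t \<le> B" by (simp add: B_def)
      then have "(?S n x powr t) powr (1 / t) \<le> B powr (1 / t)" using t by (intro powr_mono2) auto
      then show ?thesis using t S0[of x n] by (simp add: powr_powr)
    qed
    then show ?case by (intro summableI_nonneg_bounded[where x = "B powr (1 / t)"] level_nonneg)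
  qed
  show "(\<integral>\<^sup>+x\<in>C m z. ennreal ((\<Sum>k. T k x) powr t) \<partial>M) \<le> ennreal (A3 * (\<mu> m z powr \<nu> * N powr t))"
    if z: "z \<in> space M"
  proof -
    have "(\<integral>\<^sup>+x\<in>C m z. ennreal ((\<Sum>k. T k x) powr t) \<partial>M) \<le> (\<integral>\<^sup>+x\<in>C m z. (SUP n. ennreal (?S n x powr t)) \<partial>M)"
    proof (rule nn_integral_mono_AE)
      show "AE x in M. ennreal ((\<Sum>k. T k x) powr t) * indicator (C m z) x \<le> (SUP n. ennreal (?S n x powr t)) * indicator (C m z) x"
        using summ
      proof eventually_elim
        case (elim x)
        have "(\<lambda>n. ennreal (?S n x powr t)) \<longlonglongrightarrow> ennreal ((\<Sum>k. T k x) powr t)"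
          using summable_LIMSEQ[OF elim] t S0 by (intro tendsto_ennrealI tendsto_powr') auto
        then have "ennreal ((\<Sum>k. T k x) powr t) \<le> (SUP n. ennreal (?S n x powr t))"
          by (rule LIMSEQ_le_const2) (intro exI allI impI SUP_upper UNIV_I)
        then show ?case by (rule mult_right_mono) simp
      qed
    qed
    also note sup_bd[OF z]
    finally show ?thesis .
  qed
qed

end

section \<open>Cells in a space of homogeneous type\<close>

context homogeneous_type_space begin

abbreviation B :: "'a \<Rightarrow> real \<Rightarrow> 'a set" where "B \<equiv> qball M d"

lemma quasimetric_constant:
  obtains K where "1 \<le> K"
    "\<And>x y z. x \<in> space M \<Longrightarrow> y \<in> space M \<Longrightarrow> z \<in> space M \<Longrightarrow> d x y \<le> K * (d x z + d z y)"
    "\<And>x y. x \<in> space M \<Longrightarrow> y \<in> space M \<Longrightarrow> d x y \<le> K * d y x"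
    "\<And>x y. x \<in> space M \<Longrightarrow> y \<in> space M \<Longrightarrow> 0 \<le> d x y"
    "\<And>x y. x \<in> space M \<Longrightarrow> y \<in> space M \<Longrightarrow> d x y = 0 \<longleftrightarrow> x = y"
proof -
  obtain Ct Cs where C: "\<forall>x\<in>space M. \<forall>y\<in>space M. 0 \<le> d x y"
    "\<forall>x\<in>space M. \<forall>y\<in>space M. \<forall>z\<in>space M. d x y \<le> Ct * (d x z + d z y)"
    "\<forall>x\<in>space M. \<forall>y\<in>space M. d x y \<le> Cs * d y x"
    "\<forall>x\<in>space M. \<forall>y\<in>space M. d x y = 0 \<longleftrightarrow> x = y"
    using quasimetric unfolding quasimetric_on_def by (elim conjE exE) (rule that)
  show ?thesis
  proof (rule that[of "max 1 (max Ct Cs)"])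
    fix x y z assume x: "x \<in> space M" "y \<in> space M" "z \<in> space M"
    have "d x y \<le> Ct * (d x z + d z y)" using C x by blast
    also have "\<dots> \<le> max 1 (max Ct Cs) * (d x z + d z y)"
      using C(1) x by (intro mult_right_mono add_nonneg_nonneg) auto
    finally show "d x y \<le> max 1 (max Ct Cs) * (d x z + d z y)" .
  next
    fix x y assume x: "x \<in> space M" "y \<in> space M"
    have "d x y \<le> Cs * d y x" using C x by blast
    also have "\<dots> \<le> max 1 (max Ct Cs) * d y x" using C(1) x by (intro mult_right_mono) auto
    finally show "d x y \<le> max 1 (max Ct Cs) * d y x" .
  next
    fix x y assume "x \<in> space M" "y \<in> space M"
    then show "0 \<le> d x y" "d x y = 0 \<longleftrightarrow> x = y" using C(1,4) by blast+
  qed simp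
qed

lemma d_le_qdiam: "x \<in> space M \<Longrightarrow> y \<in> space M \<Longrightarrow> d x y \<le> qdiam M d"
  unfolding qdiam_def using diam_finite by (intro cSup_upper) auto

lemma B_space: "x \<in> space M \<Longrightarrow> qdiam M d < r \<Longrightarrow> B x r = space M"
  using d_le_qdiam by (fastforce simp: qball_def)

lemma B_mono: "r \<le> r' \<Longrightarrow> B x r \<subseteq> B x r'"
  by (auto simp: qball_def)

lemma finite_measure_if_diam_pos:
  assumes "0 < qdiam M d"
  shows "finite_measure M"
proof
  show "emeasure M (space M) \<noteq> \<infinity>"
  proof (cases "space M = {}")
    case False
    then obtain x where x: "x \<in> space M" by blast
    then show ?thesis using qball_finite[OF x, of "2 * qdiam M d"] B_space[OF x, of "2 * qdiam M d"] assms by simp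
  qed simp
qed

end

locale homogeneous_type_space_pos = homogeneous_type_space +
  fixes K Cd :: real
  assumes diam_pos: "0 < qdiam M d" and K: "1 \<le> K"
    and triangle: "\<And>x y z. x \<in> space M \<Longrightarrow> y \<in> space M \<Longrightarrow> z \<in> space M \<Longrightarrow> d x y \<le> K * (d x z + d z y)"
    and sym: "\<And>x y. x \<in> space M \<Longrightarrow> y \<in> space M \<Longrightarrow> d x y \<le> K * d y x"
    and d_nonneg: "\<And>x y. x \<in> space M \<Longrightarrow> y \<in> space M \<Longrightarrow> 0 \<le> d x y"
    and d_zero: "\<And>x y. x \<in> space M \<Longrightarrow> y \<in> space M \<Longrightarrow> d x y = 0 \<longleftrightarrow> x = y"
    and Cd: "1 < Cd"
    and Cd_doubling: "\<And>x r. x \<in> space M \<Longrightarrow> 0 < r \<Longrightarrow> r < qdiam M d \<Longrightarrow>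
      measure M (B x (2 * r)) \<le> Cd * measure M (B x r)"
begin

sublocale finite_measure M by (rule finite_measure_if_diam_pos[OF diam_pos])

abbreviation D :: real where "D \<equiv> qdiam M d"

lemma B_sets: "x \<in> space M \<Longrightarrow> B x r \<in> sets M"
proof (cases "0 < r")
  case False
  assume x: "x \<in> space M"
  have "B x r = {}" using False d_nonneg[OF x] by (fastforce simp: qball_def)
  then show ?thesis by simp
qed (rule qball_measurable)

lemma measure_B_mono: "x \<in> space M \<Longrightarrow> y \<in> space M \<Longrightarrow> B x r \<subseteq> B y s \<Longrightarrow> measure M (B x r) \<le> measure M (B y s)"
  by (intro finite_measure_mono B_sets)

section \<open>Doubling at all radii and finite nets\<close>

lemma doubling_all:
  assumes x: "x \<in> space M" and r: "0 < r"
  shows "measure M (B x (2 * r)) \<le> Cd * measure M (B x r)"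
proof (cases "r < D")
  case False
  \<comment> \<open>Doubling is given for radii below \<open>D\<close> only. For larger
    \<open>r\<close>, the ball of radius \<open>3 / 2 * D\<close> is already the whole space, and
    \<open>3 / 4 * D\<close> is an admissible radius.\<close>
  have "measure M (B x (2 * r)) \<le> measure M (B x (2 * (3 / 4 * D)))"
    using x False diam_pos by (intro measure_B_mono) (auto simp: B_space)
  also have "\<dots> \<le> Cd * measure M (B x (3 / 4 * D))" using x diam_pos by (intro Cd_doubling) auto
  also have "\<dots> \<le> Cd * measure M (B x r)"
    using x Cd False diam_pos by (intro mult_left_mono measure_B_mono B_mono) auto
  finally show ?thesis .
qed (use Cd_doubling[OF x r] in blast)

lemma doubling_iterated:
  assumes x: "x \<in> space M" and r: "0 < r"
  shows "measure M (B x (2 ^ n * r)) \<le> Cd ^ n * measure M (B x r)"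
proof (induction n)
  case (Suc n)
  have "measure M (B x (2 * (2 ^ n * r))) \<le> Cd * measure M (B x (2 ^ n * r))"
    using x r by (intro doubling_all) auto
  also have "\<dots> \<le> Cd * (Cd ^ n * measure M (B x r))" using Cd Suc by (intro mult_left_mono) auto
  finally show ?case by (simp add: mult_ac)
qed simp

lemma measure_B_le:
  assumes "x \<in> space M" "0 < r" "R \<le> 2 ^ n * r"
  shows "measure M (B x R) \<le> Cd ^ n * measure M (B x r)"
  using measure_B_mono[OF assms(1,1) B_mono[OF assms(3)]] doubling_iterated[OF assms(1,2), of n] by linarith

lemma measure_B_pos:
  assumes x: "x \<in> space M" and r: "0 < r"
  shows "0 < measure M (B x r)"
proof -
  define R where "R = min r D / 2"
  have R: "0 < R" "R < D" "R \<le> r" using r diam_pos by (auto simp: R_def)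
  have "0 < measure M (B x R - B x (R / 2))" using R x by (intro annulus_pos) auto
  also have "\<dots> \<le> measure M (B x r)"
    using R(3) B_mono[of R r x] by (intro finite_measure_mono B_sets x) auto
  finally show ?thesis .
qed

lemma in_B_sym:
  assumes "x \<in> space M" "y \<in> B x r"
  shows "y \<in> space M" "d x y < r" "d y x < K * r"
proof -
  show y: "y \<in> space M" "d x y < r" using assms by (auto simp: qball_def)
  have "d y x \<le> K * d x y" using assms(1) y(1) by (intro sym)
  also have "\<dots> < K * r" using y K by (intro mult_strict_left_mono) auto
  finally show "d y x < K * r" .
qed

text \<open>Doubling bounds the number of points of a separated set, so one of largest cardinality
  exists, and it is a net. The separation is \<open>r / K\<close> because \<open>d\<close> is not
  symmetric: a point outside all balls of radius \<open>r\<close> has distance at least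
  \<open>r\<close> from the net points, but they have only \<open>r / K\<close> from it when the
  order is reversed.\<close>

lemma finite_net:
  assumes r: "0 < r"
  shows "\<exists>Z. finite Z \<and> Z \<subseteq> space M \<and> (\<forall>x\<in>space M. \<exists>z\<in>Z. x \<in> B z r)"
proof -
  define sep where "sep = (\<lambda>S. finite S \<and> S \<subseteq> space M \<and> (\<forall>z\<in>S. \<forall>z'\<in>S. z \<noteq> z' \<longrightarrow> r / K \<le> d z z'))"
  \<comment> \<open>Balls of this radius around separated points are disjoint: a common point would
    give a distance below \<open>2 * K\<^sup>2 * \<rho> = r / K\<close>.\<close>
  define \<rho> where "\<rho> = r / (2 * K ^ 3)"
  have \<rho>: "0 < \<rho>" using r K by (simp add: \<rho>_def)
  obtain n where n: "2 * D / \<rho> < 2 ^ n" using real_arch_pow[of 2 "2 * D / \<rho>"] by auto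
  have whole: "measure M (space M) \<le> Cd ^ n * measure M (B z \<rho>)" if z: "z \<in> space M" for z
  proof -
    have "measure M (B z (2 * D)) \<le> Cd ^ n * measure M (B z \<rho>)"
      using n \<rho> by (intro measure_B_le z) (auto simp: field_simps)
    then show ?thesis using B_space[OF z] diam_pos by simp
  qed
  have card_bd: "real (card S) \<le> Cd ^ n" if S: "sep S" for S
  proof (cases "S = {}")
    case False
    then obtain z0 where z0: "z0 \<in> space M" using S by (auto simp: sep_def)
    have disj: "disjoint_family_on (\<lambda>z. B z \<rho>) S"
      unfolding disjoint_family_on_def
    proof (intro ballI impI)
      fix z z' assume z: "z \<in> S" "z' \<in> S" "z \<noteq> z'"
      show "B z \<rho> \<inter> B z' \<rho> = {}"
      proof (rule ccontr)
        assume "B z \<rho> \<inter> B z' \<rho> \<noteq> {}"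
        then obtain v where v: "v \<in> B z \<rho>" "v \<in> B z' \<rho>" by blast
        have zs: "z \<in> space M" "z' \<in> space M" using z S by (auto simp: sep_def)
        have "d z z' \<le> K * (d z v + d v z')" using zs in_B_sym(1)[OF zs(1) v(1)] by (intro triangle)
        also have "\<dots> < K * (\<rho> + K * \<rho>)"
          using in_B_sym(2)[OF zs(1) v(1)] in_B_sym(3)[OF zs(2) v(2)] K by (intro mult_strict_left_mono add_strict_mono) auto
        also have "\<dots> \<le> K * (K * \<rho> + K * \<rho>)" using K \<rho> by (intro mult_left_mono add_right_mono) auto
        also have "\<dots> = r / K" using K by (simp add: \<rho>_def field_simps power3_eq_cube)
        finally show False using z S by (auto simp: sep_def not_le[symmetric])
      qed
    qed
    have "real (card S) * measure M (space M) = (\<Sum>z\<in>S. measure M (space M))" by simp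
    also have "\<dots> \<le> (\<Sum>z\<in>S. Cd ^ n * measure M (B z \<rho>))"
      using S whole by (intro sum_mono) (auto simp: sep_def)
    also have "\<dots> = Cd ^ n * (\<Sum>z\<in>S. measure M (B z \<rho>))" by (simp add: sum_distrib_left)
    also have "(\<Sum>z\<in>S. measure M (B z \<rho>)) = measure M (\<Union>z\<in>S. B z \<rho>)"
      using S disj by (intro finite_measure_finite_Union[symmetric]) (auto simp: sep_def intro!: B_sets)
    also have "Cd ^ n * \<dots> \<le> Cd ^ n * measure M (space M)"
      using Cd by (intro mult_left_mono bounded_measure) auto
    finally show ?thesis using measure_B_pos[OF z0, of "2 * D"] B_space[OF z0, of "2 * D"] diam_pos by simp
  qed (use Cd in simp)
  have fin: "finite (card ` {S. sep S})"
  proof (rule finite_subset)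
    show "card ` {S. sep S} \<subseteq> {.. nat \<lfloor>Cd ^ n\<rfloor>}" using card_bd by (auto simp: le_nat_floor)
  qed simp
  have "sep {}" by (simp add: sep_def)
  then have "Max (card ` {S. sep S}) \<in> card ` {S. sep S}" using fin by (intro Max_in) auto
  then obtain S where S: "sep S" "card S = Max (card ` {S. sep S})" by auto
  have "\<exists>z\<in>S. x \<in> B z r" if x: "x \<in> space M" for x
  proof (rule ccontr)
    assume neg: "\<not> (\<exists>z\<in>S. x \<in> B z r)"
    have far: "r \<le> d z x" if "z \<in> S" for z using neg x that by (auto simp: qball_def not_less)
    have r_K: "r / K \<le> r" using r K by (simp add: divide_le_eq mult_le_cancel_left1)
    have far': "r / K \<le> d x z" if z: "z \<in> S" for z
    proof -
      have "r \<le> K * d x z" using far[OF z] sym[of z x] S(1) z x by (fastforce simp: sep_def)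
      then show ?thesis using K by (simp add: divide_le_eq mult.commute)
    qed
    have "x \<notin> S" using far[of x] d_zero[OF x x] r by auto
    have "sep (insert x S)"
      using S(1) x far far' r_K unfolding sep_def by (auto intro: order_trans)
    then have "card (insert x S) \<le> Max (card ` {S. sep S})" using fin by (intro Max_ge) auto
    then show False using S \<open>x \<notin> S\<close> by (simp add: sep_def)
  qed
  moreover have "finite S" "S \<subseteq> space M" using S(1) by (simp_all add: sep_def)
  ultimately show ?thesis by (intro exI[of _ S] conjI ballI)
qed

text \<open>Among the balls that contain a point, the one added last takes precedence. The fibres
  are therefore Boolean combinations of balls, hence measurable.\<close>

lemma net_selection:
  assumes "finite Z" "Z \<subseteq> space M"
  shows "\<exists>\<pi>. (\<forall>x. (\<exists>z\<in>Z. x \<in> B z r) \<longrightarrow> \<pi> x \<in> Z \<and> x \<in> B (\<pi> x) r) \<and> (\<forall>z. {x\<in>space M. \<pi> x = z} \<in> sets M)"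
  using assms
proof (induction Z rule: finite_induct)
  case empty
  then show ?case by (intro exI[of _ "\<lambda>x. undefined"]) auto
next
  case (insert z0 Z)
  then obtain \<pi> where \<pi>: "\<forall>x. (\<exists>z\<in>Z. x \<in> B z r) \<longrightarrow> \<pi> x \<in> Z \<and> x \<in> B (\<pi> x) r"
    "\<forall>z. {x\<in>space M. \<pi> x = z} \<in> sets M" by auto
  have z0: "B z0 r \<in> sets M" using insert.prems by (intro B_sets) auto
  have "{x\<in>space M. (if x \<in> B z0 r then z0 else \<pi> x) = z}
      = (if z = z0 then B z0 r \<union> {x\<in>space M. \<pi> x = z} else {x\<in>space M. \<pi> x = z} - B z0 r)" for z
    by (auto simp: qball_def split: if_splits)
  then have "\<forall>z. {x\<in>space M. (if x \<in> B z0 r then z0 else \<pi> x) = z} \<in> sets M" using z0 \<pi>(2) by auto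
  moreover have "\<forall>x. (\<exists>z\<in>insert z0 Z. x \<in> B z r) \<longrightarrow>
      (if x \<in> B z0 r then z0 else \<pi> x) \<in> insert z0 Z \<and> x \<in> B (if x \<in> B z0 r then z0 else \<pi> x) r"
    using \<pi>(1) by auto
  ultimately show ?case by (intro exI[of _ "\<lambda>x. if x \<in> B z0 r then z0 else \<pi> x"] conjI)
qed

text \<open>The ratio of consecutive radii is so small that the cells are engulfed by parents, and that an
  annulus around each point separates its cell from a ball inside the parent.\<close>

definition scale :: "nat \<Rightarrow> real" where "scale k = 2 * D * (1 / (32 * K ^ 5)) ^ k"

lemma ratio: "0 < 1 / (32 * K ^ 5)" "1 / (32 * K ^ 5) < 1"
proof -
  have "1 \<le> K ^ 5" using K by (rule one_le_power)
  then have "1 < 32 * K ^ 5" by linarith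
  then show "0 < 1 / (32 * K ^ 5)" "1 / (32 * K ^ 5) < 1" using K by (auto simp: divide_less_eq)
qed

lemma scale_pos: "0 < scale k"
  using diam_pos ratio(1) unfolding scale_def by (intro mult_pos_pos zero_less_power) auto

lemma scale_Suc: "scale k = 32 * K ^ 5 * scale (Suc k)"
  using K by (simp add: scale_def)

lemma scale_1: "K ^ 5 * scale 1 = D / 16"
proof -
  have "scale 0 = 2 * D" by (simp add: scale_def)
  then have "32 * (K ^ 5 * scale 1) = 2 * D" using scale_Suc[of 0] by (simp only: mult.assoc One_nat_def)
  then show ?thesis by linarith
qed

lemma scale_antimono: "k \<le> j \<Longrightarrow> scale j \<le> scale k"
  unfolding scale_def using diam_pos ratio by (intro mult_left_mono power_decreasing) auto

lemma scale_tendsto: "scale \<longlonglongrightarrow> 0"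
  unfolding scale_def using ratio by (intro tendsto_mult_right_zero LIMSEQ_power_zero) auto

lemma scale_eventually_less: "0 < e \<Longrightarrow> \<exists>k0. \<forall>k\<ge>k0. c * scale k < e"
  using order_tendstoD(2)[OF tendsto_mult_right_zero[OF scale_tendsto, of c], of e]
  by (simp add: eventually_sequentially)

lemma net_map_exists:
  "\<exists>\<pi>. \<forall>k. finite (\<pi> k ` space M) \<and> (\<forall>x\<in>space M. \<pi> k x \<in> space M \<and> x \<in> B (\<pi> k x) (scale k)) \<and>
    (\<forall>z. {x\<in>space M. \<pi> k x = z} \<in> sets M)"
proof (intro choice allI)
  fix k
  obtain Z where Z: "finite Z" "Z \<subseteq> space M" "\<forall>x\<in>space M. \<exists>z\<in>Z. x \<in> B z (scale k)"
    using finite_net[OF scale_pos[of k]] by blast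
  then obtain \<pi> where "\<forall>x. (\<exists>z\<in>Z. x \<in> B z (scale k)) \<longrightarrow> \<pi> x \<in> Z \<and> x \<in> B (\<pi> x) (scale k)"
    "\<forall>z. {x\<in>space M. \<pi> x = z} \<in> sets M" using net_selection[OF Z(1,2), of "scale k"] by blast
  then show "\<exists>\<pi>. finite (\<pi> ` space M) \<and> (\<forall>x\<in>space M. \<pi> x \<in> space M \<and> x \<in> B (\<pi> x) (scale k)) \<and>
      (\<forall>z. {x\<in>space M. \<pi> x = z} \<in> sets M)"
    using Z by (intro exI[of _ \<pi>]) (auto intro!: finite_subset[OF _ Z(1)])
qed

definition net_map :: "nat \<Rightarrow> 'a \<Rightarrow> 'a" where
  "net_map = (SOME \<pi>. \<forall>k. finite (\<pi> k ` space M) \<and>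
    (\<forall>x\<in>space M. \<pi> k x \<in> space M \<and> x \<in> B (\<pi> k x) (scale k)) \<and>
    (\<forall>z. {x\<in>space M. \<pi> k x = z} \<in> sets M))"

lemma net_map:
  shows "finite (net_map k ` space M)" "x \<in> space M \<Longrightarrow> net_map k x \<in> space M"
    "x \<in> space M \<Longrightarrow> x \<in> B (net_map k x) (scale k)" "{x\<in>space M. net_map k x = z} \<in> sets M"
  using someI_ex[OF net_map_exists] unfolding net_map_def[symmetric] by auto

text \<open>Centred at a net point, so that each generation has finitely many cells. The factor
  \<open>2 * K\<close> makes the cell contain the ball of radius \<open>scale k\<close> around
  \<open>x\<close> itself.\<close>

definition cell :: "nat \<Rightarrow> 'a \<Rightarrow> 'a set" where
  "cell k x = B (net_map k x) (2 * K * scale k)"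

lemma ball_subset_cell:
  assumes x: "x \<in> space M"
  shows "B x (scale k) \<subseteq> cell k x"
proof
  fix y assume y: "y \<in> B x (scale k)"
  note y' = in_B_sym[OF x y]
  have "d (net_map k x) y \<le> K * (d (net_map k x) x + d x y)" using x y' by (intro triangle net_map)
  also have "\<dots> < K * (scale k + scale k)"
    using in_B_sym(2)[OF net_map(2)[OF x] net_map(3)[OF x]] y' K by (intro mult_strict_left_mono add_strict_mono) auto
  finally show "y \<in> cell k x" using y' by (simp add: cell_def qball_def)
qed

lemma cell_subset_ball:
  assumes x: "x \<in> space M"
  shows "cell k x \<subseteq> B x (3 * K\<^sup>2 * scale k)"
proof
  fix y assume "y \<in> cell k x"
  then have y: "y \<in> space M" "d (net_map k x) y < 2 * K * scale k" by (auto simp: cell_def qball_def)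
  have "d x y \<le> K * (d x (net_map k x) + d (net_map k x) y)" using x y by (intro triangle net_map)
  also have "\<dots> < K * (K * scale k + 2 * K * scale k)"
    using in_B_sym(3)[OF net_map(2)[OF x] net_map(3)[OF x]] y K by (intro mult_strict_left_mono add_strict_mono) auto
  also have "\<dots> = 3 * K\<^sup>2 * scale k" by (simp add: power2_eq_square algebra_simps)
  finally show "y \<in> B x (3 * K\<^sup>2 * scale k)" using y by (simp add: qball_def)
qed

lemma K_power_mono: "i \<le> j \<Longrightarrow> K ^ i \<le> K ^ j"
  using K by (rule power_increasing[rotated])

text \<open>Through a common point, every \<open>v\<close> in the finer cell is within
  \<open>9 * K ^ 5 * scale k\<close> of \<open>x\<close>. For \<open>k > 0\<close> this is below
  \<open>scale (k - 1)\<close>, which the factor 2 in the radius of the parent absorbs.\<close>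

lemma cell_engulf:
  assumes x: "x \<in> space M" and y: "y \<in> space M" and kj: "k \<le> j" and meet: "cell j y \<inter> cell k x \<noteq> {}"
  shows "cell j y \<subseteq> cell (k - 1) x"
proof (cases k)
  case 0
  have "2 * D \<le> 2 * K * scale 0" using K diam_pos by (simp add: scale_def)
  then have "cell 0 x = space M" unfolding cell_def using diam_pos by (intro B_space net_map x) auto
  then show ?thesis using 0 by (auto simp: cell_def qball_def)
next
  case (Suc i)
  obtain w where w: "w \<in> cell j y" "w \<in> cell k x" using meet by blast
  show ?thesis
  proof
    fix v assume v: "v \<in> cell j y"
    have s: "scale j \<le> scale k" "0 \<le> scale k" "0 \<le> scale j" using scale_antimono[OF kj] scale_pos[of k] scale_pos[of j] by auto
    have wy: "w \<in> B y (3 * K\<^sup>2 * scale j)" "v \<in> B y (3 * K\<^sup>2 * scale j)" and wx: "w \<in> B x (3 * K\<^sup>2 * scale k)"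
      using cell_subset_ball[OF y] cell_subset_ball[OF x] w v by blast+
    note w' = in_B_sym[OF y wy(1)] and v' = in_B_sym[OF y wy(2)] and w'' = in_B_sym[OF x wx]
    have "d x v \<le> K * (d x w + d w v)" using x w' v' by (intro triangle)
    also have "\<dots> \<le> K * (3 * K\<^sup>2 * scale k + K * (K * (3 * K\<^sup>2 * scale j) + 3 * K\<^sup>2 * scale j))"
    proof (intro mult_left_mono add_mono)
      have "d w v \<le> K * (d w y + d y v)" using y w' v' by (intro triangle)
      also have "\<dots> \<le> K * (K * (3 * K\<^sup>2 * scale j) + 3 * K\<^sup>2 * scale j)"
        using w' v' K by (intro mult_left_mono add_mono) auto
      finally show "d w v \<le> K * (K * (3 * K\<^sup>2 * scale j) + 3 * K\<^sup>2 * scale j)" .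
    qed (use w'' K in auto)
    also have "\<dots> = 3 * K ^ 3 * scale k + 3 * K ^ 5 * scale j + 3 * K ^ 4 * scale j"
      by (simp add: algebra_simps eval_nat_numeral)
    also have "\<dots> \<le> 3 * K ^ 5 * scale k + 3 * K ^ 5 * scale k + 3 * K ^ 5 * scale k"
      using s K_power_mono[of 3 5] K_power_mono[of 4 5] K by (intro add_mono mult_mono) auto
    finally have xv: "d x v \<le> 9 * K ^ 5 * scale k" by (simp add: mult_ac)
    have "d (net_map i x) v \<le> K * (d (net_map i x) x + d x v)" using x v' by (intro triangle net_map)
    also have "\<dots> < K * (scale i + 32 * K ^ 5 * scale k)"
    proof -
      have "9 * K ^ 5 * scale k \<le> 32 * K ^ 5 * scale k" using K s by (intro mult_right_mono) auto
      with xv have "d x v \<le> 32 * K ^ 5 * scale k" by (rule order_trans)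
      then show ?thesis
        using in_B_sym(2)[OF net_map(2)[OF x] net_map(3)[OF x], of i] K
        by (intro mult_strict_left_mono add_less_le_mono) auto
    qed
    also have "\<dots> = 2 * K * scale i" using scale_Suc[of i] Suc by simp
    finally show "v \<in> cell (k - 1) x" using v' Suc by (simp add: cell_def qball_def)
  qed
qed

section \<open>Comparison of the measures of cells and balls\<close>

definition doublings :: nat where "doublings = (SOME n. 128 * K ^ 8 \<le> 2 ^ n)"
text \<open>One constant for all comparisons below. The ratio \<open>128 * K ^ 8\<close> is that of
  \<open>cell_decay\<close>, between a ball around an off-centre point that covers a cell and a ball
  of the next radius.\<close>

definition G :: real where "G = Cd ^ doublings"

lemma doublings: "128 * K ^ 8 \<le> 2 ^ doublings"
proof -
  have "\<exists>n. 128 * K ^ 8 \<le> (2::real) ^ n" using real_arch_pow[of 2 "128 * K ^ 8"] by (auto intro: less_imp_le)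
  from someI_ex[OF this] show ?thesis unfolding doublings_def .
qed

lemma G: "1 < G"
proof -
  have "doublings \<noteq> 0"
  proof
    assume "doublings = 0"
    then show False using doublings one_le_power[OF K, of 8] by simp
  qed
  then show ?thesis unfolding G_def using Cd by (intro one_less_power) auto
qed

lemma cell_le_ball:
  assumes x: "x \<in> space M"
  shows "measure M (cell k x) \<le> G * measure M (B x (scale (Suc k)))"
proof -
  have "measure M (cell k x) \<le> measure M (B x (3 * K\<^sup>2 * scale k))"
    unfolding cell_def by (intro measure_B_mono net_map x) (rule cell_subset_ball[OF x, unfolded cell_def])
  also have "\<dots> \<le> Cd ^ doublings * measure M (B x (scale (Suc k)))"
  proof (rule measure_B_le[OF x scale_pos])
    have "3 * K\<^sup>2 * scale k = 96 * K ^ 7 * scale (Suc k)"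
      unfolding scale_Suc[of k] by (simp add: eval_nat_numeral)
    also have "\<dots> \<le> 128 * K ^ 8 * scale (Suc k)"
      using K_power_mono[of 7 8] K scale_pos[of "Suc k"] by (intro mult_right_mono mult_mono) auto
    also have "\<dots> \<le> 2 ^ doublings * scale (Suc k)"
      using doublings scale_pos[of "Suc k"] by (intro mult_right_mono) auto
    finally show "3 * K\<^sup>2 * scale k \<le> 2 ^ doublings * scale (Suc k)" .
  qed
  finally show ?thesis by (simp add: G_def)
qed

lemma cell_sets': "x \<in> space M \<Longrightarrow> cell k x \<in> sets M"
  unfolding cell_def by (intro B_sets net_map)

text \<open>A nonempty annulus around \<open>x\<close> gives a point \<open>y\<close> away from the
  finer cell but well inside the coarser one. The ball of radius \<open>scale (Suc k)\<close> around
  \<open>y\<close> misses the finer cell and carries at least the fraction \<open>1 / G\<close> of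
  the coarser one.\<close>

lemma cell_decay:
  assumes x: "x \<in> space M"
  shows "measure M (cell (Suc k) x) \<le> (1 - 1 / G) * measure M (cell k x)"
proof -
  \<comment> \<open>The finer cell lies within \<open>3 * K\<^sup>2 * ?s\<close> of
    \<open>x\<close>. If a ball of radius \<open>?s\<close> around \<open>y\<close> met it, then
    \<open>d x y\<close> would be less than \<open>3 * K ^ 3 * ?s + K\<^sup>2 * ?s\<close>, hence
    below \<open>?E * ?s\<close>.\<close>
  let ?s = "scale (Suc k)" and ?E = "4 * K ^ 3"
  have s0: "0 < ?s" by (rule scale_pos)
  have K3: "1 \<le> K ^ 3" using K by (rule one_le_power)
  have "0 < K ^ 3 * ?s" using s0 K by (intro mult_pos_pos) auto
  then have E: "0 < ?E * ?s" "?E * ?s < 2 * ?E * ?s" by auto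
  have "2 * ?E * ?s < D"
  proof -
    have "?s \<le> scale 1" by (rule scale_antimono) simp
    then have "2 * ?E * ?s \<le> 8 * K ^ 3 * scale 1"
      using mult_left_mono[of ?s "scale 1" "8 * K ^ 3"] K by simp
    also have "\<dots> \<le> 8 * K ^ 5 * scale 1"
      using K_power_mono[of 3 5] scale_pos[of 1] by (intro mult_right_mono) auto
    also have "\<dots> = D / 2" using scale_1 unfolding mult.assoc by linarith
    also have "\<dots> < D" using diam_pos by simp
    finally show ?thesis .
  qed
  from annulus_pos[OF x E this] have "B x (2 * ?E * ?s) - B x (?E * ?s) \<noteq> {}" by (metis measure_empty less_irrefl)
  then obtain y where y: "y \<in> B x (2 * ?E * ?s)" "y \<notin> B x (?E * ?s)" by blast
  note y' = in_B_sym[OF x y(1)]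
  have far: "?E * ?s \<le> d x y" using y(2) y'(1) by (simp add: qball_def)
  have disj: "B y ?s \<inter> cell (Suc k) x = {}"
  proof (rule ccontr)
    assume "B y ?s \<inter> cell (Suc k) x \<noteq> {}"
    then obtain v where v: "v \<in> B y ?s" "v \<in> B x (3 * K\<^sup>2 * ?s)" using cell_subset_ball[OF x] by blast
    note v' = in_B_sym[OF y'(1) v(1)] and v'' = in_B_sym[OF x v(2)]
    have "d x y \<le> K * (d x v + d v y)" using x y' v' by (intro triangle)
    also have "\<dots> < K * (3 * K\<^sup>2 * ?s + K * ?s)" using v' v'' K by (intro mult_strict_left_mono add_strict_mono) auto
    also have "\<dots> = 3 * K ^ 3 * ?s + K ^ 2 * ?s" by (simp add: algebra_simps eval_nat_numeral)
    also have "\<dots> \<le> 3 * K ^ 3 * ?s + K ^ 3 * ?s"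
      using K_power_mono[of 2 3] s0 by (intro add_left_mono mult_right_mono) auto
    finally show False using far by simp
  qed
  have inside: "B y ?s \<subseteq> cell k x"
  proof
    fix v assume v: "v \<in> B y ?s"
    note v' = in_B_sym[OF y'(1) v]
    have "d x v \<le> K * (d x y + d y v)" using x y' v' by (intro triangle)
    also have "\<dots> \<le> K * (8 * K ^ 3 * ?s + 1 * ?s)" using y' v' K by (intro mult_left_mono add_mono) auto
    also have "\<dots> \<le> K * (8 * K ^ 3 * ?s + K ^ 3 * ?s)"
      using K K3 s0 by (intro mult_left_mono add_left_mono mult_right_mono) auto
    also have "\<dots> = 9 * K ^ 4 * ?s" by (simp add: algebra_simps eval_nat_numeral)
    also have "\<dots> \<le> 32 * K ^ 5 * ?s" using K_power_mono[of 4 5] K s0 by (intro mult_right_mono mult_mono) auto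
    finally have xv: "d x v \<le> scale k" using scale_Suc[of k] by simp
    have "d (net_map k x) v \<le> K * (d (net_map k x) x + d x v)" using x v' by (intro triangle net_map)
    also have "\<dots> < K * (scale k + scale k)"
      using in_B_sym(2)[OF net_map(2)[OF x] net_map(3)[OF x], of k] xv K
      by (intro mult_strict_left_mono add_less_le_mono) auto
    finally show "v \<in> cell k x" using v' by (simp add: cell_def qball_def)
  qed
  have sub: "cell (Suc k) x \<subseteq> cell k x"
    using cell_engulf[OF x x, of "Suc k" "Suc k"] ball_subset_cell[OF x, of "Suc k"] d_zero[OF x x] x s0
    by (auto simp: qball_def)
  have "cell k x \<subseteq> B y (128 * K ^ 8 * ?s)"
  proof
    fix v assume "v \<in> cell k x"
    then have v: "v \<in> B x (3 * K\<^sup>2 * scale k)" using cell_subset_ball[OF x] by blast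
    note v' = in_B_sym[OF x v]
    have "d y v \<le> K * (d y x + d x v)" using x y' v' by (intro triangle)
    also have "\<dots> < K * (K * (2 * ?E * ?s) + 3 * K\<^sup>2 * scale k)"
      using y' v' K by (intro mult_strict_left_mono add_strict_mono) auto
    also have "\<dots> = 8 * K ^ 5 * ?s + 96 * K ^ 8 * ?s"
      unfolding scale_Suc[of k] by (simp add: algebra_simps eval_nat_numeral)
    also have "\<dots> \<le> 8 * K ^ 8 * ?s + 120 * K ^ 8 * ?s"
      using K_power_mono[of 5 8] K s0 by (intro add_mono mult_right_mono) auto
    also have "\<dots> = 128 * K ^ 8 * ?s" by (simp add: mult_ac)
    finally show "v \<in> B y (128 * K ^ 8 * ?s)" using v' by (simp add: qball_def)
  qed
  then have "measure M (cell k x) \<le> measure M (B y (128 * K ^ 8 * ?s))"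
    by (intro finite_measure_mono B_sets y')
  also have "\<dots> \<le> G * measure M (B y ?s)"
    unfolding G_def using doublings s0 y' by (intro measure_B_le mult_right_mono) auto
  finally have big: "measure M (cell k x) \<le> G * measure M (B y ?s)" .
  have "measure M (cell (Suc k) x) + measure M (B y ?s) = measure M (cell (Suc k) x \<union> B y ?s)"
    using disj by (intro finite_measure_Union[symmetric] cell_sets' B_sets x y') auto
  also have "\<dots> \<le> measure M (cell k x)"
    using sub inside by (intro finite_measure_mono cell_sets' x) auto
  finally have "measure M (cell (Suc k) x) \<le> measure M (cell k x) - measure M (B y ?s)" by simp
  also have "\<dots> \<le> measure M (cell k x) - measure M (cell k x) / G"
    using big G by (simp add: divide_le_eq mult.commute)
  finally show ?thesis by (simp add: algebra_simps)
qed

lemma cell_0': "x \<in> space M \<Longrightarrow> cell 0 x = space M"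
proof -
  assume x: "x \<in> space M"
  have "D * 1 \<le> D * K" using K diam_pos by (intro mult_left_mono) auto
  then show ?thesis unfolding cell_def scale_def using diam_pos by (intro B_space net_map x) simp
qed

lemma cell_space_cell:
  assumes ne: "space M \<noteq> {}"
  shows "cell_space M cell G (1 - 1 / G)"
proof (intro cell_space.intro cells.intro cells_axioms.intro cell_space_axioms.intro)
  show "finite_measure M" by (rule finite_measure_if_diam_pos[OF diam_pos])
  show "cell k x \<in> sets M" if "x \<in> space M" for k x using that by (rule cell_sets')
  show "finite (cell k ` space M)" for k
  proof -
    have "cell k ` space M = (\<lambda>z. B z (2 * K * scale k)) ` net_map k ` space M" by (auto simp: cell_def)
    then show ?thesis using net_map(1)[of k] by simp
  qed
  \<comment> \<open>Different net points may have the same ball, so the fibre of a cell is a finite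
    union of fibres of the net map.\<close>
  show "{y\<in>space M. cell k y = cell k x} \<in> sets M" for k x
  proof -
    define F where "F = (\<lambda>z. B z (2 * K * scale k))"
    define Z where "Z = {z\<in>net_map k ` space M. F z = cell k x}"
    have "finite Z" unfolding Z_def by (rule finite_subset[OF _ net_map(1)[of k]]) blast
    then have "(\<Union>z\<in>Z. {y\<in>space M. net_map k y = z}) \<in> sets M" by (intro sets.finite_UN net_map(4))
    also have "(\<Union>z\<in>Z. {y\<in>space M. net_map k y = z}) = {y\<in>space M. F (net_map k y) = cell k x}"
    proof (intro equalityI subsetI)
      fix y assume "y \<in> (\<Union>z\<in>Z. {y\<in>space M. net_map k y = z})"
      then obtain z where "z \<in> Z" "y \<in> space M" "net_map k y = z" by (elim UN_E CollectE conjE)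
      then show "y \<in> {y\<in>space M. F (net_map k y) = cell k x}" by (simp add: Z_def)
    next
      fix y assume y: "y \<in> {y\<in>space M. F (net_map k y) = cell k x}"
      then have "net_map k y \<in> Z" by (simp add: Z_def)
      then show "y \<in> (\<Union>z\<in>Z. {y\<in>space M. net_map k y = z})" using y by (intro UN_I[of "net_map k y"]) simp_all
    qed
    finally show ?thesis by (simp only: F_def cell_def)
  qed
  show self: "x \<in> cell k x" if "x \<in> space M" for k x
    using ball_subset_cell[OF that, of k] d_zero[OF that that] scale_pos[of k] that by (auto simp: qball_def)
  show "cell j y \<subseteq> cell (k - 1) x" if "x \<in> space M" "y \<in> space M" "k \<le> j" "cell j y \<inter> cell k x \<noteq> {}" for j k x y
    using that by (rule cell_engulf)
  show "0 < measure M (cell k x)" if "x \<in> space M" for k x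
    unfolding cell_def using that K scale_pos[of k] by (intro measure_B_pos net_map) auto
  show "measure M (cell (k - 1) x) \<le> G * measure M (cell k x)" if x: "x \<in> space M" for k x
  proof (cases k)
    case 0
    then show ?thesis using G mult_right_mono[of 1 G "measure M (cell k x)"] by simp
  next
    case (Suc i)
    have "measure M (B x (scale k)) \<le> measure M (cell k x)"
      using ball_subset_cell[OF x] by (intro finite_measure_mono cell_sets' x)
    then have "G * measure M (B x (scale k)) \<le> G * measure M (cell k x)" using G by (intro mult_left_mono) auto
    then show ?thesis using cell_le_ball[OF x, of i] Suc by simp
  qed
  show "space M \<noteq> {}" by (rule ne)
  show "cell 0 x = space M" if "x \<in> space M" for x using that by (rule cell_0')
  show "0 < 1 - 1 / G" "1 - 1 / G < 1" using G by auto
  show "measure M (cell (Suc k) x) \<le> (1 - 1 / G) * measure M (cell k x)" if "x \<in> space M" for k x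
    using that by (rule cell_decay)
  fix h :: "'a \<Rightarrow> real" and e :: real
  assume "integrable M h" "0 < e"
  then obtain \<phi> where \<phi>: "compactly_supported_continuous T \<phi>" "integrable M \<phi>" "(\<integral>x. \<bar>h x - \<phi> x\<bar> \<partial>M) < e"
    using Cc_dense by blast
  have "\<exists>k0. \<forall>k\<ge>k0. \<forall>y\<in>cell k x. \<bar>\<phi> y - \<phi> x\<bar> < e'" if x: "x \<in> space M" and e': "0 < e'" for x e'
  proof -
    have cont: "continuous_map T euclideanreal \<phi>" using \<phi>(1) by (simp add: compactly_supported_continuous_def)
    have "openin T {y\<in>topspace T. \<phi> y \<in> ball (\<phi> x) e'}"
      by (rule openin_continuous_map_preimage[OF cont]) auto
    moreover have "x \<in> {y\<in>topspace T. \<phi> y \<in> ball (\<phi> x) e'}" using x e' space_eq by simp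
    ultimately obtain r where r: "0 < r" "B x r \<subseteq> {y\<in>topspace T. \<phi> y \<in> ball (\<phi> x) e'}"
      using qball_in_nbhd by blast
    obtain k0 where k0: "\<forall>k\<ge>k0. 3 * K\<^sup>2 * scale k < r" using scale_eventually_less[OF r(1)] by blast
    show ?thesis
    proof (intro exI[of _ k0] allI impI ballI)
      fix k y assume k: "k0 \<le> k" and "y \<in> cell k x"
      then have "y \<in> B x r" using cell_subset_ball[OF x, of k] B_mono[of "3 * K\<^sup>2 * scale k" r x] k0 by fastforce
      then show "\<bar>\<phi> y - \<phi> x\<bar> < e'" using r(2) by (auto simp: dist_real_def)
    qed
  qed
  then show "\<exists>\<phi>. integrable M \<phi> \<and> (\<integral>x. \<bar>h x - \<phi> x\<bar> \<partial>M) < e \<and>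
      (\<forall>x\<in>space M. \<forall>e'>0. \<exists>k0. \<forall>k\<ge>k0. \<forall>y\<in>cell k x. \<bar>\<phi> y - \<phi> x\<bar> < e')"
    using \<phi> by blast
qed

text \<open>The generation is the one with \<open>scale (Suc k) < r \<le> scale k\<close>; it exists
  because \<open>scale 0\<close> is twice the diameter.\<close>

lemma ball_in_cell:
  assumes x: "x \<in> space M" and r: "0 < r" "r < D"
  shows "\<exists>k. B x r \<subseteq> cell k x \<and> measure M (cell k x) \<le> G * measure M (B x r)"
proof -
  obtain k0 where k0: "\<forall>k\<ge>k0. 1 * scale k < r" using scale_eventually_less[OF r(1)] by blast
  define k where "k = (LEAST k. scale (Suc k) < r)"
  have k: "scale (Suc k) < r" unfolding k_def by (rule LeastI[of _ k0]) (use k0 in simp)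
  have k': "r \<le> scale k"
  proof (cases k)
    case 0
    then show ?thesis using r by (simp add: scale_def)
  next
    case (Suc i)
    then have "i < (LEAST k. scale (Suc k) < r)" by (simp add: k_def)
    then show ?thesis using not_less_Least[of i] Suc by (metis not_le)
  qed
  have "B x r \<subseteq> cell k x" using B_mono[OF k', of x] ball_subset_cell[OF x, of k] by blast
  moreover have "measure M (B x (scale (Suc k))) \<le> measure M (B x r)"
    using k by (intro measure_B_mono B_mono x) simp
  then have "G * measure M (B x (scale (Suc k))) \<le> G * measure M (B x r)" using G by (intro mult_left_mono) auto
  then have "measure M (cell k x) \<le> G * measure M (B x r)" using cell_le_ball[OF x, of k] by simp
  ultimately show ?thesis by blast
qed

text \<open>Since \<open>y\<close> is outside the next cell, it is outside the ball of radius
  \<open>scale (Suc k)\<close> around \<open>x\<close>. So the last cell at \<open>x\<close> that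
  contains \<open>y\<close> is comparable in measure with the ball in the kernel, which is how the
  potential is discretized.\<close>

lemma last_common_cell:
  assumes x: "x \<in> space M" and y: "y \<in> space M" "y \<noteq> x"
  shows "\<exists>k. y \<in> cell k x \<and> measure M (cell k x) \<le> G * measure M (B x (d x y))"
proof -
  have dpos: "0 < d x y" using d_zero[OF x y(1)] d_nonneg[OF x y(1)] y(2) by force
  obtain k0 where k0: "\<forall>k\<ge>k0. 3 * K\<^sup>2 * scale k < d x y" using scale_eventually_less[OF dpos] by blast
  have "y \<notin> cell (Suc k0) x"
    using cell_subset_ball[OF x, of "Suc k0"] k0[rule_format, of "Suc k0"] by (auto simp: qball_def)
  define k where "k = (LEAST k. y \<notin> cell (Suc k) x)"
  have k: "y \<notin> cell (Suc k) x" unfolding k_def by (rule LeastI[of _ k0]) fact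
  have "y \<in> cell k x"
  proof (cases k)
    case 0
    then show ?thesis using cell_0'[OF x] y by simp
  next
    case (Suc i)
    then have "i < (LEAST k. y \<notin> cell (Suc k) x)" by (simp add: k_def)
    then show ?thesis using not_less_Least[of i] Suc by blast
  qed
  moreover have "scale (Suc k) \<le> d x y"
    using k ball_subset_cell[OF x, of "Suc k"] y by (fastforce simp: qball_def)
  then have "measure M (B x (scale (Suc k))) \<le> measure M (B x (d x y))"
    by (intro measure_B_mono B_mono x)
  then have "G * measure M (B x (scale (Suc k))) \<le> G * measure M (B x (d x y))" using G by (intro mult_left_mono) auto
  then have "measure M (cell k x) \<le> G * measure M (B x (d x y))" using cell_le_ball[OF x, of k] by simp
  ultimately show ?thesis by blast
qed

text \<open>The Morrey and BMO norms only see radii below the diameter, which the radius of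
  generation 0 exceeds.\<close>

lemma cell_is_ball:
  assumes x: "x \<in> space M" and k: "0 < k"
  shows "\<exists>z\<in>space M. \<exists>r>0. r < D \<and> cell k x = B z r"
proof -
  have "2 * K * scale k \<le> 2 * K ^ 5 * scale 1"
    using scale_antimono[of 1 k] k K_power_mono[of 1 5] K scale_pos[of k] by (intro mult_mono) auto
  also have "\<dots> = D / 8" using scale_1 unfolding mult.assoc by linarith
  also have "\<dots> < D" using diam_pos by simp
  finally have "2 * K * scale k < D" .
  moreover have "0 < 2 * K * scale k" using K scale_pos[of k] by simp
  ultimately show ?thesis unfolding cell_def using net_map(2)[OF x] by blast
qed

end

section \<open>The majorant of the commutator\<close>

context cell_space begin

text \<open>At each \<open>y\<close> a single generation dominates the weight, and as all terms are
  nonnegative the sum over all generations dominates it too.\<close>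

lemma kernel_le_levels:
  assumes x: "x \<in> space M" and c0: "0 \<le> c0"
    and w: "\<And>y. 0 \<le> w y"
      "\<And>y. y \<in> space M \<Longrightarrow> w y \<noteq> 0 \<Longrightarrow> \<exists>k. y \<in> C k x \<and> w y \<le> c0 * measure M (C k x) powr (\<alpha> - 1)"
    and int: "integrable M (\<lambda>y. exp (- c y) * \<bar>f y\<bar>)"
    and summ: "summable (\<lambda>k. level \<alpha> c f k x)"
  shows "(\<integral>\<^sup>+y. ennreal (exp (c x - c y) * \<bar>f y\<bar> * w y) \<partial>M) \<le> ennreal (c0 * (\<Sum>k. level \<alpha> c f k x))"
proof -
  let ?h = "\<lambda>k y. ennreal (c0 * measure M (C k x) powr (\<alpha> - 1) * exp (c x)) *
    ennreal (indicator (C k x) y *\<^sub>R (exp (- c y) * \<bar>f y\<bar>))"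
  have term_le: "g k \<le> (\<Sum>k. g k)" for g :: "nat \<Rightarrow> ennreal" and k
    using sum_le_suminf[of g "{k}"] by simp
  have meas: "(\<lambda>y. ennreal (indicator (C k x) y *\<^sub>R (exp (- c y) * \<bar>f y\<bar>))) \<in> borel_measurable M" for k
    using integrable_mult_indicator[OF cell_sets[OF x, of k] int] by auto
  have "(\<integral>\<^sup>+y. ennreal (exp (c x - c y) * \<bar>f y\<bar> * w y) \<partial>M) \<le> (\<integral>\<^sup>+y. (\<Sum>k. ?h k y) \<partial>M)"
  proof (rule nn_integral_mono)
    fix y assume y: "y \<in> space M"
    show "ennreal (exp (c x - c y) * \<bar>f y\<bar> * w y) \<le> (\<Sum>k. ?h k y)"
    proof (cases "w y = 0")
      case False
      then obtain k where k: "y \<in> C k x" "w y \<le> c0 * measure M (C k x) powr (\<alpha> - 1)" using w(2)[OF y] by blast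
      have "exp (c x - c y) * \<bar>f y\<bar> * w y \<le> exp (c x - c y) * \<bar>f y\<bar> * (c0 * measure M (C k x) powr (\<alpha> - 1))"
        using k(2) by (intro mult_left_mono) auto
      also have "\<dots> = (c0 * measure M (C k x) powr (\<alpha> - 1) * exp (c x)) * (indicator (C k x) y *\<^sub>R (exp (- c y) * \<bar>f y\<bar>))"
        using k(1) by (simp add: exp_diff exp_minus field_simps)
      finally have "ennreal (exp (c x - c y) * \<bar>f y\<bar> * w y) \<le> ?h k y"
        using c0 by (subst ennreal_mult[symmetric]) (auto intro: ennreal_leI)
      also have "\<dots> \<le> (\<Sum>k. ?h k y)" by (rule term_le)
      finally show ?thesis .
    qed simp
  qed
  also have "\<dots> = (\<Sum>k. \<integral>\<^sup>+y. ?h k y \<partial>M)"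
    by (rule nn_integral_suminf) (intro borel_measurable_times_ennreal borel_measurable_const meas)
  also have "\<dots> = (\<Sum>k. ennreal (c0 * level \<alpha> c f k x))"
  proof (rule suminf_cong)
    fix k
    have "(\<integral>\<^sup>+y. ennreal (indicator (C k x) y *\<^sub>R (exp (- c y) * \<bar>f y\<bar>)) \<partial>M) = ennreal (LINT y:C k x|M. exp (- c y) * \<bar>f y\<bar>)"
      unfolding set_lebesgue_integral_def
      using integrable_mult_indicator[OF cell_sets[OF x, of k] int] by (intro nn_integral_eq_integral) auto
    then have "(\<integral>\<^sup>+y. ?h k y \<partial>M) = ennreal (c0 * measure M (C k x) powr (\<alpha> - 1) * exp (c x)) * ennreal (LINT y:C k x|M. exp (- c y) * \<bar>f y\<bar>)"
      using nn_integral_cmult[OF meas] by simp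
    also have "\<dots> = ennreal (c0 * level \<alpha> c f k x)"
      using c0 by (simp add: level_def mult.assoc flip: ennreal_mult')
    finally show "(\<integral>\<^sup>+y. ?h k y \<partial>M) = ennreal (c0 * level \<alpha> c f k x)" .
  qed
  also have "\<dots> = ennreal (\<Sum>k. c0 * level \<alpha> c f k x)"
    using c0 summ by (intro suminf_ennreal2 summable_mult mult_nonneg_nonneg level_nonneg)
  also have "(\<Sum>k. c0 * level \<alpha> c f k x) = c0 * (\<Sum>k. level \<alpha> c f k x)"
    by (rule suminf_mult[OF summ])
  finally show ?thesis .
qed

end

context bmo_function begin

lemma bmo_function_scaled:
  assumes \<kappa>: "0 < \<kappa>" and \<sigma>: "\<bar>\<sigma>\<bar> = \<kappa>"
  shows "bmo_function M C \<Gamma> \<beta> (\<lambda>y. \<sigma> * b y) (\<kappa> * K)"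
proof
  show "integrable M (\<lambda>y. \<sigma> * b y)" using b_integrable by simp
  show "0 < \<kappa> * K" using \<kappa> K by simp
  fix k x assume x: "x \<in> space M"
  have a: "avg k (\<lambda>y. \<sigma> * b y) x = \<sigma> * avg k b x" using avg_affine[OF b_integrable x, of k 0 \<sigma>] by simp
  have "avg k (\<lambda>y. \<bar>\<sigma> * b y - avg k (\<lambda>y. \<sigma> * b y) x\<bar>) x = avg k (\<lambda>y. 0 + \<kappa> * \<bar>b y - avg k b x\<bar>) x"
    unfolding a by (simp add: \<sigma>[symmetric] abs_mult flip: right_diff_distrib)
  also have "\<dots> = 0 + \<kappa> * avg k (\<lambda>y. \<bar>b y - avg k b x\<bar>) x"
    using b_integrable by (intro avg_affine x) auto
  also have "\<dots> \<le> \<kappa> * K" using oscillation[OF x, of k] \<kappa> by simp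
  finally show "avg k (\<lambda>y. \<bar>\<sigma> * b y - avg k (\<lambda>y. \<sigma> * b y) x\<bar>) x \<le> \<kappa> * K" .
qed

text \<open>The exponents are quantified inside, so that \<kappa> and \<open>A\<close> can be chosen
  before them and for both signs of \<open>\<sigma>\<close> at once.\<close>

definition level_bounds :: "real \<Rightarrow> real \<Rightarrow> real \<Rightarrow> real \<Rightarrow> real \<Rightarrow> real \<Rightarrow> bool" where
  "level_bounds s0 q l \<alpha> \<sigma> A \<longleftrightarrow> (\<forall>s t \<nu> N f.
    s0 \<le> s \<and> 0 < t \<and> t \<le> q \<and> 0 \<le> \<nu> \<and> \<nu> \<le> l \<and> 1 / s - 1 / t = \<alpha> / (1 - \<nu>) \<and> 0 \<le> N \<and> f \<in> borel_measurable M \<and>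
    (\<forall>k. \<forall>x\<in>space M. (\<integral>\<^sup>+y\<in>C k x. ennreal (\<bar>f y\<bar> powr s) \<partial>M) \<le> ennreal (measure M (C k x) powr \<nu> * N powr s)) \<longrightarrow>
    integrable M (\<lambda>y. exp (- (\<sigma> * b y)) * \<bar>f y\<bar>) \<and>
    (AE x in M. summable (\<lambda>k. level \<alpha> (\<lambda>y. \<sigma> * b y) f k x)) \<and>
    (\<forall>m. \<forall>z\<in>space M. (\<integral>\<^sup>+x\<in>C m z. ennreal ((\<Sum>k. level \<alpha> (\<lambda>y. \<sigma> * b y) f k x) powr t) \<partial>M)
      \<le> ennreal (A * (measure M (C m z) powr \<nu> * N powr t))))"

theorem exponential_level_bounds:
  assumes s0: "1 < s0" "s0 \<le> q" and l: "0 \<le> l" "l < 1" and \<alpha>: "0 < \<alpha>"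
  shows "\<exists>\<kappa>>0. \<exists>A\<ge>0. \<forall>\<sigma>\<in>{\<kappa>, - \<kappa>}. level_bounds s0 q l \<alpha> \<sigma> A"
proof -
  define m0 where "m0 = (1 + q) * (1 + s0) / (s0 - 1)"
  define g where "g = min \<alpha> ((1 - l) / q) / 2"
  \<comment> \<open>The first entry yields \<open>small_exp\<close> and the second
    \<open>small_step\<close> for the multiples of \<open>b\<close> by \<kappa> and its negative:
    both constraints are linear in the BMO constant, which becomes
    \<open>\<kappa> * K\<close>.\<close>
  define \<kappa> where "\<kappa> = min (ln (4 / 3) / (m0 * (2 * \<Lambda>))) (- ln \<beta> * g / (q * (\<Gamma>\<^sup>2 * K)))"
  have m0: "0 < m0" using s0 by (simp add: m0_def)
  have g: "0 < g" using \<alpha> l s0 by (simp add: g_def)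
  have d1: "0 < m0 * (2 * \<Lambda>)" using m0 \<Lambda>_pos by simp
  have d2: "0 < q * (\<Gamma>\<^sup>2 * K)" using s0 \<Gamma>_ge_1 K by (intro mult_pos_pos) auto
  have "0 < - ln \<beta> * g" using \<beta> g by (intro mult_pos_pos) auto
  then have "0 < - ln \<beta> * g / (q * (\<Gamma>\<^sup>2 * K))" using d2 by (rule divide_pos_pos)
  moreover have "0 < ln (4 / 3) / (m0 * (2 * \<Lambda>))" using d1 by (intro divide_pos_pos) simp_all
  ultimately have \<kappa>: "0 < \<kappa>" unfolding \<kappa>_def by (simp only: min_less_iff_conj)
  have k1: "\<kappa> * (m0 * (2 * \<Lambda>)) \<le> ln (4 / 3)"
    using pos_le_divide_eq[OF d1, of \<kappa> "ln (4 / 3)"] unfolding \<kappa>_def by (meson min.cobounded1)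
  have k2: "\<kappa> * (q * (\<Gamma>\<^sup>2 * K)) \<le> - ln \<beta> * g"
    using pos_le_divide_eq[OF d2, of \<kappa> "- ln \<beta> * g"] unfolding \<kappa>_def by (meson min.cobounded2)
  have loc: "small_bmo M C \<Gamma> \<beta> (\<lambda>y. \<sigma> * b y) (\<kappa> * K) s0 q l \<alpha>" if "\<sigma> \<in> {\<kappa>, - \<kappa>}" for \<sigma>
  proof -
    have "\<bar>\<sigma>\<bar> = \<kappa>" using that \<kappa> by auto
    then interpret S: bmo_function M C \<Gamma> \<beta> "\<lambda>y. \<sigma> * b y" "\<kappa> * K" by (rule bmo_function_scaled[OF \<kappa>])
    have L: "S.\<Lambda> = \<kappa> * \<Lambda>" by (simp add: S.\<Lambda>_def \<Lambda>_def)
    show ?thesis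
    proof
      show "(1 + q) * (1 + s0) / (s0 - 1) * (2 * S.\<Lambda>) \<le> ln (4 / 3)"
        using k1 unfolding L m0_def[symmetric] by (simp add: mult_ac)
      show "q * (\<Gamma>\<^sup>2 * (\<kappa> * K)) \<le> - ln \<beta> * (min \<alpha> ((1 - l) / q) / 2)"
        using k2 unfolding g_def[symmetric] by (simp add: mult_ac)
    qed (use s0 l \<alpha> in auto)
  qed
  show ?thesis
  proof (intro exI conjI)
    show "0 < \<kappa>" by (rule \<kappa>)
    \<comment> \<open>\<open>A3\<close> sees the function only through the bound
      \<open>\<kappa> * K\<close>, so both signs share it.\<close>
    show "0 \<le> small_bmo.A3 \<Gamma> \<beta> (\<kappa> * K) s0 q l \<alpha>" using small_bmo.A3_nonneg[OF loc[of \<kappa>]] by simp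
    show "\<forall>\<sigma>\<in>{\<kappa>, - \<kappa>}. level_bounds s0 q l \<alpha> \<sigma> (small_bmo.A3 \<Gamma> \<beta> (\<kappa> * K) s0 q l \<alpha>)"
      unfolding level_bounds_def
    proof (intro ballI allI impI, elim conjE)
      fix \<sigma> s t \<nu> N f
      assume \<sigma>: "\<sigma> \<in> {\<kappa>, - \<kappa>}" and h: "s0 \<le> s" "0 < t" "t \<le> q" "0 \<le> \<nu>" "\<nu> \<le> l" "1 / s - 1 / t = \<alpha> / (1 - \<nu>)"
        "0 \<le> N" "f \<in> borel_measurable M"
        "\<forall>k. \<forall>x\<in>space M. (\<integral>\<^sup>+y\<in>C k x. ennreal (\<bar>f y\<bar> powr s) \<partial>M) \<le> ennreal (measure M (C k x) powr \<nu> * N powr s)"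
      interpret D: morrey_data M C \<Gamma> \<beta> "\<lambda>y. \<sigma> * b y" "\<kappa> * K" s0 q l \<alpha> s t \<nu> N f
        by (intro morrey_data.intro loc \<sigma> morrey_data_axioms.intro) (use h in blast)+
      show "integrable M (\<lambda>y. exp (- (\<sigma> * b y)) * \<bar>f y\<bar>) \<and>
        (AE x in M. summable (\<lambda>k. level \<alpha> (\<lambda>y. \<sigma> * b y) f k x)) \<and>
        (\<forall>m. \<forall>z\<in>space M. (\<integral>\<^sup>+x\<in>C m z. ennreal ((\<Sum>k. level \<alpha> (\<lambda>y. \<sigma> * b y) f k x) powr t) \<partial>M)
          \<le> ennreal (small_bmo.A3 \<Gamma> \<beta> (\<kappa> * K) s0 q l \<alpha> * (measure M (C m z) powr \<nu> * N powr t)))"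
        using D.H_integrable D.level_sum_bound unfolding D.H_def[abs_def] by blast
    qed
  qed
qed

end

section \<open>Morrey and BMO norms over balls and over cells\<close>

lemma ennreal_powr_le:
  assumes "X \<le> ennreal (Y powr t)" "0 \<le> Y" "0 < t"
  shows "ennreal_powr X (1 / t) \<le> ennreal Y"
proof -
  have fin: "X \<noteq> \<infinity>" using assms(1) by (auto simp: top_unique)
  have "enn2real X \<le> Y powr t" using assms(1) enn2real_mono[OF assms(1)] by simp
  then have "enn2real X powr (1 / t) \<le> (Y powr t) powr (1 / t)" using assms by (intro powr_mono2) auto
  then show ?thesis using fin assms by (simp add: ennreal_powr_def powr_powr ennreal_leI)
qed

lemma le_of_ennreal_powr_le:
  assumes "ennreal_powr X (1 / t) \<le> ennreal Y" "0 \<le> Y" "0 < t"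
  shows "X \<le> ennreal (Y powr t)"
proof -
  have fin: "X \<noteq> \<infinity>" using assms(1) by (auto simp: ennreal_powr_def top_unique split: if_splits)
  then have "enn2real X powr (1 / t) \<le> Y" using assms by (simp add: ennreal_powr_def)
  then have "(enn2real X powr (1 / t)) powr t \<le> Y powr t" using assms by (intro powr_mono2) auto
  then have "enn2real X \<le> Y powr t" using assms by (simp add: powr_powr)
  then have "ennreal (enn2real X) \<le> ennreal (Y powr t)" by (rule ennreal_leI)
  then show ?thesis using ennreal_enn2real[of X] fin by (simp only: less_top infinity_ennreal_def)
qed

lemma morrey_norm_le:
  assumes "\<And>x r. x \<in> space M \<Longrightarrow> 0 < r \<Longrightarrow> r < qdiam M d \<Longrightarrow>
      ennreal (measure M (qball M d x r) powr (- \<nu>)) * (\<integral>\<^sup>+y\<in>qball M d x r. ennreal (\<bar>f y\<bar> powr s) \<partial>M) \<le> ennreal (N powr s)"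
    and "0 \<le> N" "0 < s"
  shows "morrey_norm M d s \<nu> f \<le> ennreal N"
  unfolding morrey_norm_def using assms by (intro SUP_least ennreal_powr_le) auto

context homogeneous_type_space_pos begin

lemma morrey_norm_ball:
  assumes "morrey_norm M d s \<nu> f \<le> ennreal N" and N: "0 \<le> N" "0 < s" and x: "x \<in> space M" "0 < r" "r < D"
  shows "(\<integral>\<^sup>+y\<in>B x r. ennreal (\<bar>f y\<bar> powr s) \<partial>M) \<le> ennreal (measure M (B x r) powr \<nu> * N powr s)"
proof -
  let ?I = "\<integral>\<^sup>+y\<in>B x r. ennreal (\<bar>f y\<bar> powr s) \<partial>M" and ?\<mu> = "measure M (B x r)"
  have "ennreal_powr (ennreal (?\<mu> powr - \<nu>) * ?I) (1 / s) \<le> morrey_norm M d s \<nu> f"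
    unfolding morrey_norm_def using x by (intro SUP_upper2[OF x(1)] SUP_upper) auto
  then have "ennreal (?\<mu> powr - \<nu>) * ?I \<le> ennreal (N powr s)"
    using assms(1) N by (intro le_of_ennreal_powr_le) auto
  then have "ennreal (?\<mu> powr \<nu>) * (ennreal (?\<mu> powr - \<nu>) * ?I) \<le> ennreal (?\<mu> powr \<nu>) * ennreal (N powr s)"
    by (intro mult_left_mono) auto
  moreover have "ennreal (?\<mu> powr \<nu>) * ennreal (?\<mu> powr - \<nu>) = 1"
    using measure_B_pos[OF x(1,2)] by (simp flip: ennreal_mult powr_add)
  ultimately show ?thesis by (simp add: ennreal_mult flip: mult.assoc)
qed

text \<open>A cell of generation \<open>0\<close> is the whole space, which is not one of the balls in the Morrey norm; it is
  covered by the cells of generation \<open>1\<close>.\<close>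

definition n1 :: real where "n1 = real (card (cell 1 ` space M))"

lemma finite_cells_1: "finite (cell 1 ` space M)"
proof -
  have "cell 1 ` space M = (\<lambda>z. B z (2 * K * scale 1)) ` net_map 1 ` space M" by (auto simp: cell_def)
  then show ?thesis using net_map(1)[of 1] by simp
qed

lemma n1: "space M \<noteq> {} \<Longrightarrow> 1 \<le> n1"
  using finite_cells_1 card_gt_0_iff[of "cell 1 ` space M"] by (simp add: n1_def Suc_le_eq)

lemma self_in_cell: "x \<in> space M \<Longrightarrow> x \<in> cell k x"
  using ball_subset_cell[of x k] d_zero[of x x] scale_pos[of k] by (auto simp: qball_def)

lemma morrey_norm_cell:
  assumes "morrey_norm M d s \<nu> f \<le> ennreal N" and N: "0 \<le> N" "1 \<le> s" and \<nu>: "0 \<le> \<nu>" and x: "x \<in> space M"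
    and f [measurable]: "f \<in> borel_measurable M"
  shows "(\<integral>\<^sup>+y\<in>cell k x. ennreal (\<bar>f y\<bar> powr s) \<partial>M) \<le> ennreal (measure M (cell k x) powr \<nu> * (n1 * N) powr s)"
proof -
  have n1: "1 \<le> n1" using x by (intro n1) auto
  have small: "(\<integral>\<^sup>+y\<in>cell k x. ennreal (\<bar>f y\<bar> powr s) \<partial>M) \<le> ennreal (measure M (cell k x) powr \<nu> * N powr s)"
    if h: "x \<in> space M" "0 < k" for k x
  proof -
    obtain z r where z: "z \<in> space M" "0 < r" "r < D" "cell k x = B z r" using cell_is_ball[OF h] by blast
    then show ?thesis using morrey_norm_ball[OF assms(1) N(1) _ z(1-3)] N(2) by simp
  qed
  have n1s: "n1 \<le> n1 powr s" using n1 N powr_mono[of 1 s n1] by simp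
  show ?thesis
  proof (cases "k = 0")
    case True
    have "(\<integral>\<^sup>+y\<in>cell k x. ennreal (\<bar>f y\<bar> powr s) \<partial>M) \<le> (\<integral>\<^sup>+y. (\<Sum>S\<in>cell 1 ` space M. ennreal (\<bar>f y\<bar> powr s) * indicator S y) \<partial>M)"
    proof (rule nn_integral_mono)
      fix y assume y: "y \<in> space M"
      have "ennreal (\<bar>f y\<bar> powr s) * indicator (cell k x) y \<le> ennreal (\<bar>f y\<bar> powr s) * indicator (cell 1 y) y"
        using self_in_cell[OF y, of 1] by (auto simp: indicator_def)
      also have "\<dots> \<le> (\<Sum>S\<in>cell 1 ` space M. ennreal (\<bar>f y\<bar> powr s) * indicator S y)"
        using y by (intro member_le_sum finite_cells_1) auto
      finally show "ennreal (\<bar>f y\<bar> powr s) * indicator (cell k x) y \<le> (\<Sum>S\<in>cell 1 ` space M. ennreal (\<bar>f y\<bar> powr s) * indicator S y)" .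
    qed
    also have "\<dots> = (\<Sum>S\<in>cell 1 ` space M. \<integral>\<^sup>+y\<in>S. ennreal (\<bar>f y\<bar> powr s) \<partial>M)"
      by (rule nn_integral_sum) (auto intro!: borel_measurable_times_ennreal borel_measurable_indicator cell_sets')
    also have "\<dots> \<le> (\<Sum>S\<in>cell 1 ` space M. ennreal (measure M (space M) powr \<nu> * N powr s))"
    proof (rule sum_mono)
      fix S assume "S \<in> cell 1 ` space M"
      then obtain z where z: "z \<in> space M" "S = cell 1 z" by blast
      have "(\<integral>\<^sup>+y\<in>S. ennreal (\<bar>f y\<bar> powr s) \<partial>M) \<le> ennreal (measure M S powr \<nu> * N powr s)"
        using small[OF z(1), of 1] z(2) by simp
      also have "\<dots> \<le> ennreal (measure M (space M) powr \<nu> * N powr s)"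
        using \<nu> by (intro ennreal_leI mult_right_mono powr_mono2 bounded_measure) auto
      finally show "(\<integral>\<^sup>+y\<in>S. ennreal (\<bar>f y\<bar> powr s) \<partial>M) \<le> ennreal (measure M (space M) powr \<nu> * N powr s)" .
    qed
    also have "\<dots> = ennreal (n1 * (measure M (space M) powr \<nu> * N powr s))"
      by (simp add: n1_def ennreal_of_nat_eq_real_of_nat flip: ennreal_mult)
    also have "\<dots> \<le> ennreal (measure M (cell k x) powr \<nu> * (n1 * N) powr s)"
    proof (rule ennreal_leI)
      have "n1 * (measure M (space M) powr \<nu> * N powr s) \<le> n1 powr s * (measure M (space M) powr \<nu> * N powr s)"
        using n1s by (intro mult_right_mono) auto
      then show "n1 * (measure M (space M) powr \<nu> * N powr s) \<le> measure M (cell k x) powr \<nu> * (n1 * N) powr s"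
        using True cell_0'[OF x] n1 N by (simp add: powr_mult mult_ac)
    qed
    finally show ?thesis .
  next
    case False
    have "N powr s \<le> (n1 * N) powr s" using n1 N mult_right_mono[of 1 n1 N] by (intro powr_mono2) auto
    then have "measure M (cell k x) powr \<nu> * N powr s \<le> measure M (cell k x) powr \<nu> * (n1 * N) powr s"
      by (intro mult_left_mono) auto
    then show ?thesis using small[OF x, of k] False by (auto intro: order_trans ennreal_leI)
  qed
qed

text \<open>Cells of positive generation are balls of admissible radius. The whole space is not, and
  its oscillation is bounded by twice the mean of \<open>|b|\<close>. The 1 in the constant makes it
  positive.\<close>

lemma bmo_function_cell:
  assumes b: "b \<in> BMO M d" and ne: "space M \<noteq> {}"
  shows "\<exists>K0. bmo_function M cell G (1 - 1 / G) b K0"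
proof -
  interpret cell_space M cell G "1 - 1 / G" by (rule cell_space_cell[OF ne])
  obtain x0 where x0: "x0 \<in> space M" using ne by blast
  have "set_integrable M (B x0 (2 * D)) b" using b x0 diam_pos by (simp add: BMO_def)
  then have int: "integrable M b"
    using B_space[OF x0, of "2 * D"] diam_pos unfolding set_integrable_def
    by (subst Bochner_Integration.integrable_cong[where g = "\<lambda>y. indicator (space M) y *\<^sub>R b y"]) auto
  have [measurable]: "b \<in> borel_measurable M" using int by auto
  define b0 where "b0 = enn2real (bmo_norm M d b)"
  have b0: "bmo_norm M d b = ennreal b0" "0 \<le> b0"
    using b by (auto simp: b0_def BMO_def)
  define A where "A = 2 * (\<integral>y. \<bar>b y\<bar> \<partial>M) / measure M (space M)"
  have A: "0 \<le> A" by (simp add: A_def)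
  have "avg k (\<lambda>y. \<bar>b y - avg k b x\<bar>) x \<le> 1 + b0 + A" if x: "x \<in> space M" for k x
  proof (cases "k = 0")
    case True
    have a: "avg 0 g x = (\<integral>y. g y \<partial>M) / measure M (space M)" if "integrable M g" for g :: "'a \<Rightarrow> real"
      using cell_0[OF x] set_integral_space[OF that] by (simp add: avg_def)
    have "avg 0 (\<lambda>y. \<bar>b y - avg 0 b x\<bar>) x \<le> avg 0 (\<lambda>y. \<bar>avg 0 b x\<bar> + 1 * \<bar>b y\<bar>) x"
      using int x by (intro avg_mono) auto
    also have "\<dots> = \<bar>avg 0 b x\<bar> + avg 0 (\<lambda>y. \<bar>b y\<bar>) x" using int x by (subst avg_affine) auto
    also have "\<bar>avg 0 b x\<bar> \<le> avg 0 (\<lambda>y. \<bar>b y\<bar>) x" using abs_avg_diff_le[OF int x, of 0 0] by simp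
    also have "avg 0 (\<lambda>y. \<bar>b y\<bar>) x + avg 0 (\<lambda>y. \<bar>b y\<bar>) x = A" using int by (simp add: a A_def)
    finally show ?thesis using True b0 by simp
  next
    case False
    then obtain z r where z: "z \<in> space M" "0 < r" "r < D" "cell k x = B z r" using cell_is_ball[OF x, of k] by blast
    have avg_eq: "avg k b x = ball_average M d b z r" by (simp add: avg_def ball_average_def z(4))
    let ?h = "\<lambda>y. \<bar>b y - avg k b x\<bar>"
    have "(\<integral>\<^sup>+y\<in>B z r. ennreal \<bar>b y - ball_average M d b z r\<bar> \<partial>M) / emeasure M (B z r) \<le> bmo_norm M d b"
      unfolding bmo_norm_def using z by (intro SUP_upper2[OF z(1)] SUP_upper) auto
    moreover have "(\<integral>\<^sup>+y\<in>B z r. ennreal \<bar>b y - ball_average M d b z r\<bar> \<partial>M) = ennreal (LINT y:cell k x|M. ?h y)"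
    proof -
      have "(\<integral>\<^sup>+y\<in>B z r. ennreal \<bar>b y - ball_average M d b z r\<bar> \<partial>M) = (\<integral>\<^sup>+y. ennreal (indicator (cell k x) y *\<^sub>R ?h y) \<partial>M)"
        unfolding avg_eq z(4) by (intro nn_integral_cong) (auto simp: indicator_def)
      also have "\<dots> = ennreal (LINT y:cell k x|M. ?h y)"
        unfolding set_lebesgue_integral_def
        using set_integrable_cell[of ?h x k] int x by (intro nn_integral_eq_integral) (auto simp: set_integrable_def)
      finally show ?thesis .
    qed
    ultimately have "ennreal (LINT y:cell k x|M. ?h y) / ennreal (measure M (cell k x)) \<le> ennreal b0"
      unfolding b0 by (simp add: z(4) emeasure_eq_measure)
    moreover have "0 \<le> (LINT y:cell k x|M. ?h y)"
      unfolding set_lebesgue_integral_def by (intro integral_nonneg_AE) auto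
    ultimately have "avg k ?h x \<le> b0"
      using cell_pos[OF x, of k] b0 by (simp add: avg_def divide_ennreal)
    then show ?thesis using A by simp
  qed
  then show ?thesis using int b0 A
    by (intro exI[of _ "1 + b0 + A"] bmo_function.intro bmo_function_axioms.intro cell_space_cell[OF ne]) auto
qed

end

text \<open>One of the two exponents is nonnegative. The second bound dominates the potential of
  \<open>f\<close> itself, so that integrability comes out together with the bound on the
  commutator.\<close>

lemma abs_le_exp_sum:
  assumes "0 < \<kappa>"
  shows "\<bar>u\<bar> \<le> (exp (\<kappa> * u) + exp (- \<kappa> * u)) / (\<kappa> :: real)" "1 \<le> exp (\<kappa> * u) + exp (- \<kappa> * u)"
proof -
  define v where "v = \<kappa> * u"
  have v: "exp (\<kappa> * u) = exp v" "exp (- \<kappa> * u) = exp (- v)" by (simp_all add: v_def)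
  have e: "1 + v \<le> exp v" "1 + - v \<le> exp (- v)" by (rule exp_ge_add_one_self)+
  have p: "0 < exp v" "0 < exp (- v)" by simp_all
  have "\<kappa> * \<bar>u\<bar> = v \<or> \<kappa> * \<bar>u\<bar> = - v" by (cases "0 \<le> u") (auto simp: v_def)
  then have "\<kappa> * \<bar>u\<bar> \<le> exp v + exp (- v)" using e p by linarith
  then show "\<bar>u\<bar> \<le> (exp (\<kappa> * u) + exp (- \<kappa> * u)) / \<kappa>"
    unfolding v using assms by (simp add: pos_le_divide_eq mult.commute)
  have "0 \<le> v \<or> 0 \<le> - v" by linarith
  then show "1 \<le> exp (\<kappa> * u) + exp (- \<kappa> * u)" unfolding v using e p by linarith
qed

context homogeneous_type_space_pos begin

section \<open>The kernel of the potential and its discretization\<close>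

definition kernel :: "real \<Rightarrow> 'a \<Rightarrow> 'a \<Rightarrow> real" where
  "kernel \<alpha> x y = 1 / measure M (B x (d x y)) powr (1 - \<alpha>)"

lemma potential_integrand_eq: "potential_integrand M d \<alpha> f x y = f y * kernel \<alpha> x y"
  by (simp add: potential_integrand_def kernel_def)

lemma kernel_nonneg: "0 \<le> kernel \<alpha> x y" by (simp add: kernel_def)

text \<open>Balls are the sublevel sets of \<open>d x\<close>, and the measure of a ball around the
  fixed \<open>x\<close> is a monotone function of the radius.\<close>

lemma kernel_measurable:
  assumes x: "x \<in> space M"
  shows "kernel \<alpha> x \<in> borel_measurable M"
proof -
  have "d x \<in> borel_measurable M"
    unfolding borel_measurable_iff_less using B_sets[OF x] by (auto simp: qball_def)
  moreover have "(\<lambda>r. measure M (B x r)) \<in> borel_measurable borel"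
    by (intro borel_measurable_mono monoI measure_B_mono B_mono x)
  ultimately have [measurable]: "(\<lambda>y. measure M (B x (d x y))) \<in> borel_measurable M"
    by (rule measurable_compose)
  show ?thesis unfolding kernel_def[abs_def] by measurable
qed

lemma kernel_le_cell:
  assumes x: "x \<in> space M" and y: "y \<in> space M" and \<alpha>: "\<alpha> < 1" and nz: "kernel \<alpha> x y \<noteq> 0"
  shows "\<exists>k. y \<in> cell k x \<and> kernel \<alpha> x y \<le> G powr (1 - \<alpha>) * measure M (cell k x) powr (\<alpha> - 1)"
proof -
  \<comment> \<open>At \<open>y = x\<close> the ball is empty and the kernel is 0 by convention,
    which \<open>nz\<close> excludes.\<close>
  have "y \<noteq> x"
  proof
    assume "y = x"
    then have "B x (d x y) = {}" using d_zero[OF x x] d_nonneg[OF x] by (force simp: qball_def not_less)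
    then show False using nz by (simp add: kernel_def)
  qed
  then obtain k where k: "y \<in> cell k x" "measure M (cell k x) \<le> G * measure M (B x (d x y))"
    using last_common_cell[OF x y] by blast
  have pos: "0 < measure M (cell k x)"
    unfolding cell_def using K scale_pos[of k] x by (intro measure_B_pos net_map) auto
  have "kernel \<alpha> x y = measure M (B x (d x y)) powr (\<alpha> - 1)"
    by (simp add: kernel_def powr_minus_divide[symmetric])
  also have "\<dots> \<le> (measure M (cell k x) / G) powr (\<alpha> - 1)"
    using k(2) pos G \<alpha> by (intro powr_mono2') (auto simp: divide_le_eq mult.commute)
  also have "\<dots> = G powr (1 - \<alpha>) * measure M (cell k x) powr (\<alpha> - 1)"
    using powr_minus_divide[of G "\<alpha> - 1"] G by (simp add: powr_divide)
  finally show ?thesis using k(1) by blast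
qed

text \<open>Stated for arbitrary functions because it is applied to the commutator, whose
  measurability is derived only under joint measurability of \<open>d\<close>.\<close>

lemma morrey_norm_mono_AE:
  assumes "AE x in M. \<bar>f x\<bar> \<le> \<bar>g x\<bar>" "0 < s"
  shows "morrey_norm M d s \<nu> f \<le> morrey_norm M d s \<nu> g"
proof (cases "morrey_norm M d s \<nu> g")
  case (real N)
  show ?thesis unfolding real
  proof (rule morrey_norm_le)
    fix x r assume x: "x \<in> space M" "0 < r" "r < D"
    have "(\<integral>\<^sup>+y\<in>B x r. ennreal (\<bar>f y\<bar> powr s) \<partial>M) \<le> (\<integral>\<^sup>+y\<in>B x r. ennreal (\<bar>g y\<bar> powr s) \<partial>M)"
      using assms(1)
    proof (intro nn_integral_mono_AE, eventually_elim)
      case (elim y)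
      then show ?case using assms(2) by (intro mult_right_mono ennreal_leI powr_mono2) auto
    qed
    also have "\<dots> \<le> ennreal (measure M (B x r) powr \<nu> * N powr s)"
      using real assms(2) by (intro morrey_norm_ball x) auto
    finally have "ennreal (measure M (B x r) powr - \<nu>) * (\<integral>\<^sup>+y\<in>B x r. ennreal (\<bar>f y\<bar> powr s) \<partial>M)
        \<le> ennreal (measure M (B x r) powr - \<nu>) * ennreal (measure M (B x r) powr \<nu> * N powr s)"
      by (intro mult_left_mono) auto
    also have "\<dots> = ennreal ((measure M (B x r) powr - \<nu> * measure M (B x r) powr \<nu>) * N powr s)"
      by (simp add: mult.assoc flip: ennreal_mult)
    also have "measure M (B x r) powr - \<nu> * measure M (B x r) powr \<nu> = 1"
      using measure_B_pos[OF x(1,2)] by (simp flip: powr_add)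
    finally show "ennreal (measure M (B x r) powr - \<nu>) * (\<integral>\<^sup>+y\<in>B x r. ennreal (\<bar>f y\<bar> powr s) \<partial>M) \<le> ennreal (N powr s)"
      by simp
  qed (use real assms in auto)
qed simp

text \<open>Hoelder's inequality on a ball leaves the power
  \<open>e = 1 - \<nu> - (1 - \<nu>') * (s / t)\<close> of its measure. This exponent lies between 0
  and \<open>V\<close>, so the finite total measure bounds the power, and \<open>V\<close> makes the
  constant the same for a whole family of exponents.\<close>

lemma morrey_embedding:
  assumes J [measurable]: "J \<in> borel_measurable M" and s: "1 \<le> s" "s < t" and \<nu>: "\<nu> \<le> \<nu>'" "\<nu>' \<le> 1" "1 - \<nu> \<le> V"
    and N: "0 \<le> N" and le: "morrey_norm M d t \<nu>' J \<le> ennreal N"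
  shows "morrey_norm M d s \<nu> J \<le> ennreal (max 1 (measure M (space M)) powr V * N)"
proof (rule morrey_norm_le)
  fix x r assume x: "x \<in> space M" "0 < r" "r < D"
  let ?\<mu> = "measure M (B x r)"
  have pos: "0 < ?\<mu>" using x by (intro measure_B_pos)
  have [measurable]: "B x r \<in> sets M" using x by (intro B_sets)
  define Y where "Y = ?\<mu> powr ((\<nu>' - 1) * (s / t)) * N powr s"
  have "(\<integral>\<^sup>+y\<in>B x r. ennreal (\<bar>J y\<bar> powr s * 1) \<partial>M) \<le> ennreal (1 * Y * ?\<mu>)"
  proof (rule nn_integral_Holder_bound[where r = "t / s" and r' = "t / (t - s)"])
    show "1 < t / s" "1 < t / (t - s)" "1 / (t / s) + 1 / (t / (t - s)) = 1"
      using s by (auto simp: field_simps)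
    have "Y powr (t / s) * ?\<mu> = N powr t * (?\<mu> powr (\<nu>' - 1) * ?\<mu> powr 1)"
      using s N pos by (simp add: Y_def powr_mult powr_powr)
    also have "?\<mu> powr (\<nu>' - 1) * ?\<mu> powr 1 = ?\<mu> powr \<nu>'" by (simp only: powr_add[symmetric]) simp
    finally have "Y powr (t / s) * ?\<mu> = ?\<mu> powr \<nu>' * N powr t" by simp
    moreover have "(\<bar>J y\<bar> powr s) powr (t / s) = \<bar>J y\<bar> powr t" for y using s by (simp add: powr_powr)
    ultimately show "(\<integral>\<^sup>+y\<in>B x r. ennreal ((\<bar>J y\<bar> powr s) powr (t / s)) \<partial>M) \<le> ennreal (Y powr (t / s) * ?\<mu>)"
      using morrey_norm_ball[OF le N _ x] s by simp
    show "(\<integral>\<^sup>+y\<in>B x r. ennreal (1 powr (t / (t - s))) \<partial>M) \<le> ennreal (1 * ?\<mu>)"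
      by (simp add: emeasure_eq_measure)
  qed (use pos N in \<open>auto simp: Y_def\<close>)
  then have "ennreal (?\<mu> powr - \<nu>) * (\<integral>\<^sup>+y\<in>B x r. ennreal (\<bar>J y\<bar> powr s) \<partial>M) \<le> ennreal (?\<mu> powr - \<nu>) * ennreal (Y * ?\<mu>)"
    by (intro mult_left_mono) auto
  also have "\<dots> = ennreal ((?\<mu> powr - \<nu> * ?\<mu> powr ((\<nu>' - 1) * (s / t)) * ?\<mu> powr 1) * N powr s)"
    using pos by (simp add: Y_def mult_ac flip: ennreal_mult)
  also have "\<dots> \<le> ennreal ((max 1 (measure M (space M)) powr V * N) powr s)"
  proof (rule ennreal_leI)
    define e where "e = - \<nu> + (\<nu>' - 1) * (s / t) + 1"
    have st: "0 \<le> s / t" "s / t \<le> 1" using s by auto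
    have "(1 - \<nu>') * (s / t) \<le> 1 - \<nu>'" using st \<nu> by (intro mult_left_le) auto
    moreover have "- \<nu> + (\<nu>' - 1) * r + 1 = 1 - \<nu> - (1 - \<nu>') * r" for r by (simp add: algebra_simps)
    then have "e = 1 - \<nu> - (1 - \<nu>') * (s / t)" unfolding e_def .
    moreover have "0 \<le> 1 - \<nu> - w" if "w \<le> 1 - \<nu>'" for w using that \<nu> by linarith
    ultimately have e0: "0 \<le> e" by simp
    have "(\<nu>' - 1) * (s / t) \<le> 0" using st \<nu> by (intro mult_nonpos_nonneg) auto
    then have eV: "e \<le> V" using \<nu> by (simp add: e_def)
    have "?\<mu> powr - \<nu> * ?\<mu> powr ((\<nu>' - 1) * (s / t)) * ?\<mu> powr 1 = ?\<mu> powr e"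
      by (simp only: e_def powr_add[symmetric])
    also have "\<dots> \<le> max 1 (measure M (space M)) powr e"
      using e0 bounded_measure[of "B x r"] by (intro powr_mono2) auto
    also have "\<dots> \<le> max 1 (measure M (space M)) powr V" using eV by (intro powr_mono) auto
    finally have 1: "?\<mu> powr - \<nu> * ?\<mu> powr ((\<nu>' - 1) * (s / t)) * ?\<mu> powr 1 \<le> max 1 (measure M (space M)) powr V" .
    define W where "W = max 1 (measure M (space M)) powr V"
    have W: "1 \<le> W" unfolding W_def using e0 eV by (intro ge_one_powr_ge_zero) auto
    then have "W \<le> W powr s" using s powr_mono[of 1 s W] by simp
    with 1 have "?\<mu> powr - \<nu> * ?\<mu> powr ((\<nu>' - 1) * (s / t)) * ?\<mu> powr 1 \<le> W powr s" unfolding W_def by linarith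
    then have "(?\<mu> powr - \<nu> * ?\<mu> powr ((\<nu>' - 1) * (s / t)) * ?\<mu> powr 1) * N powr s \<le> W powr s * N powr s"
      by (intro mult_right_mono) auto
    then show "(?\<mu> powr - \<nu> * ?\<mu> powr ((\<nu>' - 1) * (s / t)) * ?\<mu> powr 1) * N powr s \<le> (max 1 (measure M (space M)) powr V * N) powr s"
      using N W by (simp add: powr_mult W_def)
  qed
  finally show "ennreal (?\<mu> powr - \<nu>) * (\<integral>\<^sup>+y\<in>B x r. ennreal (\<bar>J y\<bar> powr s) \<partial>M)
      \<le> ennreal ((max 1 (measure M (space M)) powr V * N) powr s)" .
qed (use N s in auto)

text \<open>The order of the quantifiers is the point: \<open>A\<close> comes before
  \<open>f\<close>, and \<open>J\<close> before the exponents, because the grand norm takes a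
  supremum over exponents for one fixed function.\<close>

theorem commutator_majorant:
  assumes b: "b \<in> BMO M d" and ne: "space M \<noteq> {}"
    and s0: "1 < s0" "s0 \<le> q" and l: "0 \<le> l" "l < 1" and \<alpha>: "0 < \<alpha>" "\<alpha> < 1"
  shows "\<exists>A\<ge>0. \<forall>f\<in>borel_measurable M. \<exists>J\<in>borel_measurable M. \<forall>s t \<nu>.
    s0 \<le> s \<and> 0 < t \<and> t \<le> q \<and> 0 \<le> \<nu> \<and> \<nu> \<le> l \<and> 1 / s - 1 / t = \<alpha> / (1 - \<nu>) \<and> morrey_norm M d s \<nu> f < \<infinity> \<longrightarrow>
    (AE x in M. integrable M (potential_integrand M d \<alpha> f x) \<and>
      integrable M (potential_integrand M d \<alpha> (\<lambda>y. b y * f y) x) \<and>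
      \<bar>commutator b (potential M d \<alpha>) f x\<bar> \<le> J x) \<and>
    morrey_norm M d t \<nu> J \<le> ennreal A * morrey_norm M d s \<nu> f"
proof -
  obtain K0 where "bmo_function M cell G (1 - 1 / G) b K0" using bmo_function_cell[OF b ne] by blast
  then interpret S: bmo_function M cell G "1 - 1 / G" b K0 .
  obtain \<kappa> A where \<kappa>: "0 < \<kappa>" and A: "0 \<le> A"
    and core: "\<And>\<sigma>. \<sigma> \<in> {\<kappa>, - \<kappa>} \<Longrightarrow> S.level_bounds s0 q l \<alpha> \<sigma> A"
    using S.exponential_level_bounds[OF s0 l \<alpha>(1)] by blast
  define c where "c = G powr (1 - \<alpha>) / \<kappa>"
  have c: "0 < c" using G \<kappa> by (simp add: c_def)
  have [measurable]: "b \<in> borel_measurable M" using b by (simp add: BMO_def)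
  \<comment> \<open>With \<open>1 + 2 * A * G\<close> in place of \<open>2 * A * G\<close> the
    factor is at least 1, hence below its own \<open>t\<close>-th power for every
    \<open>t > 1\<close>.\<close>
  define A' where "A' = 2 * c * (1 + 2 * A * G) * n1"
  have A'0: "0 \<le> A'" using c A G n1[OF ne] by (simp add: A'_def)
  show ?thesis
  proof (intro exI[of _ A'] conjI A'0 ballI)
    fix f :: "'a \<Rightarrow> real" assume f [measurable]: "f \<in> borel_measurable M"
    define L where "L = (\<lambda>\<sigma> x. \<Sum>k. S.level \<alpha> (\<lambda>y. \<sigma> * b y) f k x)"
    have L_meas [measurable]: "L \<sigma> \<in> borel_measurable M" for \<sigma> unfolding L_def by measurable
    \<comment> \<open>The absolute values keep \<open>J\<close> nonnegative also where a series
      diverges and its sum means nothing.\<close>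
    define J where "J = (\<lambda>x. c * (\<bar>L \<kappa> x\<bar> + \<bar>L (- \<kappa>) x\<bar>))"
    have J_meas [measurable]: "J \<in> borel_measurable M" unfolding J_def by measurable
    have J0: "0 \<le> J x" for x using c by (simp add: J_def)
    show "\<exists>J\<in>borel_measurable M. \<forall>s t \<nu>.
      s0 \<le> s \<and> 0 < t \<and> t \<le> q \<and> 0 \<le> \<nu> \<and> \<nu> \<le> l \<and> 1 / s - 1 / t = \<alpha> / (1 - \<nu>) \<and> morrey_norm M d s \<nu> f < \<infinity> \<longrightarrow>
      (AE x in M. integrable M (potential_integrand M d \<alpha> f x) \<and>
        integrable M (potential_integrand M d \<alpha> (\<lambda>y. b y * f y) x) \<and>
        \<bar>commutator b (potential M d \<alpha>) f x\<bar> \<le> J x) \<and>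
      morrey_norm M d t \<nu> J \<le> ennreal A' * morrey_norm M d s \<nu> f"
    proof (intro bexI[OF _ J_meas] allI impI, elim conjE)
      fix s t \<nu>
      assume h: "s0 \<le> s" "0 < t" "t \<le> q" "0 \<le> \<nu>" "\<nu> \<le> l" "1 / s - 1 / t = \<alpha> / (1 - \<nu>)"
        and fin: "morrey_norm M d s \<nu> f < \<infinity>"
      define N where "N = enn2real (morrey_norm M d s \<nu> f)"
      have N: "morrey_norm M d s \<nu> f = ennreal N" "0 \<le> N" using fin by (auto simp: N_def)
      have s1: "1 < s" using h s0 by simp
      have "0 < \<alpha> / (1 - \<nu>)" using h l \<alpha> by simp
      then have "1 / t < 1 / s" using h by simp
      then have t1: "1 < t" using h s1 by (simp add: field_simps)
      have pre: "s0 \<le> s \<and> 0 < t \<and> t \<le> q \<and> 0 \<le> \<nu> \<and> \<nu> \<le> l \<and> 1 / s - 1 / t = \<alpha> / (1 - \<nu>) \<and> 0 \<le> n1 * N \<and> f \<in> borel_measurable M \<and>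
        (\<forall>k. \<forall>x\<in>space M. (\<integral>\<^sup>+y\<in>cell k x. ennreal (\<bar>f y\<bar> powr s) \<partial>M) \<le> ennreal (measure M (cell k x) powr \<nu> * (n1 * N) powr s))"
        using h N n1[OF ne] s1 f by (auto intro!: morrey_norm_cell)
      note core' = core[unfolded S.level_bounds_def, rule_format, OF _ pre]
      note core_pos = core'[OF insertI1] and core_neg = core'[OF insertI2[OF singletonI]]
      have summ: "AE x in M. summable (\<lambda>k. S.level \<alpha> (\<lambda>y. \<kappa> * b y) f k x)"
        "AE x in M. summable (\<lambda>k. S.level \<alpha> (\<lambda>y. - \<kappa> * b y) f k x)"
        using core_pos core_neg by auto
      have "AE x in M. integrable M (potential_integrand M d \<alpha> f x) \<and>
        integrable M (potential_integrand M d \<alpha> (\<lambda>y. b y * f y) x) \<and>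
        \<bar>commutator b (potential M d \<alpha>) f x\<bar> \<le> J x"
        using AE_space summ
      proof eventually_elim
        case (elim x)
        then have x: "x \<in> space M" by simp
        note [measurable] = kernel_measurable[OF x, of \<alpha>]
        let ?w = "kernel \<alpha> x"
        have lev: "(\<integral>\<^sup>+y. ennreal (exp (\<sigma> * b x - \<sigma> * b y) * \<bar>f y\<bar> * ?w y) \<partial>M) \<le> ennreal (G powr (1 - \<alpha>) * \<bar>L \<sigma> x\<bar>)"
          if "integrable M (\<lambda>y. exp (- (\<sigma> * b y)) * \<bar>f y\<bar>)" "summable (\<lambda>k. S.level \<alpha> (\<lambda>y. \<sigma> * b y) f k x)" for \<sigma>
        proof -
          have "(\<integral>\<^sup>+y. ennreal (exp (\<sigma> * b x - \<sigma> * b y) * \<bar>f y\<bar> * ?w y) \<partial>M) \<le> ennreal (G powr (1 - \<alpha>) * L \<sigma> x)"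
            unfolding L_def
            by (rule S.kernel_le_levels[where c = "\<lambda>y. \<sigma> * b y", OF x _ kernel_nonneg kernel_le_cell[OF x _ \<alpha>(2)] that]) auto
          also have "\<dots> \<le> ennreal (G powr (1 - \<alpha>) * \<bar>L \<sigma> x\<bar>)" by (intro ennreal_leI mult_left_mono) auto
          finally show ?thesis .
        qed
        let ?E = "\<lambda>y. exp (\<kappa> * (b x - b y)) + exp (- \<kappa> * (b x - b y))"
        have E_bd: "(\<integral>\<^sup>+y. ennreal (?E y * (\<bar>f y\<bar> * ?w y)) \<partial>M) \<le> ennreal (\<kappa> * J x)"
        proof -
          have "(\<integral>\<^sup>+y. ennreal (?E y * (\<bar>f y\<bar> * ?w y)) \<partial>M)
            = (\<integral>\<^sup>+y. ennreal (exp (\<kappa> * b x - \<kappa> * b y) * \<bar>f y\<bar> * ?w y) + ennreal (exp (- \<kappa> * b x - - \<kappa> * b y) * \<bar>f y\<bar> * ?w y) \<partial>M)"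
            using kernel_nonneg[of \<alpha> x]
            by (intro nn_integral_cong) (simp add: algebra_simps flip: ennreal_plus)
          also have "\<dots> = (\<integral>\<^sup>+y. ennreal (exp (\<kappa> * b x - \<kappa> * b y) * \<bar>f y\<bar> * ?w y) \<partial>M)
              + (\<integral>\<^sup>+y. ennreal (exp (- \<kappa> * b x - - \<kappa> * b y) * \<bar>f y\<bar> * ?w y) \<partial>M)"
            by (rule nn_integral_add) measurable
          also have "\<dots> \<le> ennreal (G powr (1 - \<alpha>) * \<bar>L \<kappa> x\<bar>) + ennreal (G powr (1 - \<alpha>) * \<bar>L (- \<kappa>) x\<bar>)"
            using core_pos core_neg elim by (intro add_mono lev) auto
          also have "\<dots> = ennreal (\<kappa> * J x)"
            using \<kappa> by (simp add: J_def c_def algebra_simps flip: ennreal_plus)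
          finally show ?thesis .
        qed
        \<comment> \<open>Used twice: \<open>h = 1\<close> gives integrability for the potential of
          \<open>f\<close>, and \<open>h y = b x - b y\<close> gives it for the commutator together
          with the bound by \<open>J\<close>.\<close>
        have dom: "(\<integral>\<^sup>+y. ennreal (norm (h y * (f y * ?w y))) \<partial>M) \<le> ennreal (R * (\<kappa> * J x))"
          if "\<And>y. \<bar>h y\<bar> \<le> R * ?E y" "0 \<le> R" for h R
        proof -
          have "(\<integral>\<^sup>+y. ennreal (norm (h y * (f y * ?w y))) \<partial>M) \<le> (\<integral>\<^sup>+y. ennreal R * ennreal (?E y * (\<bar>f y\<bar> * ?w y)) \<partial>M)"
          proof (rule nn_integral_mono)
            fix y
            have "norm (h y * (f y * ?w y)) = \<bar>h y\<bar> * (\<bar>f y\<bar> * ?w y)"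
              using kernel_nonneg[of \<alpha> x y] by (simp add: abs_mult)
            also have "\<dots> \<le> (R * ?E y) * (\<bar>f y\<bar> * ?w y)"
              using that(1)[of y] kernel_nonneg[of \<alpha> x y] by (intro mult_right_mono mult_nonneg_nonneg) auto
            finally have "norm (h y * (f y * ?w y)) \<le> R * (?E y * (\<bar>f y\<bar> * ?w y))" by (simp only: mult.assoc)
            then show "ennreal (norm (h y * (f y * ?w y))) \<le> ennreal R * ennreal (?E y * (\<bar>f y\<bar> * ?w y))"
              using that(2) by (simp only: ennreal_mult'[symmetric]) (rule ennreal_leI)
          qed
          also have "\<dots> = ennreal R * (\<integral>\<^sup>+y. ennreal (?E y * (\<bar>f y\<bar> * ?w y)) \<partial>M)"
            by (rule nn_integral_cmult) measurable
          also have "\<dots> \<le> ennreal R * ennreal (\<kappa> * J x)" by (intro mult_left_mono E_bd) simp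
          also have "\<dots> = ennreal (R * (\<kappa> * J x))" using that(2) by (simp only: ennreal_mult')
          finally show ?thesis .
        qed
        have d1: "(\<integral>\<^sup>+y. ennreal (norm (1 * (f y * ?w y))) \<partial>M) \<le> ennreal (1 * (\<kappa> * J x))"
          using abs_le_exp_sum(2)[OF \<kappa>] by (intro dom) auto
        have d2: "(\<integral>\<^sup>+y. ennreal (norm ((b x - b y) * (f y * ?w y))) \<partial>M) \<le> ennreal (1 / \<kappa> * (\<kappa> * J x))"
          using abs_le_exp_sum(1)[OF \<kappa>] \<kappa> by (intro dom) auto
        have i1: "integrable M (\<lambda>y. f y * ?w y)"
          using d1 by (intro integrableI_bounded) (auto intro: le_less_trans)
        have i2: "integrable M (\<lambda>y. (b x - b y) * (f y * ?w y))"
          using d2 by (intro integrableI_bounded) (auto intro: le_less_trans)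
        have i3: "integrable M (\<lambda>y. b y * f y * ?w y)"
        proof -
          have "integrable M (\<lambda>y. b x * (f y * ?w y) - (b x - b y) * (f y * ?w y))" using i1 i2 by simp
          then show ?thesis by (simp add: algebra_simps)
        qed
        have "commutator b (potential M d \<alpha>) f x = b x * (\<integral>y. f y * ?w y \<partial>M) - (\<integral>y. b y * f y * ?w y \<partial>M)"
          by (simp add: commutator_def potential_def potential_integrand_eq)
        also have "\<dots> = (\<integral>y. b x * (f y * ?w y) - b y * f y * ?w y \<partial>M)"
          using i1 i3 by simp
        also have "\<dots> = (\<integral>y. (b x - b y) * (f y * ?w y) \<partial>M)"
          by (intro Bochner_Integration.integral_cong) (auto simp: algebra_simps)
        finally have "ennreal \<bar>commutator b (potential M d \<alpha>) f x\<bar> \<le> (\<integral>\<^sup>+y. ennreal (norm ((b x - b y) * (f y * ?w y))) \<partial>M)"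
          using integral_norm_bound_ennreal[OF i2] by simp
        also have "\<dots> \<le> ennreal (J x)" using d2 \<kappa> by simp
        finally have "\<bar>commutator b (potential M d \<alpha>) f x\<bar> \<le> J x" using J0 by simp
        then show ?case using i1 i3 by (simp add: potential_integrand_eq[abs_def])
      qed
      moreover have "morrey_norm M d t \<nu> J \<le> ennreal A' * morrey_norm M d s \<nu> f"
      proof -
          have Lbd: "(\<integral>\<^sup>+x\<in>cell m z. ennreal (\<bar>L \<sigma> x\<bar> powr t) \<partial>M) \<le> ennreal (A * (measure M (cell m z) powr \<nu> * (n1 * N) powr t))"
            if "\<sigma> \<in> {\<kappa>, - \<kappa>}" "z \<in> space M" for m z \<sigma>
          proof -
            have "AE x in M. summable (\<lambda>k. S.level \<alpha> (\<lambda>y. \<sigma> * b y) f k x)" using core'[OF that(1)] by blast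
            then have "AE x in M. \<bar>L \<sigma> x\<bar> = L \<sigma> x"
              by eventually_elim (auto simp: L_def intro!: abs_of_nonneg suminf_nonneg S.level_nonneg)
            then have "AE x in M. ennreal (\<bar>L \<sigma> x\<bar> powr t) * indicator (cell m z) x = ennreal (L \<sigma> x powr t) * indicator (cell m z) x"
              by eventually_elim simp
            then have "(\<integral>\<^sup>+x\<in>cell m z. ennreal (\<bar>L \<sigma> x\<bar> powr t) \<partial>M) = (\<integral>\<^sup>+x\<in>cell m z. ennreal (L \<sigma> x powr t) \<partial>M)"
              by (rule nn_integral_cong_AE)
            then show ?thesis using core'[OF that(1)] that(2) by (simp add: L_def)
          qed
          have "morrey_norm M d t \<nu> J \<le> ennreal (A' * N)"
          proof (rule morrey_norm_le)
            fix x r assume x: "x \<in> space M" "0 < r" "r < D"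
            obtain k where k: "B x r \<subseteq> cell k x" "measure M (cell k x) \<le> G * measure M (B x r)"
              using ball_in_cell[OF x] by blast
            let ?\<mu> = "measure M (B x r)"
            have pos: "0 < ?\<mu>" using x by (intro measure_B_pos)
            have [measurable]: "cell k x \<in> sets M" using x by (intro cell_sets')
            have pw: "\<bar>J y\<bar> powr t \<le> (2 * c) powr t * (\<bar>L \<kappa> y\<bar> powr t + \<bar>L (- \<kappa>) y\<bar> powr t)" for y
            proof -
              let ?m = "max \<bar>L \<kappa> y\<bar> \<bar>L (- \<kappa>) y\<bar>"
              have "\<bar>J y\<bar> \<le> c * (?m + ?m)" unfolding abs_of_nonneg[OF J0] unfolding J_def
                using c by (intro mult_left_mono add_mono) auto
              then have "\<bar>J y\<bar> powr t \<le> (2 * c * ?m) powr t" using h by (intro powr_mono2) auto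
              also have "\<dots> = (2 * c) powr t * ?m powr t" using c by (simp add: powr_mult)
              also have "?m powr t \<le> \<bar>L \<kappa> y\<bar> powr t + \<bar>L (- \<kappa>) y\<bar> powr t" by (simp add: max_def)
              finally show ?thesis by (simp add: mult_left_mono)
            qed
            have "(\<integral>\<^sup>+y\<in>B x r. ennreal (\<bar>J y\<bar> powr t) \<partial>M)
                \<le> (\<integral>\<^sup>+y. ennreal ((2 * c) powr t) * (ennreal (\<bar>L \<kappa> y\<bar> powr t) * indicator (cell k x) y
                     + ennreal (\<bar>L (- \<kappa>) y\<bar> powr t) * indicator (cell k x) y) \<partial>M)"
            proof (rule nn_integral_mono)
              fix y
              have "ennreal (\<bar>J y\<bar> powr t) \<le> ennreal ((2 * c) powr t * (\<bar>L \<kappa> y\<bar> powr t + \<bar>L (- \<kappa>) y\<bar> powr t))"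
                by (rule ennreal_leI) (rule pw)
              also have "\<dots> = ennreal ((2 * c) powr t) * (ennreal (\<bar>L \<kappa> y\<bar> powr t) + ennreal (\<bar>L (- \<kappa>) y\<bar> powr t))"
                by (simp add: ennreal_mult)
              finally show "ennreal (\<bar>J y\<bar> powr t) * indicator (B x r) y
                \<le> ennreal ((2 * c) powr t) * (ennreal (\<bar>L \<kappa> y\<bar> powr t) * indicator (cell k x) y
                     + ennreal (\<bar>L (- \<kappa>) y\<bar> powr t) * indicator (cell k x) y)"
                using k(1) by (auto simp: indicator_def)
            qed
            also have "\<dots> = ennreal ((2 * c) powr t) * ((\<integral>\<^sup>+y\<in>cell k x. ennreal (\<bar>L \<kappa> y\<bar> powr t) \<partial>M)
                + (\<integral>\<^sup>+y\<in>cell k x. ennreal (\<bar>L (- \<kappa>) y\<bar> powr t) \<partial>M))"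
              by (subst nn_integral_cmult, measurable) (subst nn_integral_add, auto)
            also have "\<dots> \<le> ennreal ((2 * c) powr t) * (ennreal (A * (measure M (cell k x) powr \<nu> * (n1 * N) powr t))
                + ennreal (A * (measure M (cell k x) powr \<nu> * (n1 * N) powr t)))"
              using x by (intro mult_left_mono add_mono Lbd) auto
            also have "\<dots> = ennreal ((2 * c) powr t * (2 * A * (measure M (cell k x) powr \<nu> * (n1 * N) powr t)))"
              using A by (simp flip: ennreal_plus ennreal_mult)
            also have "\<dots> \<le> ennreal ((2 * c) powr t * (2 * A * ((G * ?\<mu> powr \<nu>) * (n1 * N) powr t)))"
            proof -
              have "measure M (cell k x) powr \<nu> \<le> (G * ?\<mu>) powr \<nu>" using k(2) h by (intro powr_mono2) auto
              also have "\<dots> = G powr \<nu> * ?\<mu> powr \<nu>" using G by (simp add: powr_mult)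
              also have "\<dots> \<le> G powr 1 * ?\<mu> powr \<nu>" using G h l by (intro mult_right_mono powr_mono) auto
              finally show ?thesis using A G by (intro ennreal_leI mult_left_mono mult_right_mono) auto
            qed
            finally have "ennreal (?\<mu> powr - \<nu>) * (\<integral>\<^sup>+y\<in>B x r. ennreal (\<bar>J y\<bar> powr t) \<partial>M)
                \<le> ennreal (?\<mu> powr - \<nu>) * ennreal ((2 * c) powr t * (2 * A * ((G * ?\<mu> powr \<nu>) * (n1 * N) powr t)))"
              by (intro mult_left_mono) auto
            also have "\<dots> = ennreal ((?\<mu> powr - \<nu> * ?\<mu> powr \<nu>) * ((2 * c) powr t * (2 * A * G) * (n1 * N) powr t))"
              using A G by (simp add: mult_ac flip: ennreal_mult')
            also have "?\<mu> powr - \<nu> * ?\<mu> powr \<nu> = 1" using pos by (simp flip: powr_add)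
            also have "ennreal (1 * ((2 * c) powr t * (2 * A * G) * (n1 * N) powr t)) \<le> ennreal ((A' * N) powr t)"
            proof (rule ennreal_leI)
              have AG: "0 \<le> 2 * A * G" using A G by simp
              have "2 * A * G \<le> (1 + 2 * A * G) powr 1" using AG by simp
              also have "\<dots> \<le> (1 + 2 * A * G) powr t" using AG t1 by (intro powr_mono) auto
              finally have "(2 * c) powr t * (2 * A * G) * (n1 * N) powr t \<le> (2 * c) powr t * (1 + 2 * A * G) powr t * (n1 * N) powr t"
                by (intro mult_right_mono mult_left_mono) auto
              also have "\<dots> = ((2 * c) * (1 + 2 * A * G) * (n1 * N)) powr t"
              proof -
                have "u powr t * v powr t * w powr t = (u * v * w) powr t" if "0 \<le> u" "0 \<le> v" "0 \<le> w" for u v w :: real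
                  using that by (simp add: powr_mult)
                then show ?thesis using c AG N n1[OF ne] by simp
              qed
              also have "(2 * c) * (1 + 2 * A * G) * (n1 * N) = A' * N" by (simp only: A'_def mult_ac)
              finally show "1 * ((2 * c) powr t * (2 * A * G) * (n1 * N) powr t) \<le> (A' * N) powr t" by simp
            qed
            finally show "ennreal (?\<mu> powr - \<nu>) * (\<integral>\<^sup>+y\<in>B x r. ennreal (\<bar>J y\<bar> powr t) \<partial>M) \<le> ennreal ((A' * N) powr t)" .
          qed (use A'0 N h in auto)
          then show ?thesis using N A'0 by (simp add: ennreal_mult)
      qed
      ultimately show "(AE x in M. integrable M (potential_integrand M d \<alpha> f x) \<and>
        integrable M (potential_integrand M d \<alpha> (\<lambda>y. b y * f y) x) \<and>
        \<bar>commutator b (potential M d \<alpha>) f x\<bar> \<le> J x) \<and>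
        morrey_norm M d t \<nu> J \<le> ennreal A' * morrey_norm M d s \<nu> f" by blast
    qed
  qed
qed

end

section \<open>The grand parameters\<close>

text \<open>Mean value theorem on the interval from \<open>y\<close> to \<open>x\<close>, after
  which \<open>y\<close> tends to 0; the limit from the right takes the place of a value at
  0.\<close>

lemma eventually_le_linear_at_right_0:
  fixes A :: "real \<Rightarrow> real"
  assumes C1: "A C1_differentiable_on {0<..\<delta>}" and \<delta>: "0 < \<delta>"
    and lim: "(A \<longlongrightarrow> 0) (at_right 0)" and deriv: "(deriv A \<longlongrightarrow> B) (at_right 0)" and B': "B < B'"
  shows "eventually (\<lambda>x. A x \<le> B' * x) (at_right 0)"
proof -
  have "eventually (\<lambda>x. deriv A x < B') (at_right 0)" by (rule order_tendstoD(2)[OF deriv B'])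
  then obtain r where r: "0 < r" "\<And>x. 0 < x \<Longrightarrow> x < r \<Longrightarrow> deriv A x < B'"
    by (auto simp: eventually_at_right_field)
  have D: "(A has_real_derivative deriv A x) (at x)" if "0 < x" "x \<le> \<delta>" for x
  proof -
    have "A differentiable (at x)"
      using C1 that by (auto simp: C1_differentiable_on_eq)
    then show ?thesis by (simp add: DERIV_deriv_iff_real_differentiable)
  qed
  have "A x \<le> B' * x" if x: "0 < x" "x < min r \<delta>" for x
  proof -
    have "eventually (\<lambda>y. A x - B' * (x - y) \<le> A y) (at_right 0)"
      unfolding eventually_at_right_field
    proof (intro exI[of _ x] conjI allI impI)
      fix y assume y: "0 < y" "y < x"
      have "\<exists>z. y < z \<and> z < x \<and> A x - A y = (x - y) * deriv A z"
        using x y by (intro MVT2 D) auto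
      then obtain z where z: "y < z" "z < x" "A x - A y = (x - y) * deriv A z" by blast
      have "(x - y) * deriv A z \<le> (x - y) * B'" using r(2)[of z] z x y by (intro mult_left_mono) auto
      then have "A x - A y \<le> (x - y) * B'" unfolding z(3) .
      then show "A x - B' * (x - y) \<le> A y" by (subst mult.commute) linarith
    qed (use x in simp)
    moreover have "((\<lambda>y. A x - B' * (x - y)) \<longlongrightarrow> A x - B' * (x - 0)) (at_right 0)"
      by (intro tendsto_intros)
    ultimately have "A x - B' * (x - 0) \<le> 0" using lim by (intro tendsto_le[OF _ lim]) auto
    then show ?thesis by simp
  qed
  then show ?thesis unfolding eventually_at_right_field using r(1) \<delta> by (intro exI[of _ "min r \<delta>"]) auto
qed

text \<open>In reciprocals the formula becomes transparent: \<open>phi_bar\<close> solves the Adams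
  relation between the exponents \<open>p - \<eta>\<close> and \<open>q - x\<close> for the Morrey
  parameter \<open>l - A x\<close>.\<close>

lemma phi_bar_inverse:
  assumes "0 < 1 - l + a" "x < q" "0 < \<alpha>" "A x = a"
  shows "1 / (p - phi_bar p q l \<alpha> A x) = 1 / (q - x) + \<alpha> / (1 - l + a)" "phi_bar p q l \<alpha> A x < p"
proof -
  define v y where "v = 1 - l + a" and "y = q - x"
  have pos: "0 < v" "0 < y" "0 < v + \<alpha> * y" using assms by (auto simp: v_def y_def intro!: add_pos_pos)
  have "p - phi_bar p q l \<alpha> A x = y * v / (v + \<alpha> * y)"
  proof -
    have "1 - l + A x - \<alpha> * (x - q) = v + \<alpha> * y" using assms(4) by (simp add: v_def y_def algebra_simps)
    moreover have "(x - q) * (1 - l + A x) = - (y * v)" using assms(4) by (simp add: v_def y_def algebra_simps)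
    ultimately show ?thesis by (simp only: phi_bar_def)
  qed
  moreover have "0 < y * v / (v + \<alpha> * y)" using pos by simp
  moreover have "1 / (y * v / (v + \<alpha> * y)) = 1 / y + \<alpha> / v" using pos by (simp add: field_simps)
  ultimately show "1 / (p - phi_bar p q l \<alpha> A x) = 1 / (q - x) + \<alpha> / (1 - l + a)" "phi_bar p q l \<alpha> A x < p"
    by (auto simp: v_def y_def)
qed

text \<open>By \<open>pq\<close> the factor in the hypothesis on \<open>\<theta>2\<close> is
  \<open>q / p\<close>, whence \<open>\<theta>1 / p \<le> \<theta>2 / q\<close>. The shift from
  \<open>p\<close> to \<open>p - \<eta>\<close> changes the exponent by at most
  \<open>\<theta>1 * \<eta>\<close>, which costs a bounded factor because
  \<open>- \<eta> * ln \<eta> \<le> 1\<close>.\<close>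

lemma powr_grand_weight_le:
  fixes p q \<theta>1 \<theta>2 \<epsilon> \<eta> c \<alpha> l :: real
  assumes p: "1 < p" and q: "1 < q" and pq: "1 / p - 1 / q = \<alpha> / (1 - l)"
    and \<theta>: "0 < \<theta>1" "\<theta>1 * (1 + \<alpha> * q / (1 - l)) \<le> \<theta>2"
    and \<epsilon>: "0 < \<epsilon>" "\<epsilon> \<le> 1" "\<epsilon> < q" and \<eta>: "c * \<epsilon> \<le> \<eta>" "1 \<le> p - \<eta>" and c: "0 < c"
  shows "\<epsilon> powr (\<theta>2 / (q - \<epsilon>)) \<le> (c powr (- (\<theta>1 / p)) * exp \<theta>1) * \<eta> powr (\<theta>1 / (p - \<eta>))"
proof -
  have \<eta>0: "0 < \<eta>" using \<eta> c \<epsilon> by (auto intro: less_le_trans[rotated])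
  have "1 + \<alpha> * q / (1 - l) = q / p"
  proof -
    have "1 + \<alpha> * q / (1 - l) = 1 + q * (1 / p - 1 / q)" using pq by (simp add: mult.commute)
    also have "\<dots> = q / p" using q by (simp add: right_diff_distrib)
    finally show ?thesis .
  qed
  then have "\<theta>1 * (q / p) \<le> \<theta>2" using \<theta> by simp
  then have le1: "\<theta>1 / p \<le> \<theta>2 / q" using p q by (simp add: field_simps)
  have "0 \<le> \<theta>1 / p" using \<theta> p by simp
  then have "0 \<le> \<theta>2 / q" using le1 by linarith
  then have "0 \<le> \<theta>2" using q by (simp add: zero_le_divide_iff)
  then have le2: "\<theta>2 / q \<le> \<theta>2 / (q - \<epsilon>)" using \<epsilon> q by (intro divide_left_mono mult_pos_pos) auto
  have "\<epsilon> powr (\<theta>2 / (q - \<epsilon>)) \<le> \<epsilon> powr (\<theta>1 / p)" using \<epsilon> le1 le2 by (intro powr_mono') auto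
  also have "\<dots> \<le> (\<eta> / c) powr (\<theta>1 / p)"
    using \<epsilon> \<eta> c \<theta> p by (intro powr_mono2) (auto simp: le_divide_eq mult.commute)
  also have "\<dots> = c powr (- (\<theta>1 / p)) * \<eta> powr (\<theta>1 / p)"
    using c \<eta>0 by (simp add: powr_divide powr_minus_divide)
  also have "\<eta> powr (\<theta>1 / p) \<le> exp \<theta>1 * \<eta> powr (\<theta>1 / (p - \<eta>))"
  proof -
    have diff: "\<theta>1 / (p - \<eta>) - \<theta>1 / p = \<theta>1 * \<eta> / (p * (p - \<eta>))" using p \<eta> by (simp add: field_simps)
    have "1 * 1 \<le> p * (p - \<eta>)" using p \<eta> by (intro mult_mono) auto
    then have "\<theta>1 * \<eta> / (p * (p - \<eta>)) \<le> \<theta>1 * \<eta> / 1" "0 \<le> \<theta>1 * \<eta> / (p * (p - \<eta>))"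
      using \<theta> \<eta>0 by (intro divide_left_mono divide_nonneg_nonneg; simp)+
    then have d: "0 \<le> \<theta>1 / (p - \<eta>) - \<theta>1 / p" "\<theta>1 / (p - \<eta>) - \<theta>1 / p \<le> \<theta>1 * \<eta>"
      unfolding diff by simp_all
    have "- (\<theta>1 / (p - \<eta>) - \<theta>1 / p) * ln \<eta> \<le> \<theta>1"
    proof (cases "\<eta> \<le> 1")
      case True
      have ln: "- ln \<eta> \<le> 1 / \<eta>" "0 \<le> - ln \<eta>"
        using ln_le_minus_one[of "1 / \<eta>"] \<eta>0 True by (auto simp: ln_div)
      have "(\<theta>1 / (p - \<eta>) - \<theta>1 / p) * (- ln \<eta>) \<le> (\<theta>1 * \<eta>) * (1 / \<eta>)"
        using d ln \<theta> \<eta>0 by (intro mult_mono) auto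
      also have "\<dots> = \<theta>1" using \<eta>0 by simp
      finally show ?thesis by (simp only: mult_minus_left mult_minus_right)
    next
      case False
      then have "0 \<le> (\<theta>1 / (p - \<eta>) - \<theta>1 / p) * ln \<eta>" using d by (intro mult_nonneg_nonneg) auto
      then show ?thesis using \<theta> by (simp only: mult_minus_left)
    qed
    moreover have "Y * w \<le> z + X * w" if "- (X - Y) * w \<le> z" for X Y w z :: real
      using that by (simp add: algebra_simps)
    ultimately have "exp (\<theta>1 / p * ln \<eta>) \<le> exp (\<theta>1 + \<theta>1 / (p - \<eta>) * ln \<eta>)"
      by (simp only: exp_le_cancel_iff)
    then show ?thesis using \<eta>0 by (simp add: powr_def exp_add)
  qed
  finally show ?thesis by (simp add: mult.assoc mult_left_mono)
qed

lemma grand_parameters: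
  fixes p q l \<alpha> \<theta>1 \<theta>2 \<delta> \<delta>1 \<delta>2 B :: real and A1 A2 :: "real \<Rightarrow> real"
  assumes p: "1 < p" and l: "0 < l" "l < 1" and \<alpha>: "0 < \<alpha>" "\<alpha> < (1 - l) / p"
    and pq: "1 / p - 1 / q = \<alpha> / (1 - l)"
    and \<theta>: "0 < \<theta>1" "\<theta>1 * (1 + \<alpha> * q / (1 - l)) \<le> \<theta>2"
    and A2_nonneg: "\<And>x. x \<in> {0<..q - 1} \<Longrightarrow> 0 \<le> A2 x"
    and \<delta>: "0 < \<delta>" and C1: "A2 C1_differentiable_on {0<..\<delta>}"
    and lim: "(A2 \<longlongrightarrow> 0) (at_right 0)" and deriv: "(deriv A2 \<longlongrightarrow> B) (at_right 0)"
    and B: "B < (1 - l)\<^sup>2 / (\<alpha> * q\<^sup>2)"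
    and \<delta>1: "0 < \<delta>1" "\<delta>1 \<le> p - 1" and \<delta>2: "0 < \<delta>2" "\<delta>2 \<le> q - 1"
    and bij: "bij_betw (phi_bar p q l \<alpha> A2) {0<..\<delta>2} {0<..\<delta>1}"
    and A1_eq: "\<And>\<eta>. \<eta> \<in> {0<..\<delta>1} \<Longrightarrow> A1 \<eta> = A2 (inv_into {0<..\<delta>2} (phi_bar p q l \<alpha> A2) \<eta>)"
  shows "\<exists>\<epsilon>1 C2. 0 < \<epsilon>1 \<and> \<epsilon>1 \<le> q - 1 \<and> 0 < C2 \<and> (\<forall>\<epsilon>. 0 < \<epsilon> \<and> \<epsilon> \<le> \<epsilon>1 \<longrightarrow>
    (\<exists>\<eta>. 0 < \<eta> \<and> \<eta> < s_max p l A1 \<and> A1 \<eta> = A2 \<epsilon> \<and> (1 + p) / 2 \<le> p - \<eta> \<and>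
      1 / (p - \<eta>) - 1 / (q - \<epsilon>) = \<alpha> / (1 - (l - A2 \<epsilon>)) \<and> 0 \<le> l - A2 \<epsilon> \<and>
      \<epsilon> powr (\<theta>2 / (q - \<epsilon>)) \<le> C2 * \<eta> powr (\<theta>1 / (p - \<eta>))))"
proof -
  let ?\<phi> = "phi_bar p q l \<alpha> A2"
  have q: "1 < q" using \<delta>2 by simp
  obtain B' where B': "B < B'" "B' < (1 - l)\<^sup>2 / (\<alpha> * q\<^sup>2)" using dense[OF B] by blast
  \<comment> \<open>A lower bound for the slope of \<open>phi_bar\<close> at 0:
    \<open>1 / q\<^sup>2\<close> comes from the change of \<open>q - \<epsilon>\<close>, the other
    term from that of the Morrey parameter. The bound on \<open>B\<close> is what makes it
    positive.\<close>
  define c where "c = 1 / q\<^sup>2 - \<alpha> * B' / (1 - l)\<^sup>2"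
  have c: "0 < c"
  proof -
    have "\<alpha> * B' / (1 - l)\<^sup>2 < \<alpha> * ((1 - l)\<^sup>2 / (\<alpha> * q\<^sup>2)) / (1 - l)\<^sup>2"
      using B'(2) \<alpha> l by (intro divide_strict_right_mono mult_strict_left_mono) auto
    also have "\<dots> = 1 / q\<^sup>2" using \<alpha> l by simp
    finally show ?thesis by (simp add: c_def)
  qed
  \<comment> \<open>The relation \<open>pq\<close> says that the formula for \<open>phi_bar\<close>
    vanishes at 0.\<close>
  have p_eq: "p + (0 - q) * (1 - l + 0) / (1 - l + 0 - \<alpha> * (0 - q)) = 0"
  proof -
    have "1 / p = 1 / q + \<alpha> / (1 - l)" using pq by simp
    also have "\<dots> = (1 - l + \<alpha> * q) / (q * (1 - l))" using q l by (simp add: field_simps)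
    finally have "p = 1 / ((1 - l + \<alpha> * q) / (q * (1 - l)))" by (metis divide_divide_eq_right div_by_1 mult_1)
    then show ?thesis by simp
  qed
  have "(?\<phi> \<longlongrightarrow> p + (0 - q) * (1 - l + 0) / (1 - l + 0 - \<alpha> * (0 - q))) (at_right 0)"
  proof -
    have "0 < 1 - l + \<alpha> * q" using l \<alpha> q by (intro add_pos_pos mult_pos_pos) auto
    then show ?thesis unfolding phi_bar_def by (intro tendsto_intros lim) simp
  qed
  then have \<phi>_lim: "(?\<phi> \<longlongrightarrow> 0) (at_right 0)" by (simp only: p_eq)
  have ev: "eventually (\<lambda>x. A2 x \<le> B' * x \<and> A2 x < l \<and> ?\<phi> x < (p - 1) / 2 \<and> x < \<delta>2 \<and> x < 1) (at_right 0)"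
    using l p \<delta>2
    by (intro eventually_conj eventually_le_linear_at_right_0[OF C1 \<delta> lim deriv B'(1)]
        order_tendstoD(2)[OF lim] order_tendstoD(2)[OF \<phi>_lim] order_tendstoD(2)[OF tendsto_ident_at]) auto
  then obtain r where r: "0 < r" "\<And>x. 0 < x \<Longrightarrow> x < r \<Longrightarrow> A2 x \<le> B' * x \<and> A2 x < l \<and> ?\<phi> x < (p - 1) / 2 \<and> x < \<delta>2 \<and> x < 1"
    by (auto simp: eventually_at_right_field)
  have in_dom: "x \<in> {0<..\<delta>2}" if "0 < x" "x < r" for x using r(2)[OF that] that by auto
  have \<phi>_in: "?\<phi> x \<in> {0<..\<delta>1}" if "0 < x" "x < r" for x
    using bij_betwE[OF bij] in_dom[OF that] by blast
  have A1_\<phi>: "A1 (?\<phi> x) = A2 x" if "0 < x" "x < r" for x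
    using A1_eq[OF \<phi>_in[OF that]] inv_into_f_f[OF bij_betw_imp_inj_on[OF bij] in_dom[OF that]] by simp
  \<comment> \<open>A positive lower bound for \<open>s_max\<close>: since
    \<open>A1 \<eta>0 < l\<close>, the supremum defining it is at least \<open>\<eta>0\<close>, and
    all smaller values of \<open>phi_bar\<close> are admissible.\<close>
  define \<eta>0 where "\<eta>0 = ?\<phi> (r / 2)"
  have \<eta>0: "0 < \<eta>0" "\<eta>0 \<le> \<delta>1" "\<eta>0 < (p - 1) / 2" "A1 \<eta>0 < l"
    using \<phi>_in[of "r / 2"] r(2)[of "r / 2"] A1_\<phi>[of "r / 2"] r(1) by (auto simp: \<eta>0_def)
  have "eventually (\<lambda>x. ?\<phi> x < \<eta>0) (at_right 0)" by (rule order_tendstoD(2)[OF \<phi>_lim \<eta>0(1)])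
  then obtain r' where r': "0 < r'" "\<And>x. 0 < x \<Longrightarrow> x < r' \<Longrightarrow> ?\<phi> x < \<eta>0"
    by (auto simp: eventually_at_right_field)
  have s_max: "\<eta>0 \<le> s_max p l A1"
  proof -
    have "\<eta>0 \<le> Sup {x \<in> {0<..p - 1}. A1 x \<le> l}"
      using \<eta>0 \<delta>1 by (intro cSup_upper) (auto intro!: bdd_aboveI[of _ "p - 1"])
    then show ?thesis using \<eta>0 p by (simp add: s_max_def)
  qed
  define \<epsilon>1 where "\<epsilon>1 = min r r' / 2"
  define C2 where "C2 = c powr (- (\<theta>1 / p)) * exp \<theta>1"
  have \<epsilon>1: "0 < \<epsilon>1" "\<epsilon>1 < r" "\<epsilon>1 < r'" using r r' by (auto simp: \<epsilon>1_def)
  have "0 < C2" using c by (simp add: C2_def)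
  moreover have "\<epsilon>1 \<le> q - 1" using in_dom[OF \<epsilon>1(1,2)] \<delta>2 by simp
  moreover have "\<exists>\<eta>. 0 < \<eta> \<and> \<eta> < s_max p l A1 \<and> A1 \<eta> = A2 \<epsilon> \<and> (1 + p) / 2 \<le> p - \<eta> \<and>
      1 / (p - \<eta>) - 1 / (q - \<epsilon>) = \<alpha> / (1 - (l - A2 \<epsilon>)) \<and> 0 \<le> l - A2 \<epsilon> \<and>
      \<epsilon> powr (\<theta>2 / (q - \<epsilon>)) \<le> C2 * \<eta> powr (\<theta>1 / (p - \<eta>))"
    if \<epsilon>: "0 < \<epsilon>" "\<epsilon> \<le> \<epsilon>1" for \<epsilon>
  proof (intro exI[of _ "?\<phi> \<epsilon>"] conjI)
    have \<epsilon>r: "\<epsilon> < r" "\<epsilon> < r'" using \<epsilon> \<epsilon>1 by auto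
    note R = r(2)[OF \<epsilon>(1) \<epsilon>r(1)]
    have A20: "0 \<le> A2 \<epsilon>" using A2_nonneg[of \<epsilon>] R \<epsilon> \<delta>2 by simp
    have \<epsilon>q: "\<epsilon> < q" using R \<delta>2 by simp
    show "0 < ?\<phi> \<epsilon>" using \<phi>_in[OF \<epsilon>(1) \<epsilon>r(1)] by simp
    show "?\<phi> \<epsilon> < s_max p l A1" using r'(2)[OF \<epsilon>(1) \<epsilon>r(2)] s_max by simp
    show "A1 (?\<phi> \<epsilon>) = A2 \<epsilon>" by (rule A1_\<phi>[OF \<epsilon>(1) \<epsilon>r(1)])
    show s0: "(1 + p) / 2 \<le> p - ?\<phi> \<epsilon>" using R by (simp add: field_simps)
    have inv: "1 / (p - ?\<phi> \<epsilon>) = 1 / (q - \<epsilon>) + \<alpha> / (1 - l + A2 \<epsilon>)"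
      using l A20 \<epsilon>q \<alpha> by (intro phi_bar_inverse) auto
    then show "1 / (p - ?\<phi> \<epsilon>) - 1 / (q - \<epsilon>) = \<alpha> / (1 - (l - A2 \<epsilon>))" by simp
    show "0 \<le> l - A2 \<epsilon>" using R by simp
    define \<eta> where "\<eta> = ?\<phi> \<epsilon>"
    have \<eta>1: "1 \<le> p - \<eta>" using s0 p by (simp add: \<eta>_def)
    have \<eta>_pos: "0 < \<eta>" using \<phi>_in[OF \<epsilon>(1) \<epsilon>r(1)] by (simp add: \<eta>_def)
    have "c * \<epsilon> \<le> \<eta>"
    proof -
      have e1: "1 / (q - \<epsilon>) - 1 / q \<ge> \<epsilon> / q\<^sup>2"
      proof -
        have "\<epsilon> / q\<^sup>2 \<le> \<epsilon> / (q * (q - \<epsilon>))"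
          using \<epsilon> \<epsilon>q q by (intro divide_left_mono mult_pos_pos) (auto simp: power2_eq_square)
        also have "\<dots> = 1 / (q - \<epsilon>) - 1 / q" using \<epsilon>q q by (simp add: field_simps)
        finally show ?thesis .
      qed
      have e2: "\<alpha> / (1 - l) - \<alpha> / (1 - l + A2 \<epsilon>) \<le> \<alpha> * B' / (1 - l)\<^sup>2 * \<epsilon>"
      proof -
        have "\<alpha> / (1 - l) - \<alpha> / (1 - l + A2 \<epsilon>) = \<alpha> * A2 \<epsilon> / ((1 - l) * (1 - l + A2 \<epsilon>))"
          using l A20 by (simp add: field_simps)
        also have "\<dots> \<le> \<alpha> * A2 \<epsilon> / ((1 - l) * (1 - l))"
          using l A20 \<alpha> by (intro divide_left_mono mult_left_mono mult_pos_pos) auto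
        also have "\<dots> \<le> \<alpha> * (B' * \<epsilon>) / ((1 - l) * (1 - l))"
          using R \<alpha> l by (intro divide_right_mono mult_left_mono) auto
        finally show ?thesis by (simp add: power2_eq_square)
      qed
      have "c * \<epsilon> = \<epsilon> / q\<^sup>2 - \<alpha> * B' / (1 - l)\<^sup>2 * \<epsilon>" by (simp add: c_def left_diff_distrib)
      also have "\<dots> \<le> 1 / (p - \<eta>) - 1 / p" using e1 e2 inv pq unfolding \<eta>_def by linarith
      also have "\<dots> = \<eta> / (p * (p - \<eta>))" using p \<eta>1 by (simp add: field_simps)
      also have "\<dots> \<le> \<eta> / 1"
      proof (rule divide_left_mono)
        show "1 \<le> p * (p - \<eta>)" using p \<eta>1 mult_mono[of 1 p 1 "p - \<eta>"] by simp
        then show "0 < p * (p - \<eta>) * 1" by simp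
      qed (use \<eta>_pos in simp)
      finally show ?thesis by simp
    qed
    then show "\<epsilon> powr (\<theta>2 / (q - \<epsilon>)) \<le> C2 * ?\<phi> \<epsilon> powr (\<theta>1 / (p - ?\<phi> \<epsilon>))"
      unfolding C2_def \<eta>_def[symmetric]
      using p q pq \<theta> \<epsilon> R \<epsilon>q \<eta>1 c by (intro powr_grand_weight_le) auto
  qed
  ultimately show ?thesis using \<epsilon>1 by blast
qed

text \<open>The measure of the ball of radius \<open>d x y\<close> around \<open>x\<close> is an
  integral over \<open>z\<close> of a jointly measurable condition on \<open>x\<close>,
  \<open>y\<close>, \<open>z\<close>. So the kernel is measurable in both variables, and the
  potentials are measurable as integrals with a parameter.\<close>

lemma (in finite_measure) measurable_commutator:
  assumes d: "(\<lambda>(x, y). d x y) \<in> borel_measurable (M \<Otimes>\<^sub>M M)"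
    and [measurable]: "b \<in> borel_measurable M" "f \<in> borel_measurable M"
  shows "commutator b (potential M d \<alpha>) f \<in> borel_measurable M"
proof -
  have [measurable]: "(\<lambda>p. d (fst p) (snd p)) \<in> borel_measurable (M \<Otimes>\<^sub>M M)"
    using d by (simp add: case_prod_beta)
  have c1: "(\<lambda>w. d (fst (fst w)) (snd w)) \<in> borel_measurable ((M \<Otimes>\<^sub>M M) \<Otimes>\<^sub>M M)"
    by (rule measurable_compose[of "\<lambda>w. (fst (fst w), snd w)" _ "M \<Otimes>\<^sub>M M" "\<lambda>p. d (fst p) (snd p)", simplified]) measurable
  have c2: "(\<lambda>w. d (fst (fst w)) (snd (fst w))) \<in> borel_measurable ((M \<Otimes>\<^sub>M M) \<Otimes>\<^sub>M M)"
    by (rule measurable_compose[of fst _ "M \<Otimes>\<^sub>M M" "\<lambda>p. d (fst p) (snd p)"]) measurable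
  note [measurable] = c1 c2
  have "(\<lambda>p. \<integral>\<^sup>+z. (if d (fst p) z < d (fst p) (snd p) then 1 else 0) \<partial>M) \<in> borel_measurable (M \<Otimes>\<^sub>M M)"
  proof (rule borel_measurable_nn_integral)
    show "(\<lambda>(p, z). if d (fst p) z < d (fst p) (snd p) then 1 else 0 :: ennreal) \<in> borel_measurable ((M \<Otimes>\<^sub>M M) \<Otimes>\<^sub>M M)"
      unfolding case_prod_beta by (rule measurable_If) measurable
  qed
  then have "(\<lambda>p. enn2real (\<integral>\<^sup>+z. (if d (fst p) z < d (fst p) (snd p) then 1 else 0) \<partial>M)) \<in> borel_measurable (M \<Otimes>\<^sub>M M)"
    by measurable
  also have "?this \<longleftrightarrow> (\<lambda>p. measure M (qball M d (fst p) (d (fst p) (snd p)))) \<in> borel_measurable (M \<Otimes>\<^sub>M M)"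
  proof (rule measurable_cong)
    fix p assume p: "p \<in> space (M \<Otimes>\<^sub>M M)"
    have "(\<lambda>z. d (fst p) z) \<in> borel_measurable M"
      using measurable_compose_Pair1[of "fst p" M "\<lambda>p. d (fst p) (snd p)" M borel] p by (auto simp: space_pair_measure)
    then have S: "qball M d (fst p) (d (fst p) (snd p)) \<in> sets M" unfolding qball_def by measurable
    have "(\<integral>\<^sup>+z. (if d (fst p) z < d (fst p) (snd p) then 1 else 0) \<partial>M)
      = (\<integral>\<^sup>+z. indicator (qball M d (fst p) (d (fst p) (snd p))) z \<partial>M)"
      by (intro nn_integral_cong) (auto simp: qball_def indicator_def)
    then show "enn2real (\<integral>\<^sup>+z. (if d (fst p) z < d (fst p) (snd p) then 1 else 0) \<partial>M) = measure M (qball M d (fst p) (d (fst p) (snd p)))"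
      using S by (simp add: measure_def)
  qed
  finally have [measurable]: "(\<lambda>p. measure M (qball M d (fst p) (d (fst p) (snd p)))) \<in> borel_measurable (M \<Otimes>\<^sub>M M)" .
  have pot: "potential M d \<alpha> g \<in> borel_measurable M" if [measurable]: "g \<in> borel_measurable M" for g
    unfolding potential_def[abs_def]
  proof (rule borel_measurable_lebesgue_integral)
    show "(\<lambda>(x, y). potential_integrand M d \<alpha> g x y) \<in> borel_measurable (M \<Otimes>\<^sub>M M)"
      unfolding potential_integrand_def case_prod_beta by measurable
  qed
  have "potential M d \<alpha> f \<in> borel_measurable M" "potential M d \<alpha> (\<lambda>y. b y * f y) \<in> borel_measurable M"
    by (intro pot; measurable)+
  then show ?thesis unfolding commutator_def[abs_def] by measurable
qed

section \<open>Grand Morrey spaces\<close>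

text \<open>When the diameter is \<open>0\<close>, Ahlfors regularity makes the only point a null set.\<close>

lemma (in homogeneous_type_space) degenerate_case:
  assumes "space M = {} \<or> qdiam M d \<le> 0"
  shows "emeasure M (space M) = 0" "morrey_norm M d s \<nu> f = 0"
proof -
  have "morrey_norm M d s \<nu> f \<le> 0"
    unfolding morrey_norm_def using assms by (intro SUP_least) auto
  then show "morrey_norm M d s \<nu> f = 0" by simp
  show "emeasure M (space M) = 0"
  proof (cases "space M = {}")
    case False
    then obtain x where x: "x \<in> space M" by blast
    have D: "qdiam M d \<le> 0" using assms False by blast
    have ball: "qball M d x r = space M" if "0 < r" for r
      using B_space[OF x, of r] D that by simp
    obtain \<gamma> c where \<gamma>: "0 < \<gamma>" and c: "\<And>x r. x \<in> space M \<Longrightarrow> 0 < r \<Longrightarrow> measure M (qball M d x r) \<le> c * r powr \<gamma>"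
      using upper_Ahlfors by blast
    have "((\<lambda>r. c * r powr \<gamma>) \<longlongrightarrow> c * 0 powr \<gamma>) (at_right 0)"
      using \<gamma> by (intro tendsto_intros tendsto_powr') (auto simp: eventually_at_right_field intro: exI[of _ 1])
    moreover have "eventually (\<lambda>r. measure M (space M) \<le> c * r powr \<gamma>) (at_right 0)"
      unfolding eventually_at_right_field using c[OF x] ball by (intro exI[of _ 1]) auto
    ultimately have "measure M (space M) \<le> c * 0 powr \<gamma>"
      by (intro tendsto_lowerbound) auto
    then have "measure M (space M) = 0" by (simp add: measure_le_0_iff)
    moreover have "emeasure M (space M) < \<infinity>" using qball_finite[OF x, of 1] ball by simp
    ultimately show ?thesis by (auto simp: measure_def enn2real_eq_0_iff)
  qed simp
qed

text \<open>Beyond \<open>\<epsilon>1\<close> the exponent \<open>q - \<epsilon>\<close> is smaller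
  than at \<open>\<epsilon>1\<close> and, \<open>A2\<close> being monotone, the Morrey parameter is
  not larger. So \<open>morrey_embedding\<close> bounds these terms by the one at
  \<open>\<epsilon>1\<close>, whose weight is a fixed positive number.\<close>

lemma (in homogeneous_type_space_pos) grand_morrey_norm_le:
  fixes p q l \<theta>1 \<theta>2 :: real and A1 A2 :: "real \<Rightarrow> real"
  assumes p: "1 < p" and q: "1 < q" and l: "0 \<le> l" "l < 1" and \<theta>2: "0 \<le> \<theta>2"
    and A2: "\<And>x. x \<in> {0<..q - 1} \<Longrightarrow> 0 \<le> A2 x" "mono_on {0<..q - 1} A2"
    and \<epsilon>1: "0 < \<epsilon>1" "\<epsilon>1 \<le> q - 1" and C2: "0 < C2" and A: "0 \<le> A"
    and J: "J \<in> borel_measurable M"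
    and small: "\<And>\<epsilon>. 0 < \<epsilon> \<Longrightarrow> \<epsilon> \<le> \<epsilon>1 \<Longrightarrow> \<exists>\<eta>. 0 < \<eta> \<and> \<eta> < s_max p l A1 \<and> A1 \<eta> = A2 \<epsilon> \<and>
      \<epsilon> powr (\<theta>2 / (q - \<epsilon>)) \<le> C2 * \<eta> powr (\<theta>1 / (p - \<eta>)) \<and>
      morrey_norm M d (q - \<epsilon>) (l - A2 \<epsilon>) J \<le> ennreal A * morrey_norm M d (p - \<eta>) (l - A2 \<epsilon>) f"
  shows "grand_morrey_norm M d q l \<theta>2 A2 J
    \<le> ennreal (max 1 (q powr \<theta>2 * max 1 (measure M (space M)) powr (1 - l + A2 (q - 1)) / \<epsilon>1 powr (\<theta>2 / (q - \<epsilon>1))) * (C2 * A))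
      * grand_morrey_norm M d p l \<theta>1 A1 f"
proof -
  define W where "W = max 1 (measure M (space M)) powr (1 - l + A2 (q - 1))"
  define Z where "Z = q powr \<theta>2 * W / \<epsilon>1 powr (\<theta>2 / (q - \<epsilon>1))"
  let ?X = "grand_morrey_norm M d p l \<theta>1 A1 f"
  have bound: "ennreal (\<epsilon> powr (\<theta>2 / (q - \<epsilon>))) * morrey_norm M d (q - \<epsilon>) (l - A2 \<epsilon>) J \<le> ennreal (C2 * A) * ?X"
    if \<epsilon>: "0 < \<epsilon>" "\<epsilon> \<le> \<epsilon>1" for \<epsilon>
  proof -
    obtain \<eta> where \<eta>: "0 < \<eta>" "\<eta> < s_max p l A1" "A1 \<eta> = A2 \<epsilon>"
      "\<epsilon> powr (\<theta>2 / (q - \<epsilon>)) \<le> C2 * \<eta> powr (\<theta>1 / (p - \<eta>))"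
      "morrey_norm M d (q - \<epsilon>) (l - A2 \<epsilon>) J \<le> ennreal A * morrey_norm M d (p - \<eta>) (l - A2 \<epsilon>) f"
      using small[OF \<epsilon>] by blast
    have "ennreal (\<epsilon> powr (\<theta>2 / (q - \<epsilon>))) * morrey_norm M d (q - \<epsilon>) (l - A2 \<epsilon>) J
        \<le> ennreal (C2 * \<eta> powr (\<theta>1 / (p - \<eta>))) * (ennreal A * morrey_norm M d (p - \<eta>) (l - A2 \<epsilon>) f)"
      using \<eta> by (intro mult_mono ennreal_leI) auto
    also have "\<dots> = ennreal (C2 * A) * (ennreal (\<eta> powr (\<theta>1 / (p - \<eta>))) * morrey_norm M d (p - \<eta>) (l - A1 \<eta>) f)"
      using C2 A \<eta>(3) by (simp add: ennreal_mult mult_ac)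
    also have "ennreal (\<eta> powr (\<theta>1 / (p - \<eta>))) * morrey_norm M d (p - \<eta>) (l - A1 \<eta>) f \<le> ?X"
      unfolding grand_morrey_norm_def using \<eta> by (intro SUP_upper) auto
    finally show ?thesis by (simp add: mult_left_mono)
  qed
  have max_ge: "ennreal (Y * (C2 * A)) * ?X \<le> ennreal (max 1 Z * (C2 * A)) * ?X" if "Y \<le> max 1 Z" for Y
    using that C2 A by (intro mult_right_mono ennreal_leI) auto
  show ?thesis
    unfolding W_def[symmetric] Z_def[symmetric] grand_morrey_norm_def[of M d q]
  proof (rule SUP_least)
    fix \<epsilon> assume "\<epsilon> \<in> {0<..<s_max q l A2}"
    then have \<epsilon>: "0 < \<epsilon>" "\<epsilon> < q - 1" by (auto simp: s_max_def)
    show "ennreal (\<epsilon> powr (\<theta>2 / (q - \<epsilon>))) * morrey_norm M d (q - \<epsilon>) (l - A2 \<epsilon>) J \<le> ennreal (max 1 Z * (C2 * A)) * ?X"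
    proof (cases "\<epsilon> \<le> \<epsilon>1")
      case True
      then show ?thesis using bound[OF \<epsilon>(1)] max_ge[of 1] by (auto intro: order_trans)
    next
      case False
      show ?thesis
      \<comment> \<open>In \<open>ennreal\<close> infinity times 0 is 0, so an infinite norm settles
        the claim only if the constant is positive. In all other cases the right-hand side of
        \<open>bound\<close> is finite.\<close>
      proof (cases "?X = \<infinity> \<and> 0 < C2 * A")
        case True
        then have "0 < max 1 Z * (C2 * A)" by (intro mult_pos_pos[of "max 1 Z"]) auto
        then have "ennreal (max 1 Z * (C2 * A)) \<noteq> 0" by (simp only: ennreal_eq_0_iff not_le)
        then have "ennreal (max 1 Z * (C2 * A)) * ?X = top"
          using True unfolding infinity_ennreal_def by (metis ennreal_mult_eq_top_iff)
        then show ?thesis by (simp only: top_greatest)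
      next
        case nt: False
        have w1: "0 < \<epsilon>1 powr (\<theta>2 / (q - \<epsilon>1))" using \<epsilon>1 by simp
        have fin: "ennreal (C2 * A) * ?X \<noteq> \<infinity>"
        proof (cases "0 < C2 * A")
          case True
          then show ?thesis using nt by (simp add: ennreal_mult_eq_top_iff)
        next
          case False
          then have "ennreal (C2 * A) = 0" by (simp only: ennreal_eq_0_iff not_less)
          then show ?thesis by simp
        qed
        define R where "R = enn2real (ennreal (C2 * A) * ?X)"
        have R: "ennreal (C2 * A) * ?X = ennreal R" "0 \<le> R"
          using fin by (auto simp: R_def less_top)
        have "ennreal (\<epsilon>1 powr (\<theta>2 / (q - \<epsilon>1))) * morrey_norm M d (q - \<epsilon>1) (l - A2 \<epsilon>1) J \<le> ennreal R"
          using bound[OF \<epsilon>1(1) order_refl] R by simp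
        then have m1: "morrey_norm M d (q - \<epsilon>1) (l - A2 \<epsilon>1) J \<le> ennreal (R / \<epsilon>1 powr (\<theta>2 / (q - \<epsilon>1)))"
        proof -
          assume *: "ennreal (\<epsilon>1 powr (\<theta>2 / (q - \<epsilon>1))) * morrey_norm M d (q - \<epsilon>1) (l - A2 \<epsilon>1) J \<le> ennreal R"
          let ?w = "\<epsilon>1 powr (\<theta>2 / (q - \<epsilon>1))" and ?m = "morrey_norm M d (q - \<epsilon>1) (l - A2 \<epsilon>1) J"
          have "?m = ennreal (1 / ?w) * (ennreal ?w * ?m)"
            using w1 by (simp flip: mult.assoc ennreal_mult)
          also have "\<dots> \<le> ennreal (1 / ?w) * ennreal R" by (intro mult_left_mono *) simp
          also have "\<dots> = ennreal (R / ?w)" using R w1 by (simp flip: ennreal_mult)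
          finally show ?thesis .
        qed
        have mono: "A2 \<epsilon>1 \<le> A2 \<epsilon>" "A2 \<epsilon> \<le> A2 (q - 1)"
          using False \<epsilon> \<epsilon>1 by (auto intro!: mono_onD[OF A2(2)])
        have A20: "0 \<le> A2 \<epsilon>1" using A2(1)[of \<epsilon>1] \<epsilon>1 by simp
        have "morrey_norm M d (q - \<epsilon>) (l - A2 \<epsilon>) J \<le> ennreal (W * (R / \<epsilon>1 powr (\<theta>2 / (q - \<epsilon>1))))"
          unfolding W_def
        proof (rule morrey_embedding[OF J _ _ _ _ _ _ m1])
          show "0 \<le> R / \<epsilon>1 powr (\<theta>2 / (q - \<epsilon>1))" using R by simp
        qed (use False \<epsilon> mono l A20 in auto)
        moreover have "\<epsilon> powr (\<theta>2 / (q - \<epsilon>)) \<le> q powr \<theta>2"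
        proof -
          have e: "0 \<le> \<theta>2 / (q - \<epsilon>)" "\<theta>2 / (q - \<epsilon>) \<le> \<theta>2 / 1"
            using \<theta>2 \<epsilon> divide_left_mono[of 1 "q - \<epsilon>" \<theta>2] by simp_all
          have "\<epsilon> powr (\<theta>2 / (q - \<epsilon>)) \<le> q powr (\<theta>2 / (q - \<epsilon>))" using \<epsilon> e by (intro powr_mono2) auto
          also have "\<dots> \<le> q powr \<theta>2" using e q by (intro powr_mono) auto
          finally show ?thesis .
        qed
        ultimately have "ennreal (\<epsilon> powr (\<theta>2 / (q - \<epsilon>))) * morrey_norm M d (q - \<epsilon>) (l - A2 \<epsilon>) J
            \<le> ennreal (q powr \<theta>2) * ennreal (W * (R / \<epsilon>1 powr (\<theta>2 / (q - \<epsilon>1))))"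
          by (intro mult_mono ennreal_leI) auto
        also have "\<dots> = ennreal (Z * R)"
          using R by (simp add: Z_def W_def mult_ac flip: ennreal_mult)
        also have "\<dots> \<le> ennreal (max 1 Z * R)" using R by (intro ennreal_leI mult_right_mono) auto
        also have "\<dots> = ennreal (max 1 Z) * (ennreal (C2 * A) * ?X)" using R by (simp add: ennreal_mult)
        also have "\<dots> = ennreal (max 1 Z * (C2 * A)) * ?X" using C2 A by (simp add: ennreal_mult mult.assoc)
        finally show ?thesis .
      qed
    qed
  qed
qed

lemma (in homogeneous_type_space_pos) grand_morrey_norm_mono_AE:
  assumes "AE x in M. \<bar>f x\<bar> \<le> \<bar>g x\<bar>" "1 < p"
  shows "grand_morrey_norm M d p l \<theta> A f \<le> grand_morrey_norm M d p l \<theta> A g"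
  unfolding grand_morrey_norm_def
proof (intro SUP_mono bexI)
  fix \<epsilon> assume "\<epsilon> \<in> {0<..<s_max p l A}"
  then have "\<epsilon> < p - 1" by (auto simp: s_max_def)
  then show "ennreal (\<epsilon> powr (\<theta> / (p - \<epsilon>))) * morrey_norm M d (p - \<epsilon>) (l - A \<epsilon>) f
      \<le> ennreal (\<epsilon> powr (\<theta> / (p - \<epsilon>))) * morrey_norm M d (p - \<epsilon>) (l - A \<epsilon>) g"
    using assms by (intro mult_left_mono morrey_norm_mono_AE) auto
qed

lemma morrey_norm_finite:
  assumes "grand_morrey_norm M d p l \<theta> A f < \<infinity>" "0 < \<epsilon>" "\<epsilon> < s_max p l A"
  shows "morrey_norm M d (p - \<epsilon>) (l - A \<epsilon>) f < \<infinity>"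
proof -
  have "ennreal (\<epsilon> powr (\<theta> / (p - \<epsilon>))) * morrey_norm M d (p - \<epsilon>) (l - A \<epsilon>) f \<le> grand_morrey_norm M d p l \<theta> A f"
    unfolding grand_morrey_norm_def using assms by (intro SUP_upper) auto
  also note assms(1)
  finally have "ennreal (\<epsilon> powr (\<theta> / (p - \<epsilon>))) * morrey_norm M d (p - \<epsilon>) (l - A \<epsilon>) f < \<infinity>" .
  then show ?thesis using assms(2) by (auto simp: ennreal_mult_less_top)
qed

text \<open>Integrability of both potential integrands is part of the conclusion, because the
  integral of a non-integrable function is 0 by convention and a bound on the norm alone could be
  hollow. Membership in the target space includes measurability, which is derived from that of
  \<open>d\<close> in both variables.\<close>

theorem corollary4p7:
  fixes T :: "'a topology" and M :: "'a measure" and d :: "'a \<Rightarrow> 'a \<Rightarrow> real"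
    and p q l \<alpha> \<theta>1 \<theta>2 \<delta> \<delta>1 \<delta>2 B :: real
    and A1 A2 :: "real \<Rightarrow> real" and b :: "'a \<Rightarrow> real"
  assumes "homogeneous_type_space T M d"
    and "1 < p" and "0 < l" and "l < 1"
    and "0 < \<alpha>" and "\<alpha> < (1 - l) / p"
    and "1 / p - 1 / q = \<alpha> / (1 - l)"
    and "0 < \<theta>1" and "\<theta>2 \<ge> \<theta>1 * (1 + \<alpha> * q / (1 - l))"
    and "continuous_on {0<..p - 1} A1" and "mono_on {0<..p - 1} A1"
    and "\<And>x. x \<in> {0<..p - 1} \<Longrightarrow> 0 \<le> A1 x"
    and "continuous_on {0<..q - 1} A2" and "mono_on {0<..q - 1} A2"
    and "\<And>x. x \<in> {0<..q - 1} \<Longrightarrow> 0 \<le> A2 x"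
    and "0 < \<delta>" and "\<delta> \<le> q - 1" and "A2 C1_differentiable_on {0<..\<delta>}"
    and "(A2 \<longlongrightarrow> 0) (at_right 0)"
    and "(deriv A2 \<longlongrightarrow> B) (at_right 0)"
    and "0 \<le> B" and "B < (1 - l)\<^sup>2 / (\<alpha> * q\<^sup>2)"
    and "0 < \<delta>1" and "\<delta>1 \<le> p - 1" and "0 < \<delta>2" and "\<delta>2 \<le> q - 1"
    and "bij_betw (phi_bar p q l \<alpha> A2) {0<..\<delta>2} {0<..\<delta>1}"
    and "\<And>\<eta>. \<eta> \<in> {0<..\<delta>1} \<Longrightarrow>
           A1 \<eta> = A2 (inv_into {0<..\<delta>2} (phi_bar p q l \<alpha> A2) \<eta>)"
    and "b \<in> BMO M d"
  shows "\<exists>C::real. C > 0 \<and>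
    (\<forall>f \<in> grand_morrey_space M d p l \<theta>1 A1.
       (AE x in M. integrable M (potential_integrand M d \<alpha> f x) \<and>
                   integrable M (potential_integrand M d \<alpha> (\<lambda>y. b y * f y) x)) \<and>
       grand_morrey_norm M d q l \<theta>2 A2 (commutator b (potential M d \<alpha>) f)
         \<le> ennreal C * grand_morrey_norm M d p l \<theta>1 A1 f \<and>
       ((\<lambda>(x, y). d x y) \<in> borel_measurable (M \<Otimes>\<^sub>M M) \<longrightarrow>
         commutator b (potential M d \<alpha>) f \<in> grand_morrey_space M d q l \<theta>2 A2))"
proof -
  interpret H: homogeneous_type_space T M d by (rule assms(1))
  note p = assms(2) and l = assms(3,4) and \<alpha> = assms(5,6) and pq = assms(7) and \<theta> = assms(8,9)
  note A2_mono = assms(14) and A2_nonneg = assms(15) and bmo = assms(29)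
  have q: "1 < q" using assms(16,17) by simp
  have b_meas: "b \<in> borel_measurable M" using bmo by (simp add: BMO_def)
  show ?thesis
  proof (cases "space M = {} \<or> qdiam M d \<le> 0")
    case True
    note deg = H.degenerate_case[OF True]
    \<comment> \<open>The whole space is a null set here, so every statement holds almost
      everywhere.\<close>
    have AE: "AE x in M. P x" for P
      by (rule AE_I[of _ _ "space M"]) (use deg(1) in auto)
    have fm: "finite_measure M" by (rule finite_measureI) (simp add: deg(1))
    have grand: "grand_morrey_norm M d q l \<theta>2 A2 g = 0" for g
    proof -
      have "grand_morrey_norm M d q l \<theta>2 A2 g \<le> 0"
        unfolding grand_morrey_norm_def deg(2) by (intro SUP_least) simp
      then show ?thesis by simp
    qed
    show ?thesis
    proof (intro exI[of _ 1] conjI ballI impI)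
      fix f assume "f \<in> grand_morrey_space M d p l \<theta>1 A1"
      then have f: "f \<in> borel_measurable M" by (simp add: grand_morrey_space_def)
      show "AE x in M. integrable M (potential_integrand M d \<alpha> f x) \<and>
          integrable M (potential_integrand M d \<alpha> (\<lambda>y. b y * f y) x)" by (rule AE)
      show "grand_morrey_norm M d q l \<theta>2 A2 (commutator b (potential M d \<alpha>) f) \<le> ennreal 1 * grand_morrey_norm M d p l \<theta>1 A1 f"
        by (simp add: grand)
      assume "(\<lambda>(x, y). d x y) \<in> borel_measurable (M \<Otimes>\<^sub>M M)"
      then show "commutator b (potential M d \<alpha>) f \<in> grand_morrey_space M d q l \<theta>2 A2"
        using finite_measure.measurable_commutator[OF fm _ b_meas f] by (simp add: grand_morrey_space_def grand)
    qed simp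
  next
    case False
    then have ne: "space M \<noteq> {}" and D: "0 < qdiam M d" by auto
    obtain K where K: "1 \<le> K"
      "\<And>x y z. x \<in> space M \<Longrightarrow> y \<in> space M \<Longrightarrow> z \<in> space M \<Longrightarrow> d x y \<le> K * (d x z + d z y)"
      "\<And>x y. x \<in> space M \<Longrightarrow> y \<in> space M \<Longrightarrow> d x y \<le> K * d y x"
      "\<And>x y. x \<in> space M \<Longrightarrow> y \<in> space M \<Longrightarrow> 0 \<le> d x y"
      "\<And>x y. x \<in> space M \<Longrightarrow> y \<in> space M \<Longrightarrow> d x y = 0 \<longleftrightarrow> x = y"
      by (rule H.quasimetric_constant) (rule that)
    obtain Cd where Cd: "1 < Cd" "\<forall>x\<in>space M. \<forall>r. 0 < r \<and> r < qdiam M d \<longrightarrow>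
        measure M (qball M d x (2 * r)) \<le> Cd * measure M (qball M d x r)"
      using H.doubling by blast
    interpret P: homogeneous_type_space_pos T M d K Cd
    proof
      show "measure M (qball M d x (2 * r)) \<le> Cd * measure M (qball M d x r)"
        if "x \<in> space M" "0 < r" "r < qdiam M d" for x r using Cd(2) that by blast
    qed (fact D K Cd(1))+
    have "p < q"
    proof -
      have "0 < \<alpha> / (1 - l)" using \<alpha> l by simp
      then have "1 / q < 1 / p" using pq by simp
      then show ?thesis using p q by (simp add: field_simps)
    qed
    have \<alpha>1: "\<alpha> < 1"
    proof -
      have "(1 - l) / p \<le> 1 / 1" using l p by (intro frac_le) auto
      then show ?thesis using \<alpha> by simp
    qed
    have \<theta>2: "0 \<le> \<theta>2"
    proof -
      have "0 \<le> \<theta>1 * (1 + \<alpha> * q / (1 - l))"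
        using \<theta> \<alpha> l q by (intro mult_nonneg_nonneg add_nonneg_nonneg divide_nonneg_nonneg) auto
      then show ?thesis using \<theta> by simp
    qed
    obtain \<epsilon>1 C2 where \<epsilon>1: "0 < \<epsilon>1" "\<epsilon>1 \<le> q - 1" and C2: "0 < C2"
      and par: "\<forall>\<epsilon>. 0 < \<epsilon> \<and> \<epsilon> \<le> \<epsilon>1 \<longrightarrow>
        (\<exists>\<eta>. 0 < \<eta> \<and> \<eta> < s_max p l A1 \<and> A1 \<eta> = A2 \<epsilon> \<and> (1 + p) / 2 \<le> p - \<eta> \<and>
          1 / (p - \<eta>) - 1 / (q - \<epsilon>) = \<alpha> / (1 - (l - A2 \<epsilon>)) \<and> 0 \<le> l - A2 \<epsilon> \<and>
          \<epsilon> powr (\<theta>2 / (q - \<epsilon>)) \<le> C2 * \<eta> powr (\<theta>1 / (p - \<eta>)))"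
      using grand_parameters[OF p l \<alpha> pq \<theta> A2_nonneg assms(16) assms(18-20) assms(22-28)] by blast
    \<comment> \<open>The midpoint keeps all exponents \<open>p - \<eta>\<close> away from 1, where
      the constants would blow up.\<close>
    have s0: "1 < (1 + p) / 2" "(1 + p) / 2 \<le> q" using p \<open>p < q\<close> by auto
    have l0: "0 \<le> l" using l by simp
    obtain A where A: "0 \<le> A" and maj: "\<forall>f\<in>borel_measurable M. \<exists>J\<in>borel_measurable M. \<forall>s t \<nu>.
      (1 + p) / 2 \<le> s \<and> 0 < t \<and> t \<le> q \<and> 0 \<le> \<nu> \<and> \<nu> \<le> l \<and> 1 / s - 1 / t = \<alpha> / (1 - \<nu>) \<and> morrey_norm M d s \<nu> f < \<infinity> \<longrightarrow>
      (AE x in M. integrable M (potential_integrand M d \<alpha> f x) \<and>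
        integrable M (potential_integrand M d \<alpha> (\<lambda>y. b y * f y) x) \<and>
        \<bar>commutator b (potential M d \<alpha>) f x\<bar> \<le> J x) \<and>
      morrey_norm M d t \<nu> J \<le> ennreal A * morrey_norm M d s \<nu> f"
      using P.commutator_majorant[OF bmo ne s0 l0 l(2) \<alpha>(1) \<alpha>1] by blast
    define C0 where "C0 = max 1 (q powr \<theta>2 * max 1 (measure M (space M)) powr (1 - l + A2 (q - 1)) / \<epsilon>1 powr (\<theta>2 / (q - \<epsilon>1))) * (C2 * A)"
    have C0: "0 \<le> C0" using C2 A by (simp add: C0_def)
    show ?thesis
    \<comment> \<open>A positive constant is claimed, and \<open>C0\<close> may be 0.\<close>
    proof (intro exI[of _ "C0 + 1"] conjI ballI impI)
      show "0 < C0 + 1" using C0 by simp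
      fix f assume "f \<in> grand_morrey_space M d p l \<theta>1 A1"
      then have f: "f \<in> borel_measurable M" "grand_morrey_norm M d p l \<theta>1 A1 f < \<infinity>"
        by (simp_all add: grand_morrey_space_def)
      obtain J where J: "J \<in> borel_measurable M" and Jb: "\<And>s t \<nu>. (1 + p) / 2 \<le> s \<and> 0 < t \<and> t \<le> q \<and> 0 \<le> \<nu> \<and> \<nu> \<le> l \<and>
          1 / s - 1 / t = \<alpha> / (1 - \<nu>) \<and> morrey_norm M d s \<nu> f < \<infinity> \<Longrightarrow>
          (AE x in M. integrable M (potential_integrand M d \<alpha> f x) \<and>
            integrable M (potential_integrand M d \<alpha> (\<lambda>y. b y * f y) x) \<and>
            \<bar>commutator b (potential M d \<alpha>) f x\<bar> \<le> J x) \<and>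
          morrey_norm M d t \<nu> J \<le> ennreal A * morrey_norm M d s \<nu> f"
        using bspec[OF maj f(1)] by (elim bexE) (rule that, assumption, (drule spec)+, erule mp, assumption)
      have small: "\<exists>\<eta>. 0 < \<eta> \<and> \<eta> < s_max p l A1 \<and> A1 \<eta> = A2 \<epsilon> \<and>
          \<epsilon> powr (\<theta>2 / (q - \<epsilon>)) \<le> C2 * \<eta> powr (\<theta>1 / (p - \<eta>)) \<and>
          morrey_norm M d (q - \<epsilon>) (l - A2 \<epsilon>) J \<le> ennreal A * morrey_norm M d (p - \<eta>) (l - A2 \<epsilon>) f \<and>
          (AE x in M. integrable M (potential_integrand M d \<alpha> f x) \<and>
            integrable M (potential_integrand M d \<alpha> (\<lambda>y. b y * f y) x) \<and>
            \<bar>commutator b (potential M d \<alpha>) f x\<bar> \<le> J x)"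
        if \<epsilon>: "0 < \<epsilon>" "\<epsilon> \<le> \<epsilon>1" for \<epsilon>
      proof -
        obtain \<eta> where \<eta>: "0 < \<eta>" "\<eta> < s_max p l A1" "A1 \<eta> = A2 \<epsilon>" "(1 + p) / 2 \<le> p - \<eta>"
          "1 / (p - \<eta>) - 1 / (q - \<epsilon>) = \<alpha> / (1 - (l - A2 \<epsilon>))" "0 \<le> l - A2 \<epsilon>"
          "\<epsilon> powr (\<theta>2 / (q - \<epsilon>)) \<le> C2 * \<eta> powr (\<theta>1 / (p - \<eta>))"
          using par \<epsilon> by blast
        have "0 \<le> A2 \<epsilon>" using A2_nonneg[of \<epsilon>] \<epsilon> \<epsilon>1 by simp
        moreover have "morrey_norm M d (p - \<eta>) (l - A2 \<epsilon>) f < \<infinity>"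
          using morrey_norm_finite[OF f(2) \<eta>(1,2)] \<eta>(3) by simp
        ultimately show ?thesis
          using Jb[of "p - \<eta>" "q - \<epsilon>" "l - A2 \<epsilon>"] \<eta> \<epsilon> \<epsilon>1 by (intro exI[of _ \<eta>]) auto
      qed
      \<comment> \<open>A single admissible parameter suffices, as this statement no longer contains
        it.\<close>
      have ae: "AE x in M. integrable M (potential_integrand M d \<alpha> f x) \<and>
            integrable M (potential_integrand M d \<alpha> (\<lambda>y. b y * f y) x) \<and>
            \<bar>commutator b (potential M d \<alpha>) f x\<bar> \<le> J x"
        using small[OF \<epsilon>1(1) order_refl] by blast
      then show "AE x in M. integrable M (potential_integrand M d \<alpha> f x) \<and>
            integrable M (potential_integrand M d \<alpha> (\<lambda>y. b y * f y) x)"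
        by eventually_elim blast
      have "AE x in M. \<bar>commutator b (potential M d \<alpha>) f x\<bar> \<le> \<bar>J x\<bar>" using ae by eventually_elim auto
      then have "grand_morrey_norm M d q l \<theta>2 A2 (commutator b (potential M d \<alpha>) f) \<le> grand_morrey_norm M d q l \<theta>2 A2 J"
        using q by (rule P.grand_morrey_norm_mono_AE)
      also have "\<dots> \<le> ennreal C0 * grand_morrey_norm M d p l \<theta>1 A1 f"
        unfolding C0_def using small
        by (intro P.grand_morrey_norm_le p q l0 l(2) \<theta>2 A2_nonneg A2_mono \<epsilon>1 C2 A J) blast+
      also have "\<dots> \<le> ennreal (C0 + 1) * grand_morrey_norm M d p l \<theta>1 A1 f"
        by (intro mult_right_mono ennreal_leI) auto
      finally show le: "grand_morrey_norm M d q l \<theta>2 A2 (commutator b (potential M d \<alpha>) f)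
          \<le> ennreal (C0 + 1) * grand_morrey_norm M d p l \<theta>1 A1 f" .
      assume "(\<lambda>(x, y). d x y) \<in> borel_measurable (M \<Otimes>\<^sub>M M)"
      then have "commutator b (potential M d \<alpha>) f \<in> borel_measurable M"
        using b_meas f(1) by (rule P.measurable_commutator)
      moreover have "ennreal (C0 + 1) * grand_morrey_norm M d p l \<theta>1 A1 f < \<infinity>"
        using f(2) by (simp add: ennreal_mult_less_top)
      ultimately show "commutator b (potential M d \<alpha>) f \<in> grand_morrey_space M d q l \<theta>2 A2"
        using le by (auto simp: grand_morrey_space_def intro: le_less_trans)
    qed
  qed
qed

end
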